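(* For two methods of creating prediction sets, $PS^1$ and $PS^2$, write $PS^1\leftrightharpoons PS^2$ for the asymptotic equivalence defined in the context. (a) If the family of conformity scores $\mathfrak{C}$ is stable, then $PS^{\mathrm{fc}}\leftrightharpoons PS^{\mathrm{sc}}\leftrightharpoons PS^{\mathrm{cc}}$. (b) For every symmetric prediction algorithm $\mathcal{A}$ that is asymptotically out-of-sample stable, $PI^{\mathrm{sJ}}_{\mathcal{A}}\leftrightharpoons PI^{\mathrm{sJ+}}_{\mathcal{A}}$ (with CC understood for the conformity score $\mathcal{C}^{\mathrm{out}}$ based on $\mathcal{A}$). (c) Assume that the conformity score is the absolute out-of-sample prediction error $\mathcal{C}^{\mathrm{out}}$ of a symmetric prediction algorithm $\mathcal{A}$. (i) Then $PI^{\mathrm{sJ}}_{\mathcal{A}}$ and $PS^{\mathrm{sc}}$ coincide deterministically. (ii) If $\mathcal{A}$ is asymptotically out-of-sample stable, then $$PS^{\mathrm{fc}}\leftrightharpoons PS^{\mathrm{cc}}\leftrightharpoons PS^{\mathrm{sc}}=PI^{\mathrm{sJ}}_{\mathcal{A}}\leftrightharpoons PI^{\mathrm{sJ+}}_{\mathcal{A}} .$$ (iii) If, additionally to the assumption in (ii), the prediction error $y_{n+1}-\mathcal{A}_{n,n}(x_{n+1},\mathcal{T}_n)$ is bounded in probability, then the inflated versions of all four methods $PS^{\mathrm{fc}}$, $PS^{\mathrm{cc}}$, $PI^{\mathrm{sJ}}_{\mathcal{A}}$, $PI^{\mathrm{sJ+}}_{\mathcal{A}}$ are asymptotically uniformly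 conditionally conservative in general, and their non-inflated versions are asymptotically uniformly conditionally valid if CC holds.
   Context: Setting. For every $n\in\mathbb{N}$, $P_n$ is a regular Borel probability measure on $\mathcal{Z}_n=\mathcal{Y}_n\times\mathcal{X}_n$, where $\mathcal{Y}_n\subseteq\mathbb{R}$ is a (possibly unbounded) interval and $\mathcal{X}_n$ is a Euclidean space of dimension $p_n\in\mathbb{N}$. For each $n$, $t_i=t_i^{(n)}=(y_i,x_i)$, $1\le i\le n+1$, are i.i.d. with distribution $P_n$. Put $\mathcal{T}_n=(t_1,\dots,t_n)$, and let $\mathcal{T}_n^{\setminus i}$ be $\mathcal{T}_n$ with $t_i$ removed. $\mathbb{P}(\cdot\,\|\,\mathcal{T}_n)$ is conditional probability given $\mathcal{T}_n$. Conformity scores. $\mathfrak{C}=(\mathcal{C}^{(n)}_m)_{n,m\in\mathbb{N}}$ is a family of measurable functions $\mathcal{C}^{(n)}_m:\mathcal{Z}_n\times\mathcal{Z}_n^m\to\mathbb{R}$, symmetric in their second argument (invariant under permutations of the $m$ entries); the superscript is dropped. $\mathfrak{C}$ is stable if $|\mathcal{C}_n(t_{n+1},\mathcal{T}_n)-\mathcal{C}_{n-1}(t_{n+1},\mathcal{T}_n^{\setminus n})|\to0$ in probability. Continuous case assumption (CC): for every $n$ and almost every $\mathcal{T}_n$, the distribution of $\mathcal{C}_n(t_{n+1},\mathcal{T}_n)$ conditional on $\mathcal{T}_n$ is absolutely continuous with density $f_{\mathcal{T}_n}$, and $(\|f_{\mathcal{T}_n}\|_\infty)_{n}$ is stochastically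 bounded, where $\|f\|_\infty=\sup_x|f(x)|$. Prediction algorithms. A prediction algorithm is a family $\mathcal{A}=(\mathcal{A}_{n,m})_{n,m\in\mathbb{N}}$ of measurable functions $\mathcal{A}_{n,m}:\mathcal{X}_n\times\mathcal{Z}_n^m\to\mathcal{Y}_n$; it is symmetric if it is invariant under permutations of the training points. A symmetric $\mathcal{A}$ is asymptotically out-of-sample stable if $\mathcal{A}_{n,n}(x_{n+1},\mathcal{T}_n)-\mathcal{A}_{n,n-1}(x_{n+1},\mathcal{T}_n^{\setminus n})\to0$ in probability. The absolute out-of-sample prediction error is $\mathcal{C}^{\mathrm{out}}_m((y,x),T)=|y-\mathcal{A}_{n,m}(x,T)|$ for $T\in\mathcal{Z}_n^m$. Quantiles. For a cdf $F$ and $\alpha\in\mathbb{R}$, $F^{-1}(\alpha)=\inf\{x:F(x)\ge\alpha\}\in[-\infty,\infty]$ with $\inf\emptyset=+\infty$. For real $c$, $c\le+\infty$ is true and $c\le-\infty$ is false. Methods (nominal level $1-\alpha$, inflation $\delta$). Full conformal: with $\mathcal{D}_{n+1}^y=(t_1,\dots,t_n,(y,x_{n+1}))$, $\mathcal{D}_{n+1}^y\setminus t_i$ the same with the $i$-th entry removed, and $\hat F_y(s)=\frac{1}{n+1}\mathds{1}\{\mathcal{C}_n((y,x_{n+1}),\mathcal{T}_n)\le s\}+\frac1{n+1}\sum_{i=1}^n\mathds{1}\{\mathcal{C}_n(t_i,\mathcal{D}_{n+1}^y\setminus t_i)\le s\}$, put $PS^{\mathrm{fc}}_{n,\alpha}(\delta)=\{y\in\mathcal{Y}_n:\mathcal{C}_n((y,x_{n+1}),\mathcal{T}_n)\le\hat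 F_y^{-1}(1-\alpha)+\delta\}$. Shortcut: $PS^{\mathrm{sc}}_{n,\alpha}(\delta)=\{y\in\mathcal{Y}_n:\mathcal{C}_n((y,x_{n+1}),\mathcal{T}_n)\le\hat G^{-1}(1-\alpha)+\delta\}$, $\hat G(s)=\frac1n\sum_{i=1}^n\mathds{1}\{\mathcal{C}_{n-1}(t_i,\mathcal{T}_n^{\setminus i})\le s\}$. $n$-fold cross-conformal: $PS^{\mathrm{cc}}_{n,\alpha}(\delta)=\{y\in\mathcal{Y}_n:1+\sum_{i=1}^n\mathds{1}\{\mathcal{C}_{n-1}((y,x_{n+1}),\mathcal{T}_n^{\setminus i})\le\mathcal{C}_{n-1}(t_i,\mathcal{T}_n^{\setminus i})+\delta\}>\alpha(n+1)\}$. Symmetric Jackknife: with $\hat u_i=y_i-\mathcal{A}_{n,n-1}(x_i,\mathcal{T}_n^{\setminus i})$ and $q$ the $(1-\alpha)$-quantile of the empirical cdf of $|\hat u_1|,\dots,|\hat u_n|$, $PI^{\mathrm{sJ}}_{\mathcal{A}}$ is given by $\{y\in\mathcal{Y}_n:|y-\mathcal{A}_{n,n}(x_{n+1},\mathcal{T}_n)|\le q+\delta\}$. Symmetric Jackknife+: with $\hat m_i=\mathcal{A}_{n,n-1}(x_{n+1},\mathcal{T}_n^{\setminus i})$, let $q^{+}$ be the $(1-\alpha)$-quantile of the empirical cdf of $\hat m_1+|\hat u_1|,\dots,\hat m_n+|\hat u_n|$ and $q^-$ the negative of the $(1-\alpha)$-quantile of the empirical cdf of $-\hat m_1+|\hat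 u_1|,\dots,-\hat m_n+|\hat u_n|$; $PI^{\mathrm{sJ+}}_{\mathcal{A}}$ is given by $\{y\in\mathcal{Y}_n:q^--\delta\le y\le q^++\delta\}$. Properties. A method $PS_{n,\alpha}(\delta)$ has asymptotically uniformly conditionally conservative inflated versions if for all $\delta,\epsilon>0$: $\lim_{n}\mathbb{P}(\sup_{\alpha\in[0,1]}[\mathbb{P}(y_{n+1}\notin PS_{n,\alpha}(\delta)\,\|\,\mathcal{T}_n)-\alpha]\ge\epsilon)=0$. Its non-inflated version is asymptotically uniformly conditionally valid if $\lim_n\mathbb{E}(\sup_{\alpha\in[0,1]}|\mathbb{P}(y_{n+1}\notin PS_{n,\alpha}(0)\,\|\,\mathcal{T}_n)-\alpha|)=0$. $PS^1\leftrightharpoons PS^2$ means: (1) the inflated versions of $PS^1$ are asymptotically uniformly conditionally conservative if and only if those of $PS^2$ are; and (2) if CC holds, the non-inflated version of $PS^1$ is asymptotically uniformly conditionally valid if and only if that of $PS^2$ is. *)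

theory Defs
  imports "HOL-Probability.Probability" "HOL-Combinatorics.Permutations"
begin

text \<open>
  The dimensions p n vary with n, so real vectors of length d are functions on the index set {1..d}
  (extensional, as in the library's product spaces), and the Borel sets of the d-dimensional
  space are those of the product space over {1..d}. A training sample of size m is likewise a
  function on {1..m}.
\<close>

type_synonym point = "real \<times> (nat \<Rightarrow> real)"
type_synonym sample = "nat \<Rightarrow> point"
type_synonym score_family = "nat \<Rightarrow> nat \<Rightarrow> point \<Rightarrow> sample \<Rightarrow> real"
type_synonym algorithm = "nat \<Rightarrow> nat \<Rightarrow> (nat \<Rightarrow> real) \<Rightarrow> sample \<Rightarrow> real"

text \<open>Arguments of a method: n, alpha, delta, the new feature vector, the training sample.\<close>
type_synonym pred_method = "nat \<Rightarrow> real \<Rightarrow> real \<Rightarrow> (nat \<Rightarrow> real) \<Rightarrow> sample \<Rightarrow> real set"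

definition feature_space :: "nat \<Rightarrow> (nat \<Rightarrow> real) measure" where
  "feature_space d = (\<Pi>\<^sub>M i\<in>{1..d}. borel)"

definition data_space :: "real set \<Rightarrow> nat \<Rightarrow> point measure" where
  "data_space Y d = restrict_space borel Y \<Otimes>\<^sub>M feature_space d"

definition sample_space :: "real set \<Rightarrow> nat \<Rightarrow> nat \<Rightarrow> sample measure" where
  "sample_space Y d m = (\<Pi>\<^sub>M i\<in>{1..m}. data_space Y d)"

definition training :: "(nat \<Rightarrow> nat \<Rightarrow> 'w \<Rightarrow> point) \<Rightarrow> nat \<Rightarrow> 'w \<Rightarrow> sample" where
  "training t n \<omega> = (\<lambda>i\<in>{1..n}. t n i \<omega>)"

text \<open>The sample of size m - 1 obtained by deleting the i-th entry of a sample of size m.\<close>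
definition remove_entry :: "nat \<Rightarrow> nat \<Rightarrow> sample \<Rightarrow> sample" where
  "remove_entry m i T = (\<lambda>j\<in>{1..m - 1}. if j < i then T j else T (j + 1))"

text \<open>
  The index n = 0 is a dummy. Regularity of P n need not be assumed: every Borel probability
  measure on (a Borel subset of) a Euclidean space is regular.
\<close>
locale iid_array = prob_space M for M :: "'w measure" +
  fixes Y :: "nat \<Rightarrow> real set"
    and p :: "nat \<Rightarrow> nat"
    and P :: "nat \<Rightarrow> point measure"
    and t :: "nat \<Rightarrow> nat \<Rightarrow> 'w \<Rightarrow> point"
  assumes interval: "\<And>n. 1 \<le> n \<Longrightarrow> is_interval (Y n)"
    and prob_space_P: "\<And>n. 1 \<le> n \<Longrightarrow> prob_space (P n)"
    and sets_P: "\<And>n. 1 \<le> n \<Longrightarrow> sets (P n) = sets (data_space (Y n) (p n))"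
    and indep: "\<And>n. 1 \<le> n \<Longrightarrow> indep_vars (\<lambda>_. data_space (Y n) (p n)) (t n) {1..n + 1}"
    and distr_t: "\<And>n i. 1 \<le> n \<Longrightarrow> i \<in> {1..n + 1} \<Longrightarrow>
      distr M (data_space (Y n) (p n)) (t n i) = P n"

definition tendsto_zero_in_prob :: "'w measure \<Rightarrow> (nat \<Rightarrow> 'w \<Rightarrow> real) \<Rightarrow> bool" where
  "tendsto_zero_in_prob M X \<longleftrightarrow>
    (\<forall>\<epsilon>>0. (\<lambda>n. measure M {\<omega> \<in> space M. \<bar>X n \<omega>\<bar> > \<epsilon>}) \<longlonglongrightarrow> 0)"

text \<open>
  Stochastic boundedness (boundedness in probability). The event B only matters if X n is not
  measurable; the bound then concerns outer probability.
\<close>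
definition stoch_bounded :: "'w measure \<Rightarrow> (nat \<Rightarrow> 'w \<Rightarrow> ennreal) \<Rightarrow> bool" where
  "stoch_bounded M X \<longleftrightarrow>
    (\<forall>\<epsilon>>0. \<exists>K::real. \<forall>n\<ge>1. \<exists>B\<in>sets M.
      {\<omega> \<in> space M. X n \<omega> > ennreal K} \<subseteq> B \<and> measure M B \<le> \<epsilon>)"

definition conformity_scores :: "(nat \<Rightarrow> real set) \<Rightarrow> (nat \<Rightarrow> nat) \<Rightarrow> score_family \<Rightarrow> bool" where
  "conformity_scores Y p C \<longleftrightarrow> (\<forall>n\<ge>1. \<forall>m.
    case_prod (C n m) \<in> borel_measurable
      (data_space (Y n) (p n) \<Otimes>\<^sub>M sample_space (Y n) (p n) m) \<and>
    (\<forall>z\<in>space (data_space (Y n) (p n)). \<forall>T\<in>space (sample_space (Y n) (p n) m).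
      \<forall>\<pi>. \<pi> permutes {1..m} \<longrightarrow> C n m z (T \<circ> \<pi>) = C n m z T))"

definition stable_scores ::
  "'w measure \<Rightarrow> (nat \<Rightarrow> nat \<Rightarrow> 'w \<Rightarrow> point) \<Rightarrow> score_family \<Rightarrow> bool" where
  "stable_scores M t C \<longleftrightarrow> tendsto_zero_in_prob M (\<lambda>n \<omega>.
    \<bar>C n n (t n (n + 1) \<omega>) (training t n \<omega>)
      - C n (n - 1) (t n (n + 1) \<omega>) (remove_entry n n (training t n \<omega>))\<bar>)"

definition symmetric_algorithm :: "(nat \<Rightarrow> real set) \<Rightarrow> (nat \<Rightarrow> nat) \<Rightarrow> algorithm \<Rightarrow> bool" where
  "symmetric_algorithm Y p A \<longleftrightarrow> (\<forall>n\<ge>1. \<forall>m.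
    case_prod (A n m) \<in> measurable
      (feature_space (p n) \<Otimes>\<^sub>M sample_space (Y n) (p n) m) (restrict_space borel (Y n)) \<and>
    (\<forall>x\<in>space (feature_space (p n)). \<forall>T\<in>space (sample_space (Y n) (p n) m).
      \<forall>\<pi>. \<pi> permutes {1..m} \<longrightarrow> A n m x (T \<circ> \<pi>) = A n m x T))"

definition oos_stable ::
  "'w measure \<Rightarrow> (nat \<Rightarrow> nat \<Rightarrow> 'w \<Rightarrow> point) \<Rightarrow> algorithm \<Rightarrow> bool" where
  "oos_stable M t A \<longleftrightarrow> tendsto_zero_in_prob M (\<lambda>n \<omega>.
    A n n (snd (t n (n + 1) \<omega>)) (training t n \<omega>)
      - A n (n - 1) (snd (t n (n + 1) \<omega>)) (remove_entry n n (training t n \<omega>)))"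

definition oos_error :: "algorithm \<Rightarrow> score_family" where
  "oos_error A n m z T = \<bar>fst z - A n m (snd z) T\<bar>"

text \<open>
  Given the training sample T, the new data point has conditional distribution P n, by
  independence (see \<open>cond_prob_given_training\<close> below); so the conditional distribution of the score
  is its distribution under P n with T held fixed. The density is only determined up to null sets,
  whence the supremum norm refers to some version f.
\<close>
definition CC ::
  "'w measure \<Rightarrow> (nat \<Rightarrow> point measure) \<Rightarrow> (nat \<Rightarrow> nat \<Rightarrow> 'w \<Rightarrow> point) \<Rightarrow> score_family \<Rightarrow> bool" where
  "CC M P t C \<longleftrightarrow> (\<exists>f :: nat \<Rightarrow> sample \<Rightarrow> real \<Rightarrow> ennreal.
    (\<forall>n\<ge>1. AE \<omega> in M.
      distributed (P n) lborel (\<lambda>z. C n n z (training t n \<omega>)) (f n (training t n \<omega>))) \<and>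
    stoch_bounded M (\<lambda>n \<omega>. SUP s. f n (training t n \<omega>) s))"

definition quantile :: "(real \<Rightarrow> real) \<Rightarrow> real \<Rightarrow> ereal" where
  "quantile F \<alpha> = Inf (ereal ` {s. \<alpha> \<le> F s})"

definition emp_cdf :: "nat \<Rightarrow> (nat \<Rightarrow> real) \<Rightarrow> real \<Rightarrow> real" where
  "emp_cdf n v s = 1 / real n * (\<Sum>i=1..n. of_bool (v i \<le> s))"

definition fc_cdf :: "score_family \<Rightarrow> nat \<Rightarrow> point \<Rightarrow> sample \<Rightarrow> real \<Rightarrow> real" where
  "fc_cdf C n z T s =
    1 / real (n + 1) * of_bool (C n n z T \<le> s)
    + 1 / real (n + 1) *
      (\<Sum>i=1..n. of_bool (C n n (T i) (remove_entry (n + 1) i (T(n + 1 := z))) \<le> s))"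

definition PS_fc :: "(nat \<Rightarrow> real set) \<Rightarrow> score_family \<Rightarrow> pred_method" where
  "PS_fc Y C n \<alpha> \<delta> x T =
    {y \<in> Y n. ereal (C n n (y, x) T) \<le> quantile (fc_cdf C n (y, x) T) (1 - \<alpha>) + ereal \<delta>}"

definition PS_sc :: "(nat \<Rightarrow> real set) \<Rightarrow> score_family \<Rightarrow> pred_method" where
  "PS_sc Y C n \<alpha> \<delta> x T =
    {y \<in> Y n. ereal (C n n (y, x) T)
      \<le> quantile (emp_cdf n (\<lambda>i. C n (n - 1) (T i) (remove_entry n i T))) (1 - \<alpha>) + ereal \<delta>}"

definition PS_cc :: "(nat \<Rightarrow> real set) \<Rightarrow> score_family \<Rightarrow> pred_method" where
  "PS_cc Y C n \<alpha> \<delta> x T =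
    {y \<in> Y n. 1 + (\<Sum>i=1..n. of_bool (C n (n - 1) (y, x) (remove_entry n i T)
        \<le> C n (n - 1) (T i) (remove_entry n i T) + \<delta>)) > \<alpha> * (real n + 1)}"

definition loo_residual :: "algorithm \<Rightarrow> nat \<Rightarrow> sample \<Rightarrow> nat \<Rightarrow> real" where
  "loo_residual A n T i = fst (T i) - A n (n - 1) (snd (T i)) (remove_entry n i T)"

definition loo_prediction :: "algorithm \<Rightarrow> nat \<Rightarrow> (nat \<Rightarrow> real) \<Rightarrow> sample \<Rightarrow> nat \<Rightarrow> real" where
  "loo_prediction A n x T i = A n (n - 1) x (remove_entry n i T)"

definition PI_sJ :: "(nat \<Rightarrow> real set) \<Rightarrow> algorithm \<Rightarrow> pred_method" where
  "PI_sJ Y A n \<alpha> \<delta> x T =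
    {y \<in> Y n. ereal \<bar>y - A n n x T\<bar>
      \<le> quantile (emp_cdf n (\<lambda>i. \<bar>loo_residual A n T i\<bar>)) (1 - \<alpha>) + ereal \<delta>}"

definition PI_sJ_plus :: "(nat \<Rightarrow> real set) \<Rightarrow> algorithm \<Rightarrow> pred_method" where
  "PI_sJ_plus Y A n \<alpha> \<delta> x T =
    (let q_plus = quantile (emp_cdf n (\<lambda>i.
           loo_prediction A n x T i + \<bar>loo_residual A n T i\<bar>)) (1 - \<alpha>);
         q_minus = - quantile (emp_cdf n (\<lambda>i.
           - loo_prediction A n x T i + \<bar>loo_residual A n T i\<bar>)) (1 - \<alpha>)
     in {y \<in> Y n. q_minus - ereal \<delta> \<le> ereal y \<and> ereal y \<le> q_plus + ereal \<delta>})"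

text \<open>
  The conditional probability, given training sample T, that the new response is not covered.
  As a supremum over uncountably many alpha is taken below, a regular version is needed; it is
  provided by the conditional distribution P n of the new data point.
\<close>
definition miscoverage ::
  "(nat \<Rightarrow> point measure) \<Rightarrow> pred_method \<Rightarrow> nat \<Rightarrow> real \<Rightarrow> real \<Rightarrow> sample \<Rightarrow> real" where
  "miscoverage P PS n \<alpha> \<delta> T = measure (P n) {z \<in> space (P n). fst z \<notin> PS n \<alpha> \<delta> (snd z) T}"

lemma (in iid_array) cond_prob_given_training:
  assumes n: "1 \<le> n"
    and S: "S \<in> sets (data_space (Y n) (p n) \<Otimes>\<^sub>M sample_space (Y n) (p n) n)"
  shows "AE \<omega> in M.
    real_cond_exp M (vimage_algebra (space M) (training t n) (sample_space (Y n) (p n) n))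
      (indicator {\<omega> \<in> space M. (t n (n + 1) \<omega>, training t n \<omega>) \<in> S}) \<omega>
    = measure (P n) {z \<in> space (P n). (z, training t n \<omega>) \<in> S}"
proof -
  let ?Z = "data_space (Y n) (p n)" and ?N = "sample_space (Y n) (p n) n"
  let ?F = "vimage_algebra (space M) (training t n) ?N"
  let ?X = "t n (n + 1)" and ?T = "training t n"
  let ?E = "{\<omega> \<in> space M. (?X \<omega>, ?T \<omega>) \<in> S}"
  let ?h = "\<lambda>T. measure (P n) {z \<in> space (P n). (z, T) \<in> S}"
  interpret Pn: prob_space "P n" by (rule prob_space_P[OF n])
  note sP[measurable_cong] = sets_P[OF n]
  have t_meas: "t n i \<in> measurable M ?Z" if "i \<in> {1..n + 1}" for i
    using indep[OF n] that by (auto simp: indep_vars_def)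
  have X[measurable]: "?X \<in> measurable M ?Z" by (rule t_meas) simp
  have X'[measurable]: "t n (Suc n) \<in> measurable M ?Z" using X by simp
  have T[measurable]: "?T \<in> measurable M ?N"
    unfolding training_def sample_space_def by (rule measurable_restrict) (simp add: t_meas)
  note S[measurable]
  let ?Z1 = "PiM {n + 1} (\<lambda>_. ?Z)" and ?X1 = "\<lambda>\<omega>. restrict (\<lambda>i. t n i \<omega>) {n + 1}"
  have X1[measurable]: "?X1 \<in> measurable M ?Z1"
    by (rule measurable_restrict) (simp add: t_meas)
  have iv: "indep_var ?Z1 ?X1 ?N ?T"
    unfolding sample_space_def training_def by (rule indep_var_restrict[OF indep[OF n]]) auto
  have DTp: "prob_space (distr M ?N ?T)" by (rule prob_space_distr) simp
  have joint: "distr M (?Z \<Otimes>\<^sub>M ?N) (\<lambda>\<omega>. (?X \<omega>, ?T \<omega>)) = P n \<Otimes>\<^sub>M distr M ?N ?T"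
  proof -
    have c[measurable]: "(\<lambda>f. f (n + 1)) \<in> measurable ?Z1 ?Z" by (rule measurable_component_singleton) simp
    have "P n = distr (distr M ?Z1 ?X1) ?Z (\<lambda>f. f (n + 1))"
      using distr_t[OF n, of "n + 1"] by (subst distr_distr[OF c X1]) (simp add: comp_def)
    then have "P n \<Otimes>\<^sub>M distr M ?N ?T = distr (distr M ?Z1 ?X1) ?Z (\<lambda>f. f (n + 1)) \<Otimes>\<^sub>M
        distr (distr M ?N ?T) ?N (\<lambda>T. T)"
      by (simp add: distr_id2)
    also have "\<dots> = distr (distr M ?Z1 ?X1 \<Otimes>\<^sub>M distr M ?N ?T) (?Z \<Otimes>\<^sub>M ?N) (\<lambda>(f, T). (f (n + 1), T))"
      by (rule pair_measure_distr)
        (auto simp: distr_id2 intro: prob_space_imp_sigma_finite DTp)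
    also have "distr M ?Z1 ?X1 \<Otimes>\<^sub>M distr M ?N ?T = distr M (?Z1 \<Otimes>\<^sub>M ?N) (\<lambda>\<omega>. (?X1 \<omega>, ?T \<omega>))"
      using iv by (simp add: indep_var_distribution_eq)
    also have "distr \<dots> (?Z \<Otimes>\<^sub>M ?N) (\<lambda>(f, T). (f (n + 1), T)) =
        distr M (?Z \<Otimes>\<^sub>M ?N) (\<lambda>\<omega>. (?X \<omega>, ?T \<omega>))"
      by (subst distr_distr) (measurable, simp add: comp_def)
    finally show ?thesis ..
  qed
  interpret DT: prob_space "distr M ?N ?T" by (rule DTp)
  interpret PT: pair_prob_space "P n" "distr M ?N ?T" ..
  have T_sp: "?T \<in> space M \<rightarrow> space ?N" using measurable_space[OF T] by auto
  have sub: "subalgebra M ?F"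
    unfolding subalgebra_def
    using T by (auto simp: sets_vimage_algebra2[OF T_sp] measurable_sets)
  interpret sigma_finite_subalgebra M ?F
    by (rule finite_measure_subalgebra_is_sigma_finite[OF finite_measure_subalgebra.intro])
      (auto simp: finite_measure_subalgebra_axioms_def sub intro: finite_measure_axioms)
  have h[measurable]: "?h \<in> borel_measurable ?N"
  proof -
    have "(\<lambda>T. enn2real (emeasure (P n) (Pair T -` ((\<lambda>(a, b). (b, a)) -` S \<inter> space (?N \<Otimes>\<^sub>M P n))))) \<in> borel_measurable ?N"
      by (rule measurable_compose[OF Pn.measurable_emeasure_Pair]) measurable
    moreover have "Pair T -` ((\<lambda>(a, b). (b, a)) -` S \<inter> space (?N \<Otimes>\<^sub>M P n)) =
       {z \<in> space (P n). (z, T) \<in> S}" if "T \<in> space ?N" for T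
      using that by (auto simp: space_pair_measure)
    ultimately show ?thesis by (simp add: measure_def cong: measurable_cong)
  qed
  have hF: "(\<lambda>\<omega>. ?h (?T \<omega>)) \<in> borel_measurable ?F"
    by (rule measurable_compose[OF measurable_vimage_algebra1[OF T_sp] h])
  have E[measurable]: "?E \<in> sets M" by measurable
  show ?thesis
  proof (rule real_cond_exp_charact)
    fix A assume "A \<in> sets ?F"
    then obtain B where B[measurable]: "B \<in> sets ?N" and A: "A = ?T -` B \<inter> space M"
      by (auto simp: sets_vimage_algebra2[OF T_sp])
    have AM[measurable]: "A \<in> sets M" unfolding A by measurable
    have "(\<integral>\<omega>\<in>A. indicator ?E \<omega> \<partial>M) =
        (\<integral>\<omega>. (\<lambda>(z, T). indicator B T * indicator S (z, T) :: real) (?X \<omega>, ?T \<omega>) \<partial>M)"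
      unfolding set_lebesgue_integral_def
      by (rule Bochner_Integration.integral_cong) (auto simp: A indicator_def)
    also have "\<dots> = (\<integral>x. (\<lambda>(z, T). indicator B T * indicator S (z, T)) x
        \<partial>distr M (?Z \<Otimes>\<^sub>M ?N) (\<lambda>\<omega>. (?X \<omega>, ?T \<omega>)))"
      by (subst integral_distr) auto
    also have "\<dots> = (\<integral>x. (\<lambda>(z, T). indicator B T * indicator S (z, T)) x \<partial>(P n \<Otimes>\<^sub>M distr M ?N ?T))"
      unfolding joint ..
    also have "\<dots> = (\<integral>T. (\<integral>z. indicator B T * indicator S (z, T) \<partial>P n) \<partial>distr M ?N ?T)"
    proof (rule PT.integral_snd[symmetric])
      show "integrable (P n \<Otimes>\<^sub>M distr M ?N ?T) (\<lambda>(z, T). indicator B T * indicator S (z, T) :: real)"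
        by (rule PT.P.integrable_const_bound[where B = 1]) (auto simp: indicator_def)
    qed
    also have "\<dots> = (\<integral>T. indicator B T * ?h T \<partial>distr M ?N ?T)"
    proof (rule Bochner_Integration.integral_cong[OF refl])
      fix T assume T': "T \<in> space (distr M ?N ?T)"
      have "(\<integral>z. indicator S (z, T) \<partial>P n) = (\<integral>z. indicator {z \<in> space (P n). (z, T) \<in> S} z \<partial>P n :: real)"
        by (rule Bochner_Integration.integral_cong) (auto simp: indicator_def)
      also have "\<dots> = ?h T" by (simp add: Int_absorb2 subsetI)
      finally show "(\<integral>z. indicator B T * indicator S (z, T) \<partial>P n) = indicator B T * ?h T" by simp
    qed
    also have "\<dots> = (\<integral>\<omega>. indicator B (?T \<omega>) * ?h (?T \<omega>) \<partial>M)"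
      by (rule integral_distr) auto
    also have "\<dots> = (\<integral>\<omega>\<in>A. ?h (?T \<omega>) \<partial>M)"
      unfolding set_lebesgue_integral_def
      by (rule Bochner_Integration.integral_cong) (auto simp: A indicator_def)
    finally show "(\<integral>\<omega>\<in>A. indicator ?E \<omega> \<partial>M) = (\<integral>\<omega>\<in>A. ?h (?T \<omega>) \<partial>M)" .
  next
    show "integrable M (indicator ?E :: 'w \<Rightarrow> real)"
      by (rule integrable_const_bound[where B = 1]) (auto simp: indicator_def)
    show "integrable M (\<lambda>\<omega>. ?h (?T \<omega>))"
      by (rule integrable_const_bound[where B = 1]) auto
    show "(\<lambda>\<omega>. ?h (?T \<omega>)) \<in> borel_measurable ?F" by (rule hF)
  qed
qed

definition inflated_conservative ::
  "'w measure \<Rightarrow> (nat \<Rightarrow> point measure) \<Rightarrow> (nat \<Rightarrow> nat \<Rightarrow> 'w \<Rightarrow> point) \<Rightarrow> pred_method \<Rightarrow> bool" where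
  "inflated_conservative M P t PS \<longleftrightarrow> (\<forall>\<delta>>0. \<forall>\<epsilon>>0.
    (\<lambda>n. measure M {\<omega> \<in> space M.
      (SUP \<alpha>\<in>{0..1}. miscoverage P PS n \<alpha> \<delta> (training t n \<omega>) - \<alpha>) \<ge> \<epsilon>}) \<longlonglongrightarrow> 0)"

definition noninflated_valid ::
  "'w measure \<Rightarrow> (nat \<Rightarrow> point measure) \<Rightarrow> (nat \<Rightarrow> nat \<Rightarrow> 'w \<Rightarrow> point) \<Rightarrow> pred_method \<Rightarrow> bool" where
  "noninflated_valid M P t PS \<longleftrightarrow>
    (\<lambda>n. \<integral>\<omega>. (SUP \<alpha>\<in>{0..1}. \<bar>miscoverage P PS n \<alpha> 0 (training t n \<omega>) - \<alpha>\<bar>) \<partial>M) \<longlonglongrightarrow> 0"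

definition asymp_equiv_methods ::
  "'w measure \<Rightarrow> (nat \<Rightarrow> point measure) \<Rightarrow> (nat \<Rightarrow> nat \<Rightarrow> 'w \<Rightarrow> point) \<Rightarrow> score_family
    \<Rightarrow> pred_method \<Rightarrow> pred_method \<Rightarrow> bool" where
  "asymp_equiv_methods M P t C PS1 PS2 \<longleftrightarrow>
    (inflated_conservative M P t PS1 \<longleftrightarrow> inflated_conservative M P t PS2) \<and>
    (CC M P t C \<longrightarrow> (noninflated_valid M P t PS1 \<longleftrightarrow> noninflated_valid M P t PS2))"

end

theory Submission
  imports Defs
begin

text \<open>
  All methods are compared with the shortcut. For each of them the response of the new point is not
  covered at level alpha iff a p-value, which is a statistic of the training sample T and the new
  point, is at most alpha. For the shortcut it is the fraction of the leave-one-out scores of the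
  training points that, after inflation, reach the score of the new point (\<open>not_le_quantile_emp_cdf\<close>).
  The other p-values are fractions of the same kind, with some of the scores replaced by those that
  arise when one training point is added or removed.

  By exchangeability (\<open>integral_score_pair\<close>) stability applies to every pair of points, so that on
  average only a vanishing fraction of the n comparisons is affected by such a replacement by more than
  a small amount (\<open>vanishing_fraction\<close>). Hence each p-value lies between those of the shortcut with a
  slightly smaller and a slightly larger inflation, up to a small error and an event of vanishing
  probability (\<open>close_fc_sc\<close>, \<open>close_cc_sc\<close>, \<open>close_sJ_plus_sc\<close>). By Markov's inequality the conditional
  probability of that event given T vanishes as well, and conservativeness is transferred in both
  directions (\<open>conservative_cong\<close>). For the methods without inflation, the inflation of the shortcut has
  to be removed again. Under a bounded density this costs little, uniformly in alpha
  (\<open>inflation_continuous_sc\<close>, \<open>valid_cong\<close>).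

  It remains to show that the shortcut itself is conservative and valid for stochastically bounded
  nonnegative scores. For a bounded Lipschitz function g, the mean of g over the leave-one-out scores is
  compared in mean square with the conditional mean of g of the score of the new point
  (\<open>mean_square_loo_mean_le\<close>). After expanding the square, stability reduces every mixed term to one
  and the same number, the expectation \<open>pair_mean\<close> of the product of g at the scores of two points with
  respect to the n - 1 remaining ones among n + 1 points. Applied to ramp functions on a finite grid this
  makes the two distribution functions close in the Levy metric (\<open>vanishing_Levy\<close>), and closeness in
  that metric controls the level of the shortcut (\<open>level_upper\<close>, \<open>level_lower\<close>).
\<close>

section \<open>Events whose outer probability tends to zero\<close>

text \<open>Events, not necessarily measurable, whose outer probability tends to zero.\<close>
definition vanishing :: "'w measure \<Rightarrow> (nat \<Rightarrow> 'w set) \<Rightarrow> bool" where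
  "vanishing M A \<longleftrightarrow>
    (\<forall>e>0. \<forall>\<^sub>F n in sequentially. \<exists>B\<in>sets M. A n \<subseteq> B \<and> measure M B \<le> e)"

lemma vanishing_mono:
  assumes "vanishing M B" and "\<forall>\<^sub>F n in sequentially. A n \<subseteq> B n"
  shows "vanishing M A"
  unfolding vanishing_def
proof (intro allI impI)
  fix e :: real assume "e > 0"
  with assms(1) have "\<forall>\<^sub>F n in sequentially. \<exists>B'\<in>sets M. B n \<subseteq> B' \<and> measure M B' \<le> e"
    by (auto simp: vanishing_def)
  with assms(2) show "\<forall>\<^sub>F n in sequentially. \<exists>B\<in>sets M. A n \<subseteq> B \<and> measure M B \<le> e"
    by eventually_elim blast
qed

text \<open>A distribution function is right continuous, so the uncountable suprema over the levels
  can be taken over the rationals, which makes them measurable.\<close>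
lemma SUP_right_continuous:
  fixes f :: "real \<Rightarrow> real"
  assumes bdd: "bdd_above (f ` {0..1})"
    and cont: "\<And>a. a \<in> {0..<1} \<Longrightarrow> continuous (at_right a) f"
  shows "(SUP a\<in>{0..1}. f a) = (SUP a\<in>{0..1} \<inter> \<rat>. f a)"
proof (rule antisym)
  have bdd': "bdd_above (f ` ({0..1} \<inter> \<rat>))" using bdd by (rule bdd_above_mono) auto
  have ne: "{0..1} \<inter> \<rat> \<noteq> ({} :: real set)"
    by (rule ex_in_conv[THEN iffD1], rule exI[of _ 0]) simp
  show "(SUP a\<in>{0..1} \<inter> \<rat>. f a) \<le> (SUP a\<in>{0..1}. f a)"
    using ne by (intro cSUP_subset_mono bdd) auto
  show "(SUP a\<in>{0..1}. f a) \<le> (SUP a\<in>{0..1} \<inter> \<rat>. f a)"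
  proof (rule cSUP_least)
    fix a :: real assume a: "a \<in> {0..1}"
    show "f a \<le> (SUP a\<in>{0..1} \<inter> \<rat>. f a)"
    proof (cases "a = 1")
      case True
      then show ?thesis by (intro cSUP_upper2[OF _ _ order_refl] bdd') auto
    next
      case False
      then have a': "a \<in> {0..<1}" using a by auto
      show ?thesis
      proof (rule ccontr)
        assume "\<not> ?thesis"
        then have "\<forall>\<^sub>F x in at_right a. f x > (SUP a\<in>{0..1} \<inter> \<rat>. f a)"
          using cont[OF a'] by (intro order_tendstoD(1)) (auto simp: continuous_within)
        then obtain b where b: "b > a" "\<And>x. a < x \<Longrightarrow> x < b \<Longrightarrow> f x > (SUP a\<in>{0..1} \<inter> \<rat>. f a)"
          by (auto simp: eventually_at_right_field)
        obtain q where q: "q \<in> \<rat>" "a < q" "q < min b 1"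
          using Rats_dense_in_real[of a "min b 1"] b a' by auto
        have "f q \<le> (SUP a\<in>{0..1} \<inter> \<rat>. f a)"
          using q a' by (intro cSUP_upper bdd') auto
        with b(2)[of q] q show False by simp
      qed
    qed
  qed simp
qed

context prob_space
begin

lemma vanishing_Un:
  assumes "vanishing M A" "vanishing M B"
  shows "vanishing M (\<lambda>n. A n \<union> B n)"
  unfolding vanishing_def
proof (intro allI impI)
  fix e :: real assume "e > 0"
  then have "e / 2 > 0" by simp
  with assms have "\<forall>\<^sub>F n in sequentially. \<exists>A'\<in>sets M. A n \<subseteq> A' \<and> prob A' \<le> e / 2"
    "\<forall>\<^sub>F n in sequentially. \<exists>B'\<in>sets M. B n \<subseteq> B' \<and> prob B' \<le> e / 2"
    unfolding vanishing_def by blast+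
  then show "\<forall>\<^sub>F n in sequentially. \<exists>C\<in>sets M. A n \<union> B n \<subseteq> C \<and> prob C \<le> e"
  proof eventually_elim
    case (elim n)
    then obtain A' B' where "A' \<in> sets M" "A n \<subseteq> A'" "prob A' \<le> e / 2"
      "B' \<in> sets M" "B n \<subseteq> B'" "prob B' \<le> e / 2" by blast
    moreover from this have "prob (A' \<union> B') \<le> e"
      using measure_Un_le[of A' M B'] by simp
    ultimately show ?case by (intro bexI[of _ "A' \<union> B'"]) auto
  qed
qed

lemma vanishing_empty: "vanishing M (\<lambda>n. {})"
  unfolding vanishing_def by (auto intro!: always_eventually exI bexI[of _ "{}"])

lemma vanishing_UN:
  assumes "finite I" "\<And>i. i \<in> I \<Longrightarrow> vanishing M (A i)"
  shows "vanishing M (\<lambda>n. \<Union>i\<in>I. A i n)"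
  using assms
proof (induction I rule: finite_induct)
  case (insert i I)
  then have "vanishing M (\<lambda>n. A i n \<union> (\<Union>i\<in>I. A i n))"
    by (intro vanishing_Un) auto
  then show ?case by simp
qed (simp add: vanishing_empty)

text \<open>A sequence of events vanishes if, up to events of arbitrarily small probability, it is covered
  by vanishing events.\<close>
lemma vanishing_approx:
  assumes "\<And>e. e > 0 \<Longrightarrow> \<exists>A'. vanishing M A' \<and>
    (\<forall>\<^sub>F n in sequentially. \<exists>B\<in>sets M. measure M B \<le> e \<and> A n \<subseteq> A' n \<union> B)"
  shows "vanishing M A"
  unfolding vanishing_def
proof (intro allI impI)
  fix e :: real assume "e > 0"
  then have e2: "e / 2 > 0" by simp
  with assms obtain A' where A': "vanishing M A'"
    and B: "\<forall>\<^sub>F n in sequentially. \<exists>B\<in>sets M. measure M B \<le> e / 2 \<and> A n \<subseteq> A' n \<union> B" by blast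
  from A' e2 have "\<forall>\<^sub>F n in sequentially. \<exists>B\<in>sets M. A' n \<subseteq> B \<and> prob B \<le> e / 2"
    unfolding vanishing_def by blast
  with B show "\<forall>\<^sub>F n in sequentially. \<exists>C\<in>sets M. A n \<subseteq> C \<and> prob C \<le> e"
  proof eventually_elim
    case (elim n)
    then obtain B B' where B: "B \<in> sets M" "measure M B \<le> e / 2" "A n \<subseteq> A' n \<union> B"
      "B' \<in> sets M" "A' n \<subseteq> B'" "prob B' \<le> e / 2" by blast
    moreover from this have "prob (B \<union> B') \<le> e"
      using measure_Un_le[of B M B'] by simp
    ultimately show ?case by (intro bexI[of _ "B \<union> B'"]) auto
  qed
qed

lemma vanishing_imp_tendsto:
  assumes "vanishing M A"
  shows "(\<lambda>n. prob (A n)) \<longlonglongrightarrow> 0"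
proof (rule tendstoI)
  fix e :: real assume "e > 0"
  then have "e / 2 > 0" by simp
  with assms have "\<forall>\<^sub>F n in sequentially. \<exists>B\<in>sets M. A n \<subseteq> B \<and> prob B \<le> e / 2"
    unfolding vanishing_def by blast
  then show "\<forall>\<^sub>F n in sequentially. dist (prob (A n)) 0 < e"
  proof eventually_elim
    case (elim n)
    then obtain B where B: "B \<in> sets M" "A n \<subseteq> B" "prob B \<le> e / 2" by blast
    then have "prob (A n) \<le> prob B" by (intro finite_measure_mono)
    with B \<open>e > 0\<close> show ?case by simp
  qed
qed

lemma tendsto_imp_vanishing:
  assumes "\<forall>\<^sub>F n in sequentially. A n \<in> sets M" "(\<lambda>n. prob (A n)) \<longlonglongrightarrow> 0"
  shows "vanishing M A"
  unfolding vanishing_def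
proof (intro allI impI)
  fix e :: real assume "e > 0"
  with assms(2) have "\<forall>\<^sub>F n in sequentially. prob (A n) < e"
    by (auto dest: order_tendstoD)
  with assms(1) show "\<forall>\<^sub>F n in sequentially. \<exists>B\<in>sets M. A n \<subseteq> B \<and> prob B \<le> e"
    by eventually_elim force
qed

lemma vanishing_Markov:
  fixes X :: "nat \<Rightarrow> 'a \<Rightarrow> real"
  assumes X: "\<forall>\<^sub>F n in sequentially. integrable M (X n) \<and> (\<forall>\<omega>\<in>space M. 0 \<le> X n \<omega>)"
    and lim: "(\<lambda>n. expectation (X n)) \<longlonglongrightarrow> 0" and "\<epsilon> > 0"
  shows "vanishing M (\<lambda>n. {\<omega> \<in> space M. X n \<omega> > \<epsilon>})"
proof (rule tendsto_imp_vanishing)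
  show "\<forall>\<^sub>F n in sequentially. {\<omega> \<in> space M. \<epsilon> < X n \<omega>} \<in> sets M"
    using X
  proof eventually_elim
    case (elim n)
    then have [measurable]: "X n \<in> borel_measurable M" by (auto dest: borel_measurable_integrable)
    show ?case by measurable
  qed
  show "(\<lambda>n. prob {\<omega> \<in> space M. \<epsilon> < X n \<omega>}) \<longlonglongrightarrow> 0"
  proof (rule tendsto_sandwich[of "\<lambda>_. 0" _ _ "\<lambda>n. expectation (X n) / \<epsilon>"])
    show "\<forall>\<^sub>F n in sequentially. prob {\<omega> \<in> space M. \<epsilon> < X n \<omega>} \<le> expectation (X n) / \<epsilon>"
      using X
    proof eventually_elim
      case (elim n)
      then have [measurable]: "X n \<in> borel_measurable M" by (auto dest: borel_measurable_integrable)
      have "prob {\<omega> \<in> space M. \<epsilon> < X n \<omega>} \<le> prob {\<omega> \<in> space M. \<epsilon> \<le> X n \<omega>}"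
        by (rule finite_measure_mono) (force, measurable)
      also have "\<dots> \<le> expectation (X n) / \<epsilon>"
        using elim \<open>\<epsilon> > 0\<close> by (intro integral_Markov_inequality_measure[where A = "{}"]) auto
      finally show ?case .
    qed
    show "(\<lambda>n. expectation (X n) / \<epsilon>) \<longlonglongrightarrow> 0"
      using tendsto_divide[OF lim tendsto_const[of \<epsilon>]] \<open>\<epsilon> > 0\<close> by simp
  qed auto
qed

text \<open>For variables with values in the unit interval, convergence of the expectations to zero
  is convergence to zero in probability.\<close>
lemma expectation_tendsto_0_iff_vanishing:
  fixes X :: "nat \<Rightarrow> 'a \<Rightarrow> real"
  assumes X: "\<forall>\<^sub>F n in sequentially. X n \<in> borel_measurable M \<and> (\<forall>\<omega>\<in>space M. 0 \<le> X n \<omega> \<and> X n \<omega> \<le> 1)"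
  shows "(\<lambda>n. expectation (X n)) \<longlonglongrightarrow> 0 \<longleftrightarrow>
    (\<forall>\<epsilon>>0. vanishing M (\<lambda>n. {\<omega> \<in> space M. X n \<omega> > \<epsilon>}))"
proof
  have int: "\<forall>\<^sub>F n in sequentially. integrable M (X n) \<and> (\<forall>\<omega>\<in>space M. 0 \<le> X n \<omega>)"
    using X
  proof eventually_elim
    case (elim n)
    then show ?case by (intro conjI integrable_const_bound[where B = 1] AE_I2) auto
  qed
  show "\<forall>\<epsilon>>0. vanishing M (\<lambda>n. {\<omega> \<in> space M. X n \<omega> > \<epsilon>})" if "(\<lambda>n. expectation (X n)) \<longlonglongrightarrow> 0"
    using vanishing_Markov[OF int that] by blast
  assume v: "\<forall>\<epsilon>>0. vanishing M (\<lambda>n. {\<omega> \<in> space M. X n \<omega> > \<epsilon>})"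
  show "(\<lambda>n. expectation (X n)) \<longlonglongrightarrow> 0"
  proof (rule tendstoI)
    fix e :: real assume "e > 0"
    then have e3: "e / 3 > 0" by simp
    with v have "\<forall>\<^sub>F n in sequentially. \<exists>B\<in>sets M. {\<omega> \<in> space M. X n \<omega> > e / 3} \<subseteq> B \<and> prob B \<le> e / 3"
      unfolding vanishing_def by blast
    then show "\<forall>\<^sub>F n in sequentially. dist (expectation (X n)) 0 < e"
      using X int
    proof eventually_elim
      case (elim n)
      then obtain B where B: "B \<in> sets M" "{\<omega> \<in> space M. X n \<omega> > e / 3} \<subseteq> B" "prob B \<le> e / 3"
        by blast
      have iB: "integrable M (indicator B :: 'a \<Rightarrow> real)"
        using B(1) by (simp add: less_top[symmetric])
      have "expectation (X n) \<le> expectation (\<lambda>\<omega>. e / 3 + indicator B \<omega>)"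
      proof (rule integral_mono)
        fix \<omega> assume "\<omega> \<in> space M"
        then have "X n \<omega> \<le> e / 3 \<or> \<omega> \<in> B" "X n \<omega> \<le> 1"
          using elim B(2) by (auto simp: not_le[symmetric])
        then show "X n \<omega> \<le> e / 3 + indicator B \<omega>"
          using e3 by (auto simp: indicator_def)
      qed (use elim B iB in \<open>auto intro!: Bochner_Integration.integrable_add\<close>)
      also have "\<dots> = e / 3 + prob B"
        using B iB by (subst Bochner_Integration.integral_add) (auto simp: prob_space)
      also have "\<dots> < e" using B(3) \<open>e > 0\<close> by simp
      finally have "expectation (X n) < e" .
      moreover have "0 \<le> expectation (X n)" using elim by (intro integral_nonneg_AE) auto
      ultimately show ?case by simp
    qed
  qed
qed

lemma continuous_distribution_function:
  fixes X :: "'a \<Rightarrow> real"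
  assumes [measurable]: "X \<in> borel_measurable M"
  shows "continuous (at_right a) (\<lambda>a. prob {x \<in> space M. X x \<le> a})"
proof -
  interpret D: prob_space "distr M borel X" by (rule prob_space_distr) simp
  interpret D: finite_borel_measure "distr M borel X"
    by standard auto
  have "cdf (distr M borel X) = (\<lambda>a. prob {x \<in> space M. X x \<le> a})"
    by (auto simp: cdf_def measure_distr fun_eq_iff intro!: arg_cong[where f = prob])
  then show ?thesis using D.cdf_is_right_cont[of a] by simp
qed

end

section \<open>Exchangeability and conditioning on the training sample\<close>

text \<open>The training sample together with the new point, which has the index n + 1.\<close>
definition full_sample :: "(nat \<Rightarrow> nat \<Rightarrow> 'w \<Rightarrow> point) \<Rightarrow> nat \<Rightarrow> 'w \<Rightarrow> sample" where
  "full_sample t n \<omega> = (\<lambda>i\<in>{1..n + 1}. t n i \<omega>)"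

lemma insert_atLeastAtMost_Suc: "{1..n + 1} = insert (n + 1) {1..n::nat}"
  by auto

text \<open>The full sample, of size n + 1, in a different order.\<close>
definition reindex :: "nat \<Rightarrow> (nat \<Rightarrow> nat) \<Rightarrow> sample \<Rightarrow> sample" where
  "reindex n \<pi> w = (\<lambda>i\<in>{1..n + 1}. w (\<pi> i))"

context iid_array
begin

lemma measurable_t: "1 \<le> n \<Longrightarrow> i \<in> {1..n + 1} \<Longrightarrow> t n i \<in> measurable M (data_space (Y n) (p n))"
  using indep[of n] by (auto simp: indep_vars_def)

lemma measurable_full_sample:
  "1 \<le> n \<Longrightarrow> full_sample t n \<in> measurable M (sample_space (Y n) (p n) (n + 1))"
  unfolding full_sample_def sample_space_def
  by (rule measurable_restrict) (rule measurable_t)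

lemma measurable_training:
  "1 \<le> n \<Longrightarrow> training t n \<in> measurable M (sample_space (Y n) (p n) n)"
  unfolding training_def sample_space_def
  by (rule measurable_restrict) (rule measurable_t, auto)

lemma space_P: "1 \<le> n \<Longrightarrow> space (P n) = space (data_space (Y n) (p n))"
  using sets_P by (rule sets_eq_imp_space_eq)

lemma sets_PiM_P:
  "1 \<le> n \<Longrightarrow> sets (PiM {1..m} (\<lambda>_. P n)) = sets (sample_space (Y n) (p n) m)"
  unfolding sample_space_def by (rule sets_PiM_cong) (auto simp: sets_P)

lemma distr_restrict_t:
  assumes n: "1 \<le> n" and m: "m \<in> {1..n + 1}"
  shows "distr M (sample_space (Y n) (p n) m) (\<lambda>\<omega>. \<lambda>i\<in>{1..m}. t n i \<omega>) = PiM {1..m} (\<lambda>_. P n)"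
proof -
  have "indep_vars (\<lambda>_. data_space (Y n) (p n)) (t n) {1..m}"
    using m by (intro indep_vars_subset[OF indep[OF n]]) auto
  then have "distr M (sample_space (Y n) (p n) m) (\<lambda>\<omega>. \<lambda>i\<in>{1..m}. t n i \<omega>)
      = PiM {1..m} (\<lambda>i. distr M (data_space (Y n) (p n)) (t n i))"
    using m n unfolding sample_space_def
    by (subst indep_vars_iff_distr_eq_PiM'[symmetric]) (auto intro!: measurable_t)
  also have "\<dots> = PiM {1..m} (\<lambda>_. P n)"
    using m n by (intro PiM_cong) (auto simp: distr_t)
  finally show ?thesis .
qed

lemma distr_full_sample:
  "1 \<le> n \<Longrightarrow> distr M (sample_space (Y n) (p n) (n + 1)) (full_sample t n) = PiM {1..n + 1} (\<lambda>_. P n)"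
  using distr_restrict_t[of n "n + 1"] by (simp add: full_sample_def[abs_def])

lemma distr_training:
  "1 \<le> n \<Longrightarrow> distr M (sample_space (Y n) (p n) n) (training t n) = PiM {1..n} (\<lambda>_. P n)"
  using distr_restrict_t[of n n] by (simp add: training_def[abs_def])

lemma space_sample_fun_upd:
  assumes "T \<in> space (sample_space (Y n) (p n) n)" "z \<in> space (data_space (Y n) (p n))"
  shows "T(n + 1 := z) \<in> space (sample_space (Y n) (p n) (n + 1))"
  using assms by (auto simp: sample_space_def space_PiM PiE_def Pi_def extensional_def)

lemma space_restrict_sample:
  assumes "w \<in> space (sample_space (Y n) (p n) (n + 1))"
  shows "restrict w {1..n} \<in> space (sample_space (Y n) (p n) n)"
  using assms by (auto simp: sample_space_def space_PiM PiE_def Pi_def)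

lemma restrict_fun_upd_sample:
  assumes "T \<in> space (sample_space (Y n) (p n) n)"
  shows "restrict (T(n + 1 := z)) {1..n} = T"
  using assms by (auto simp: sample_space_def space_PiM PiE_def extensional_def fun_eq_iff)

lemma measurable_fun_upd_sample:
  "(\<lambda>(T, z). T(n + 1 := z)) \<in> measurable
    (sample_space (Y n) (p n) n \<Otimes>\<^sub>M data_space (Y n) (p n)) (sample_space (Y n) (p n) (n + 1))"
  unfolding sample_space_def insert_atLeastAtMost_Suc by measurable

lemma full_sample_space: "1 \<le> n \<Longrightarrow> \<omega> \<in> space M \<Longrightarrow>
    full_sample t n \<omega> \<in> space (sample_space (Y n) (p n) (n + 1))"
  by (rule measurable_space[OF measurable_full_sample])

lemma training_space: "1 \<le> n \<Longrightarrow> \<omega> \<in> space M \<Longrightarrow>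
    training t n \<omega> \<in> space (sample_space (Y n) (p n) n)"
  by (rule measurable_space[OF measurable_training])

lemma full_sample_eq: "full_sample t n \<omega> = (training t n \<omega>)(n + 1 := t n (n + 1) \<omega>)"
  unfolding full_sample_def training_def by (rule ext) (auto simp: restrict_def)

lemma measurable_fun_upd_P:
  assumes n: "1 \<le> n" and f: "f \<in> borel_measurable (sample_space (Y n) (p n) (n + 1))"
    and T: "T \<in> space (sample_space (Y n) (p n) n)"
  shows "(\<lambda>z. f (T(n + 1 := z))) \<in> borel_measurable (P n)"
proof -
  have "(\<lambda>z. (\<lambda>(T, z). T(n + 1 := z)) (T, z)) \<in>
      measurable (data_space (Y n) (p n)) (sample_space (Y n) (p n) (n + 1))"
    by (rule measurable_compose[OF measurable_Pair1'[OF T] measurable_fun_upd_sample])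
  from measurable_compose[OF this f] show ?thesis
    using sets_P[OF n] by (simp cong: measurable_cong_sets)
qed

lemma measurable_integral_P:
  fixes f :: "sample \<Rightarrow> real"
  assumes n: "1 \<le> n" and f: "f \<in> borel_measurable (sample_space (Y n) (p n) (n + 1))"
  shows "(\<lambda>T. \<integral>z. f (T(n + 1 := z)) \<partial>P n) \<in> borel_measurable (sample_space (Y n) (p n) n)"
proof -
  interpret Pn: prob_space "P n" by (rule prob_space_P[OF n])
  note sets_P[OF n, measurable_cong]
  note measurable_compose[OF measurable_fun_upd_sample f, measurable]
  show ?thesis
  proof (rule Pn.borel_measurable_lebesgue_integral)
    have "(\<lambda>x. f ((\<lambda>(T, z). T(n + 1 := z)) x)) \<in> borel_measurable (sample_space (Y n) (p n) n \<Otimes>\<^sub>M P n)"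
      by measurable
    then show "(\<lambda>(T, z). f (T(n + 1 := z))) \<in> borel_measurable (sample_space (Y n) (p n) n \<Otimes>\<^sub>M P n)"
      by (simp add: case_prod_unfold)
  qed
qed

text \<open>The new point is independent of the training sample, with distribution P n.\<close>
lemma integral_full_sample_Fubini:
  fixes f :: "sample \<Rightarrow> real"
  assumes n: "1 \<le> n" and f: "f \<in> borel_measurable (sample_space (Y n) (p n) (n + 1))"
    and bound: "\<And>w. w \<in> space (sample_space (Y n) (p n) (n + 1)) \<Longrightarrow> \<bar>f w\<bar> \<le> c"
  shows "(\<integral>\<omega>. f (full_sample t n \<omega>) \<partial>M) = (\<integral>\<omega>. (\<integral>z. f ((training t n \<omega>)(n + 1 := z)) \<partial>P n) \<partial>M)"
proof -
  interpret Pn: prob_space "P n" by (rule prob_space_P[OF n])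
  interpret Q: prob_space "PiM {1..n + 1} (\<lambda>_. P n)" by (rule prob_space_PiM) (rule Pn.prob_space_axioms)
  interpret product_prob_space "\<lambda>_. P n" "{1..n + 1}" by standard
  have f': "f \<in> borel_measurable (PiM {1..n + 1} (\<lambda>_. P n))"
    using f sets_PiM_P[OF n, of "n + 1"] by (simp cong: measurable_cong_sets)
  have "space (PiM {1..n + 1} (\<lambda>_. P n)) = space (sample_space (Y n) (p n) (n + 1))"
    using sets_PiM_P[OF n] by (rule sets_eq_imp_space_eq)
  then have "integrable (PiM {1..n + 1} (\<lambda>_. P n)) f"
    using bound by (intro Q.integrable_const_bound[where B = c] f' AE_I2) auto
  then have int: "integrable (PiM (insert (n + 1) {1..n}) (\<lambda>_. P n)) f"
    unfolding insert_atLeastAtMost_Suc .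
  have "(\<integral>\<omega>. f (full_sample t n \<omega>) \<partial>M) = integral\<^sup>L (PiM {1..n + 1} (\<lambda>_. P n)) f"
    unfolding distr_full_sample[OF n, symmetric]
    by (rule integral_distr[symmetric, OF measurable_full_sample[OF n] f])
  also have "\<dots> = (\<integral>T. (\<integral>z. f (T(n + 1 := z)) \<partial>P n) \<partial>PiM {1..n} (\<lambda>_. P n))"
    unfolding insert_atLeastAtMost_Suc by (rule product_integral_insert[OF _ _ int]) auto
  also have "\<dots> = (\<integral>\<omega>. (\<integral>z. f ((training t n \<omega>)(n + 1 := z)) \<partial>P n) \<partial>M)"
    unfolding distr_training[OF n, symmetric]
    by (rule integral_distr[OF measurable_training[OF n] measurable_integral_P[OF n f]])
  finally show ?thesis .
qed

lemma space_reindex: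
  assumes "\<pi> permutes {1..n + 1}" "w \<in> space (sample_space (Y n) (p n) (n + 1))"
  shows "reindex n \<pi> w \<in> space (sample_space (Y n) (p n) (n + 1))"
proof -
  have "\<pi> i \<in> {1..n + 1}" if "i \<in> {1..n + 1}" for i
    using permutes_in_image[OF assms(1)] that by blast
  then show ?thesis
    using assms(2) unfolding sample_space_def space_PiM reindex_def by (auto simp: PiE_def Pi_def)
qed

lemma integral_exchangeable:
  fixes f :: "sample \<Rightarrow> real"
  assumes n: "1 \<le> n" and f: "f \<in> borel_measurable (sample_space (Y n) (p n) (n + 1))"
    and \<pi>: "\<pi> permutes {1..n + 1}"
  shows "(\<integral>\<omega>. f (reindex n \<pi> (full_sample t n \<omega>)) \<partial>M) = (\<integral>\<omega>. f (full_sample t n \<omega>) \<partial>M)"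
proof -
  let ?Q = "PiM {1..n + 1} (\<lambda>_. P n)"
  have in_im: "\<pi> \<in> {1..n + 1} \<rightarrow> {1..n + 1}"
    using permutes_in_image[OF \<pi>] by blast
  have d: "distr ?Q ?Q (reindex n \<pi>) = ?Q"
    unfolding reindex_def[abs_def]
    using distr_PiM_reindex[of "{1..n + 1}" "\<lambda>_. P n" \<pi> "{1..n + 1}"] prob_space_P[OF n]
      permutes_inj_on[OF \<pi>] in_im by simp
  have s: "sets ?Q = sets (sample_space (Y n) (p n) (n + 1))" by (rule sets_PiM_P[OF n])
  have f': "f \<in> borel_measurable ?Q" using f s by (simp cong: measurable_cong_sets)
  have r: "reindex n \<pi> \<in> measurable ?Q ?Q"
    unfolding reindex_def[abs_def] using in_im
    by (intro measurable_restrict measurable_component_singleton) auto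
  have "(\<integral>\<omega>. f (reindex n \<pi> (full_sample t n \<omega>)) \<partial>M) = (\<integral>w. f (reindex n \<pi> w) \<partial>?Q)"
    unfolding distr_full_sample[OF n, symmetric]
    by (rule integral_distr[symmetric, OF measurable_full_sample[OF n]])
      (use measurable_compose[OF r f'] s in \<open>simp cong: measurable_cong_sets\<close>)
  also have "\<dots> = integral\<^sup>L (distr ?Q ?Q (reindex n \<pi>)) f"
    by (rule integral_distr[symmetric, OF r f'])
  also have "\<dots> = (\<integral>\<omega>. f (full_sample t n \<omega>) \<partial>M)"
    unfolding d unfolding distr_full_sample[OF n, symmetric]
    by (rule integral_distr[OF measurable_full_sample[OF n] f])
  finally show ?thesis .
qed

end

section \<open>Prediction methods as families of p-values\<close>

text \<open>
  A p-value for a prediction method: a statistic of the full sample (training sample and new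
  point) such that a response is not covered at level alpha iff its p-value is at most alpha.
\<close>
definition pvalue_of ::
  "(nat \<Rightarrow> real set) \<Rightarrow> (nat \<Rightarrow> nat) \<Rightarrow> pred_method \<Rightarrow> (nat \<Rightarrow> real \<Rightarrow> sample \<Rightarrow> real) \<Rightarrow> bool" where
  "pvalue_of Y p PS \<rho> \<longleftrightarrow> (\<forall>n\<ge>1. \<forall>\<delta>.
    \<rho> n \<delta> \<in> borel_measurable (sample_space (Y n) (p n) (n + 1)) \<and>
    (\<delta> \<ge> 0 \<longrightarrow> (\<forall>\<alpha>\<in>{0..1}. \<forall>z\<in>space (data_space (Y n) (p n)). \<forall>T\<in>space (sample_space (Y n) (p n) n).
      fst z \<notin> PS n \<alpha> \<delta> (snd z) T \<longleftrightarrow> \<rho> n \<delta> (T(n + 1 := z)) \<le> \<alpha>)))"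

text \<open>The conditional distribution function of the p-value, given the training sample T. At alpha it is
  the conditional probability of miscoverage.\<close>
definition pvalue_cdf ::
  "(nat \<Rightarrow> point measure) \<Rightarrow> (nat \<Rightarrow> real \<Rightarrow> sample \<Rightarrow> real) \<Rightarrow> nat \<Rightarrow> real \<Rightarrow> sample \<Rightarrow> real \<Rightarrow> real" where
  "pvalue_cdf P \<rho> n \<delta> T a = measure (P n) {z \<in> space (P n). \<rho> n \<delta> (T(n + 1 := z)) \<le> a}"

text \<open>The new points that, together with the training sample T, belong to an event about the full sample.\<close>
definition sections :: "(nat \<Rightarrow> point measure) \<Rightarrow> nat \<Rightarrow> sample set \<Rightarrow> sample \<Rightarrow> point set" where
  "sections P n A T = {z \<in> space (P n). T(n + 1 := z) \<in> A}"

lemma sets_not_between: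
  fixes f g h :: "'a \<Rightarrow> real"
  assumes [measurable]: "f \<in> borel_measurable N" "g \<in> borel_measurable N" "h \<in> borel_measurable N"
  shows "{w \<in> space N. \<not> (f w - \<kappa> \<le> g w \<and> g w \<le> h w + \<kappa>)} \<in> sets N"
  by measurable

context iid_array
begin

lemma sets_sections:
  assumes n: "1 \<le> n" and A: "A \<in> sets (sample_space (Y n) (p n) (n + 1))"
    and T: "T \<in> space (sample_space (Y n) (p n) n)"
  shows "sections P n A T \<in> sets (P n)"
proof -
  have "(\<lambda>z. indicator A (T(n + 1 := z)) :: real) \<in> borel_measurable (P n)"
    using A by (intro measurable_fun_upd_P[OF n _ T] borel_measurable_indicator)
  then have "{z \<in> space (P n). indicator A (T(n + 1 := z)) = (1::real)} \<in> sets (P n)"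
    by measurable
  then show ?thesis by (simp add: sections_def indicator_eq_1_iff)
qed

lemma measure_section_eq_integral:
  assumes n: "1 \<le> n" and A: "A \<in> sets (sample_space (Y n) (p n) (n + 1))"
    and T: "T \<in> space (sample_space (Y n) (p n) n)"
  shows "measure (P n) (sections P n A T) = (\<integral>z. indicator A (T(n + 1 := z)) \<partial>P n)"
proof -
  have "(\<integral>z. indicator A (T(n + 1 := z)) \<partial>P n) = (\<integral>z. indicator (sections P n A T) z \<partial>P n :: real)"
    by (rule Bochner_Integration.integral_cong) (auto simp: sections_def indicator_def)
  also have "\<dots> = measure (P n) (sections P n A T)"
    by (simp add: sections_def Int_absorb2 subsetI)
  finally show ?thesis ..
qed

lemma measurable_measure_section:
  assumes n: "1 \<le> n" and A: "A \<in> sets (sample_space (Y n) (p n) (n + 1))"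
  shows "(\<lambda>\<omega>. measure (P n) (sections P n A (training t n \<omega>))) \<in> borel_measurable M"
proof -
  have "(\<lambda>\<omega>. \<integral>z. indicator A ((training t n \<omega>)(n + 1 := z)) \<partial>P n :: real) \<in> borel_measurable M"
    using A by (intro measurable_compose[OF measurable_training[OF n] measurable_integral_P[OF n]])
      (rule borel_measurable_indicator)
  then show ?thesis
    using measure_section_eq_integral[OF n A training_space[OF n]]
    by (simp cong: measurable_cong)
qed

lemma expectation_measure_section:
  assumes n: "1 \<le> n" and A: "A \<in> sets (sample_space (Y n) (p n) (n + 1))"
  shows "expectation (\<lambda>\<omega>. measure (P n) (sections P n A (training t n \<omega>))) =
    prob {\<omega> \<in> space M. full_sample t n \<omega> \<in> A}"
proof -
  have "expectation (\<lambda>\<omega>. measure (P n) (sections P n A (training t n \<omega>))) =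
      (\<integral>\<omega>. (\<integral>z. indicator A ((training t n \<omega>)(n + 1 := z)) \<partial>P n) \<partial>M)"
    by (rule Bochner_Integration.integral_cong)
      (auto simp: measure_section_eq_integral[OF n A training_space[OF n]])
  also have "\<dots> = (\<integral>\<omega>. indicator A (full_sample t n \<omega>) \<partial>M)"
    using A by (intro integral_full_sample_Fubini[OF n, symmetric, where c = 1]) (auto simp: indicator_def)
  also have "\<dots> = (\<integral>\<omega>. indicator {\<omega> \<in> space M. full_sample t n \<omega> \<in> A} \<omega> \<partial>M)"
    by (rule Bochner_Integration.integral_cong) (auto simp: indicator_def)
  also have "\<dots> = prob {\<omega> \<in> space M. full_sample t n \<omega> \<in> A}"
    by (simp add: Int_absorb2 subsetI)
  finally show ?thesis .
qed

text \<open>If an event about the full sample becomes improbable, then its conditional probability given the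
  training sample is small with high probability.\<close>
lemma vanishing_conditional:
  assumes A: "\<And>n. 1 \<le> n \<Longrightarrow> A n \<in> sets (sample_space (Y n) (p n) (n + 1))"
    and v: "vanishing M (\<lambda>n. {\<omega> \<in> space M. full_sample t n \<omega> \<in> A n})" and "\<epsilon> > 0"
  shows "vanishing M (\<lambda>n. {\<omega> \<in> space M. measure (P n) (sections P n (A n) (training t n \<omega>)) > \<epsilon>})"
proof (rule vanishing_Markov)
  show "\<forall>\<^sub>F n in sequentially.
       integrable M (\<lambda>\<omega>. measure (P n) (sections P n (A n) (training t n \<omega>))) \<and>
       (\<forall>\<omega>\<in>space M. 0 \<le> measure (P n) (sections P n (A n) (training t n \<omega>)))"
    using eventually_ge_at_top[of 1]
  proof eventually_elim
    case (elim n)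
    interpret Pn: prob_space "P n" by (rule prob_space_P[OF elim])
    show ?case
      by (intro conjI integrable_const_bound[where B = 1] AE_I2 ballI measurable_measure_section elim A)
        auto
  qed
  have "\<forall>\<^sub>F n in sequentially. prob {\<omega> \<in> space M. full_sample t n \<omega> \<in> A n} =
      expectation (\<lambda>\<omega>. measure (P n) (sections P n (A n) (training t n \<omega>)))"
    using eventually_ge_at_top[of 1]
    by eventually_elim (rule expectation_measure_section[symmetric, OF _ A])
  then show "(\<lambda>n. expectation (\<lambda>\<omega>. measure (P n) (sections P n (A n) (training t n \<omega>)))) \<longlonglongrightarrow> 0"
    using vanishing_imp_tendsto[OF v] by (simp cong: tendsto_cong)
qed fact

lemma sets_pvalue_le:
  assumes "pvalue_of Y p PS \<rho>" "1 \<le> n"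
  shows "{w \<in> space (sample_space (Y n) (p n) (n + 1)). \<rho> n \<delta> w \<le> a} \<in>
    sets (sample_space (Y n) (p n) (n + 1))"
proof -
  have [measurable]: "\<rho> n \<delta> \<in> borel_measurable (sample_space (Y n) (p n) (n + 1))"
    using assms by (auto simp: pvalue_of_def)
  show ?thesis by measurable
qed

lemma pvalue_cdf_eq_section:
  assumes n: "1 \<le> n" and T: "T \<in> space (sample_space (Y n) (p n) n)"
  shows "pvalue_cdf P \<rho> n \<delta> T a =
    measure (P n) (sections P n {w \<in> space (sample_space (Y n) (p n) (n + 1)). \<rho> n \<delta> w \<le> a} T)"
  unfolding pvalue_cdf_def sections_def
  using space_sample_fun_upd[OF T]
  by (intro arg_cong[where f = "measure (P n)"]) (auto simp del: fun_upd_apply simp: space_P[OF n])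

lemma measurable_pvalue_cdf:
  assumes "pvalue_of Y p PS \<rho>" "1 \<le> n"
  shows "(\<lambda>\<omega>. pvalue_cdf P \<rho> n \<delta> (training t n \<omega>) a) \<in> borel_measurable M"
  using measurable_measure_section[OF assms(2) sets_pvalue_le[OF assms]]
    pvalue_cdf_eq_section[OF assms(2) training_space[OF assms(2)]]
  by (simp cong: measurable_cong)

lemma pvalue_cdf_bounds:
  assumes n: "1 \<le> n"
  shows "0 \<le> pvalue_cdf P \<rho> n \<delta> T a" "pvalue_cdf P \<rho> n \<delta> T a \<le> 1"
proof -
  interpret Pn: prob_space "P n" by (rule prob_space_P[OF n])
  show "0 \<le> pvalue_cdf P \<rho> n \<delta> T a" "pvalue_cdf P \<rho> n \<delta> T a \<le> 1"
    by (auto simp: pvalue_cdf_def)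
qed

lemma continuous_pvalue_cdf:
  assumes \<rho>: "pvalue_of Y p PS \<rho>" and n: "1 \<le> n" and T: "T \<in> space (sample_space (Y n) (p n) n)"
  shows "continuous (at_right a) (pvalue_cdf P \<rho> n \<delta> T)"
proof -
  interpret Pn: prob_space "P n" by (rule prob_space_P[OF n])
  have "(\<lambda>z. \<rho> n \<delta> (T(n + 1 := z))) \<in> borel_measurable (P n)"
    using \<rho> n by (intro measurable_fun_upd_P[OF n _ T]) (auto simp: pvalue_of_def)
  from Pn.continuous_distribution_function[OF this] show ?thesis
    by (simp add: pvalue_cdf_def[abs_def])
qed

lemma miscoverage_eq_pvalue_cdf:
  assumes \<rho>: "pvalue_of Y p PS \<rho>" and n: "1 \<le> n" and T: "T \<in> space (sample_space (Y n) (p n) n)"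
    and "\<delta> \<ge> 0" "\<alpha> \<in> {0..1}"
  shows "miscoverage P PS n \<alpha> \<delta> T = pvalue_cdf P \<rho> n \<delta> T \<alpha>"
  unfolding miscoverage_def pvalue_cdf_def
  using \<rho>[unfolded pvalue_of_def] n T \<open>\<delta> \<ge> 0\<close> \<open>\<alpha> \<in> {0..1}\<close>
  by (intro arg_cong[where f = "measure (P n)"] Collect_cong conj_cong refl)
    (simp del: fun_upd_apply add: space_P[OF n])

lemma inflated_conservative_iff:
  assumes \<rho>: "pvalue_of Y p PS \<rho>"
  shows "inflated_conservative M P t PS \<longleftrightarrow> (\<forall>\<delta>>0. \<forall>\<epsilon>>0. vanishing M (\<lambda>n.
    {\<omega> \<in> space M. \<exists>\<alpha>\<in>{0..1}. pvalue_cdf P \<rho> n \<delta> (training t n \<omega>) \<alpha> > \<alpha> + \<epsilon>}))"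
    (is "_ \<longleftrightarrow> (\<forall>\<delta>>0. \<forall>\<epsilon>>0. vanishing M (?V \<delta> \<epsilon>))")
proof -
  let ?f = "\<lambda>\<delta> n \<omega> \<alpha>. pvalue_cdf P \<rho> n \<delta> (training t n \<omega>) \<alpha> - \<alpha>"
  let ?S = "\<lambda>\<delta> n \<omega>. SUP \<alpha>\<in>{0..1}. miscoverage P PS n \<alpha> \<delta> (training t n \<omega>) - \<alpha>"
  have bdd: "bdd_above (?f \<delta> n \<omega> ` A)" if "n \<ge> 1" "A \<subseteq> {0..1}" for \<delta> n \<omega> A
    using pvalue_cdf_bounds(2)[OF that(1)] that(2)
    by (intro bdd_aboveI2[where M = 1]) (smt (verit) atLeastAtMost_iff subsetD)
  have S: "?S \<delta> n \<omega> = (SUP \<alpha>\<in>{0..1}. ?f \<delta> n \<omega> \<alpha>)"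
    if "n \<ge> 1" "\<omega> \<in> space M" "\<delta> > 0" for \<delta> n \<omega>
    using that miscoverage_eq_pvalue_cdf[OF \<rho> that(1) training_space[OF that(1,2)]]
    by (intro SUP_cong refl) auto
  have S': "?S \<delta> n \<omega> = (SUP \<alpha>\<in>{0..1} \<inter> \<rat>. ?f \<delta> n \<omega> \<alpha>)"
    if "n \<ge> 1" "\<omega> \<in> space M" "\<delta> > 0" for \<delta> n \<omega>
    unfolding S[OF that] using bdd[OF that(1) order_refl]
    by (rule SUP_right_continuous)
      (intro continuous_diff continuous_ident continuous_pvalue_cdf[OF \<rho> that(1) training_space[OF that(1,2)]])
  have meas: "?S \<delta> n \<in> borel_measurable M" if "n \<ge> 1" "\<delta> > 0" for \<delta> n
  proof -
    have "(\<lambda>\<omega>. SUP \<alpha>\<in>{0..1} \<inter> \<rat>. ?f \<delta> n \<omega> \<alpha>) \<in> borel_measurable M"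
      by (intro borel_measurable_cSUP borel_measurable_diff measurable_pvalue_cdf[OF \<rho> that(1)] bdd[OF that(1)])
        (auto simp: countable_rat intro!: countable_Int2)
    then show ?thesis using S'[OF that(1) _ that(2)] by (simp cong: measurable_cong)
  qed
  have V: "?V \<delta> \<epsilon> n = {\<omega> \<in> space M. ?S \<delta> n \<omega> > \<epsilon>}" if "n \<ge> 1" "\<delta> > 0" for \<delta> \<epsilon> n
  proof -
    have "?S \<delta> n \<omega> > \<epsilon> \<longleftrightarrow> (\<exists>\<alpha>\<in>{0..1}. pvalue_cdf P \<rho> n \<delta> (training t n \<omega>) \<alpha> > \<alpha> + \<epsilon>)"
      if \<omega>: "\<omega> \<in> space M" for \<omega>
      unfolding S[OF \<open>n \<ge> 1\<close> \<omega> \<open>\<delta> > 0\<close>]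
      by (subst less_cSUP_iff) (auto intro: bdd[OF \<open>n \<ge> 1\<close>] simp: less_diff_eq add.commute)
    then show ?thesis by blast
  qed
  show ?thesis
  proof (intro iffI allI impI)
    fix \<delta> \<epsilon> :: real assume c: "inflated_conservative M P t PS" and "\<delta> > 0" "\<epsilon> > 0"
    have "vanishing M (\<lambda>n. {\<omega> \<in> space M. ?S \<delta> n \<omega> \<ge> \<epsilon>})"
    proof (rule tendsto_imp_vanishing)
      show "\<forall>\<^sub>F n in sequentially. {\<omega> \<in> space M. ?S \<delta> n \<omega> \<ge> \<epsilon>} \<in> sets M"
        using eventually_ge_at_top[of 1]
      proof eventually_elim
        case (elim n)
        note [measurable] = meas[OF elim \<open>\<delta> > 0\<close>]
        show ?case by measurable
      qed
    qed (use c \<open>\<delta> > 0\<close> \<open>\<epsilon> > 0\<close> in \<open>auto simp: inflated_conservative_def\<close>)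
    then show "vanishing M (?V \<delta> \<epsilon>)"
      by (rule vanishing_mono, intro eventually_sequentiallyI[of 1]) (auto simp: V \<open>\<delta> > 0\<close>)
  next
    assume v: "\<forall>\<delta>>0. \<forall>\<epsilon>>0. vanishing M (?V \<delta> \<epsilon>)"
    show "inflated_conservative M P t PS"
      unfolding inflated_conservative_def
    proof (intro allI impI vanishing_imp_tendsto)
      fix \<delta> \<epsilon> :: real assume "\<delta> > 0" "\<epsilon> > 0"
      then have "vanishing M (?V \<delta> (\<epsilon> / 2))" using v by simp
      then show "vanishing M (\<lambda>n. {\<omega> \<in> space M. ?S \<delta> n \<omega> \<ge> \<epsilon>})"
        by (rule vanishing_mono, intro eventually_sequentiallyI[of 1])
          (use \<open>\<delta> > 0\<close> \<open>\<epsilon> > 0\<close> in \<open>auto simp: V\<close>)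
    qed
  qed
qed

lemma noninflated_valid_iff:
  assumes \<rho>: "pvalue_of Y p PS \<rho>"
  shows "noninflated_valid M P t PS \<longleftrightarrow> (\<forall>\<epsilon>>0. vanishing M (\<lambda>n.
    {\<omega> \<in> space M. \<exists>\<alpha>\<in>{0..1}. \<bar>pvalue_cdf P \<rho> n 0 (training t n \<omega>) \<alpha> - \<alpha>\<bar> > \<epsilon>}))"
    (is "_ \<longleftrightarrow> (\<forall>\<epsilon>>0. vanishing M (?V \<epsilon>))")
proof -
  let ?f = "\<lambda>n \<omega> \<alpha>. \<bar>pvalue_cdf P \<rho> n 0 (training t n \<omega>) \<alpha> - \<alpha>\<bar>"
  let ?S = "\<lambda>n \<omega>. SUP \<alpha>\<in>{0..1}. \<bar>miscoverage P PS n \<alpha> 0 (training t n \<omega>) - \<alpha>\<bar>"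
  have f_le: "?f n \<omega> \<alpha> \<le> 1" if "n \<ge> 1" "\<alpha> \<in> {0..1}" for n \<omega> \<alpha>
    using pvalue_cdf_bounds[OF that(1), of \<rho> 0 "training t n \<omega>" \<alpha>] that(2) by auto
  have bdd: "bdd_above (?f n \<omega> ` A)" if "n \<ge> 1" "A \<subseteq> {0..1}" for n \<omega> A
    using f_le[OF that(1)] that(2) by (intro bdd_aboveI2[where M = 1]) auto
  have S: "?S n \<omega> = (SUP \<alpha>\<in>{0..1}. ?f n \<omega> \<alpha>)" if "n \<ge> 1" "\<omega> \<in> space M" for n \<omega>
    using that miscoverage_eq_pvalue_cdf[OF \<rho> that(1) training_space[OF that(1,2)]]
    by (intro SUP_cong refl) auto
  have S': "?S n \<omega> = (SUP \<alpha>\<in>{0..1} \<inter> \<rat>. ?f n \<omega> \<alpha>)" if "n \<ge> 1" "\<omega> \<in> space M" for n \<omega>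
    unfolding S[OF that] using bdd[OF that(1) order_refl]
    by (rule SUP_right_continuous)
      (intro continuous_rabs continuous_diff continuous_ident
        continuous_pvalue_cdf[OF \<rho> that(1) training_space[OF that(1,2)]])
  have meas: "?S n \<in> borel_measurable M" if "n \<ge> 1" for n
  proof -
    have "(\<lambda>\<omega>. SUP \<alpha>\<in>{0..1} \<inter> \<rat>. ?f n \<omega> \<alpha>) \<in> borel_measurable M"
      by (intro borel_measurable_cSUP borel_measurable_abs borel_measurable_diff
          measurable_pvalue_cdf[OF \<rho> that] bdd[OF that])
        (auto simp: countable_rat intro!: countable_Int2)
    then show ?thesis using S'[OF that] by (simp cong: measurable_cong)
  qed
  have V: "?V \<epsilon> n = {\<omega> \<in> space M. ?S n \<omega> > \<epsilon>}" if "n \<ge> 1" for \<epsilon> n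
  proof -
    have "?S n \<omega> > \<epsilon> \<longleftrightarrow> (\<exists>\<alpha>\<in>{0..1}. ?f n \<omega> \<alpha> > \<epsilon>)" if \<omega>: "\<omega> \<in> space M" for \<omega>
      unfolding S[OF \<open>n \<ge> 1\<close> \<omega>] by (subst less_cSUP_iff) (auto intro: bdd[OF \<open>n \<ge> 1\<close>])
    then show ?thesis by blast
  qed
  have bounds: "0 \<le> ?S n \<omega> \<and> ?S n \<omega> \<le> 1" if "n \<ge> 1" "\<omega> \<in> space M" for n \<omega>
    unfolding S[OF that] using f_le[OF that(1)]
    by (intro conjI cSUP_upper2[OF bdd[OF that(1) order_refl], of 0] cSUP_least) auto
  have "noninflated_valid M P t PS \<longleftrightarrow> (\<forall>\<epsilon>>0. vanishing M (\<lambda>n. {\<omega> \<in> space M. ?S n \<omega> > \<epsilon>}))"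
    unfolding noninflated_valid_def
    by (rule expectation_tendsto_0_iff_vanishing)
      (intro eventually_sequentiallyI[of 1] conjI ballI meas; use bounds in auto)
  also have "\<dots> \<longleftrightarrow> (\<forall>\<epsilon>>0. vanishing M (?V \<epsilon>))"
  proof -
    have "vanishing M (\<lambda>n. {\<omega> \<in> space M. ?S n \<omega> > \<epsilon>}) \<longleftrightarrow> vanishing M (?V \<epsilon>)" for \<epsilon>
      by (intro iffI; erule vanishing_mono, intro eventually_sequentiallyI[of 1]) (use V in auto)
    then show ?thesis by blast
  qed
  finally show ?thesis .
qed

text \<open>
  The p-value \<open>\<rho>\<close> is close to \<open>\<sigma>\<close> if, with high probability, it lies between those of \<open>\<sigma>\<close> with a
  slightly smaller and a slightly larger inflation, up to a small additive error. The smaller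
  inflation may be negative, so that \<open>\<sigma>\<close> has to make sense for negative inflations as well.
\<close>
definition pvalues_close :: "(nat \<Rightarrow> real \<Rightarrow> sample \<Rightarrow> real) \<Rightarrow> (nat \<Rightarrow> real \<Rightarrow> sample \<Rightarrow> real) \<Rightarrow> bool" where
  "pvalues_close \<rho> \<sigma> \<longleftrightarrow> (\<forall>\<delta>\<ge>0. \<forall>\<eta>>0. \<forall>\<kappa>>0. vanishing M (\<lambda>n.
    {\<omega> \<in> space M. \<not> (\<sigma> n (\<delta> - \<eta>) (full_sample t n \<omega>) - \<kappa> \<le> \<rho> n \<delta> (full_sample t n \<omega>) \<and>
      \<rho> n \<delta> (full_sample t n \<omega>) \<le> \<sigma> n (\<delta> + \<eta>) (full_sample t n \<omega>) + \<kappa>)}))"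

text \<open>A small positive or negative inflation has little effect on the conditional distribution function
  of the p-value, uniformly in the level and the sample size.\<close>
definition inflation_continuous :: "(nat \<Rightarrow> real \<Rightarrow> sample \<Rightarrow> real) \<Rightarrow> bool" where
  "inflation_continuous \<sigma> \<longleftrightarrow> (\<forall>\<epsilon>>0. \<forall>e>0. \<exists>\<eta>>0. \<forall>n\<ge>1. \<exists>B\<in>sets M. prob B \<le> e \<and>
    (\<forall>\<omega>\<in>space M - B. \<forall>a.
      pvalue_cdf P \<sigma> n (- \<eta>) (training t n \<omega>) a \<le> pvalue_cdf P \<sigma> n 0 (training t n \<omega>) a + \<epsilon> \<and>
      pvalue_cdf P \<sigma> n 0 (training t n \<omega>) a \<le> pvalue_cdf P \<sigma> n \<eta> (training t n \<omega>) a + \<epsilon>))"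

text \<open>Closeness of the p-values carries over to their conditional distribution functions, with high
  probability and uniformly in the level.\<close>
lemma pvalues_close_cdf:
  assumes \<rho>: "pvalue_of Y p PS \<rho>" and \<sigma>: "pvalue_of Y p PS' \<sigma>" and close: "pvalues_close \<rho> \<sigma>"
    and "\<delta> \<ge> 0" "\<eta> > 0" "\<kappa> > 0" "\<epsilon> > 0"
  shows "vanishing M (\<lambda>n. {\<omega> \<in> space M. \<not> (\<forall>a.
    pvalue_cdf P \<rho> n \<delta> (training t n \<omega>) a \<le> pvalue_cdf P \<sigma> n (\<delta> - \<eta>) (training t n \<omega>) (a + \<kappa>) + \<epsilon> \<and>
    pvalue_cdf P \<sigma> n (\<delta> + \<eta>) (training t n \<omega>) a \<le> pvalue_cdf P \<rho> n \<delta> (training t n \<omega>) (a + \<kappa>) + \<epsilon>)})"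
    (is "vanishing M ?V")
proof -
  define A where "A = (\<lambda>n. {w \<in> space (sample_space (Y n) (p n) (n + 1)).
    \<not> (\<sigma> n (\<delta> - \<eta>) w - \<kappa> \<le> \<rho> n \<delta> w \<and> \<rho> n \<delta> w \<le> \<sigma> n (\<delta> + \<eta>) w + \<kappa>)})"
  have A: "A n \<in> sets (sample_space (Y n) (p n) (n + 1))" if n: "1 \<le> n" for n
  proof -
    have "\<rho> n \<delta> \<in> borel_measurable (sample_space (Y n) (p n) (n + 1))"
      "\<And>\<delta>. \<sigma> n \<delta> \<in> borel_measurable (sample_space (Y n) (p n) (n + 1))"
      using \<rho> \<sigma> n by (auto simp: pvalue_of_def)
    then show ?thesis unfolding A_def by (intro sets_not_between)
  qed
  have "vanishing M (\<lambda>n. {\<omega> \<in> space M. full_sample t n \<omega> \<in> A n})"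
    using close[unfolded pvalues_close_def, rule_format, OF \<open>\<delta> \<ge> 0\<close> \<open>\<eta> > 0\<close> \<open>\<kappa> > 0\<close>]
    by (rule vanishing_mono) (auto simp: A_def intro!: always_eventually)
  then have "vanishing M (\<lambda>n. {\<omega> \<in> space M. measure (P n) (sections P n (A n) (training t n \<omega>)) > \<epsilon>})"
    using A \<open>\<epsilon> > 0\<close> by (intro vanishing_conditional) auto
  then show ?thesis
  proof (rule vanishing_mono, intro eventually_sequentiallyI[of 1] subsetI CollectI conjI)
    fix n \<omega> assume n: "1 \<le> n" and \<omega>: "\<omega> \<in> ?V n"
    then show "\<omega> \<in> space M" by simp
    interpret Pn: prob_space "P n" by (rule prob_space_P[OF n])
    let ?T = "training t n \<omega>"
    have T: "?T \<in> space (sample_space (Y n) (p n) n)" using n \<omega> by (auto intro: training_space)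
    have meas: "(\<lambda>z. \<rho> n \<delta> (?T(n + 1 := z))) \<in> borel_measurable (P n)"
      "(\<lambda>z. \<sigma> n \<delta> (?T(n + 1 := z))) \<in> borel_measurable (P n)" for \<delta>
      using \<rho> \<sigma> n by (intro measurable_fun_upd_P[OF n _ T]; auto simp: pvalue_of_def)+
    note [measurable] = meas sets_sections[OF n A[OF n] T]
    show "measure (P n) (sections P n (A n) ?T) > \<epsilon>"
    proof (rule ccontr)
      assume small: "\<not> measure (P n) (sections P n (A n) ?T) > \<epsilon>"
      have in_A: "?T(n + 1 := z) \<in> A n \<longleftrightarrow> \<not> (\<sigma> n (\<delta> - \<eta>) (?T(n + 1 := z)) - \<kappa> \<le> \<rho> n \<delta> (?T(n + 1 := z)) \<and>
         \<rho> n \<delta> (?T(n + 1 := z)) \<le> \<sigma> n (\<delta> + \<eta>) (?T(n + 1 := z)) + \<kappa>)" if "z \<in> space (P n)" for z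
        using space_sample_fun_upd[OF T] that n unfolding A_def by (simp del: fun_upd_apply add: space_P)
      have "pvalue_cdf P \<rho> n \<delta> ?T a \<le> pvalue_cdf P \<sigma> n (\<delta> - \<eta>) ?T (a + \<kappa>) + \<epsilon>" for a
      proof -
        have "pvalue_cdf P \<rho> n \<delta> ?T a \<le> measure (P n)
            ({z \<in> space (P n). \<sigma> n (\<delta> - \<eta>) (?T(n + 1 := z)) \<le> a + \<kappa>} \<union> sections P n (A n) ?T)"
          unfolding pvalue_cdf_def
        proof (rule Pn.finite_measure_mono)
          show "{z \<in> space (P n). \<sigma> n (\<delta> - \<eta>) (?T(n + 1 := z)) \<le> a + \<kappa>} \<union> sections P n (A n) ?T \<in> sets (P n)"
            by measurable
        qed (use in_A in \<open>force simp: sections_def simp del: fun_upd_apply\<close>)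
        also have "\<dots> \<le> pvalue_cdf P \<sigma> n (\<delta> - \<eta>) ?T (a + \<kappa>) + measure (P n) (sections P n (A n) ?T)"
          unfolding pvalue_cdf_def by (rule measure_Un_le) measurable
        finally show ?thesis using small by simp
      qed
      moreover have "pvalue_cdf P \<sigma> n (\<delta> + \<eta>) ?T a \<le> pvalue_cdf P \<rho> n \<delta> ?T (a + \<kappa>) + \<epsilon>" for a
      proof -
        have "pvalue_cdf P \<sigma> n (\<delta> + \<eta>) ?T a \<le> measure (P n)
            ({z \<in> space (P n). \<rho> n \<delta> (?T(n + 1 := z)) \<le> a + \<kappa>} \<union> sections P n (A n) ?T)"
          unfolding pvalue_cdf_def
        proof (rule Pn.finite_measure_mono)
          show "{z \<in> space (P n). \<rho> n \<delta> (?T(n + 1 := z)) \<le> a + \<kappa>} \<union> sections P n (A n) ?T \<in> sets (P n)"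
            by measurable
        qed (use in_A in \<open>force simp: sections_def simp del: fun_upd_apply\<close>)
        also have "\<dots> \<le> pvalue_cdf P \<rho> n \<delta> ?T (a + \<kappa>) + measure (P n) (sections P n (A n) ?T)"
          unfolding pvalue_cdf_def by (rule measure_Un_le) measurable
        finally show ?thesis using small by simp
      qed
      ultimately show False using \<omega> by auto
    qed
  qed
qed

end

section \<open>Methods with close p-values are asymptotically equivalent\<close>

text \<open>If two distribution functions are close in the Levy metric and one of them is nearly that of the
  uniform distribution, then so is the other. The restriction to the unit interval is harmless, as
  distribution functions have values in it.\<close>
lemma approximate_level:
  fixes F G :: "real \<Rightarrow> real"
  assumes FG: "\<And>a. F a \<le> G (a + \<kappa>) + c" and GF: "\<And>a. G a \<le> F (a + \<kappa>) + c"
    and F: "\<And>a. 0 \<le> F a" "\<And>a. F a \<le> 1"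
    and G: "\<And>a. a \<in> {0..1} \<Longrightarrow> \<bar>G a - a\<bar> \<le> d"
    and "0 \<le> \<kappa>" "0 \<le> c" "\<alpha> \<in> {0..1}"
  shows "\<bar>F \<alpha> - \<alpha>\<bar> \<le> \<kappa> + c + d"
proof -
  have d: "0 \<le> d" using G[of 0] by simp
  have "F \<alpha> \<le> \<alpha> + \<kappa> + c + d"
  proof (cases "\<alpha> + \<kappa> \<le> 1")
    case True
    then have "\<alpha> + \<kappa> \<in> {0..1}" using \<open>0 \<le> \<kappa>\<close> \<open>\<alpha> \<in> {0..1}\<close> by simp
    from FG[of \<alpha>] G[OF this] show ?thesis by linarith
  qed (use F(2)[of \<alpha>] d \<open>0 \<le> c\<close> in linarith)
  moreover have "\<alpha> - \<kappa> - c - d \<le> F \<alpha>"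
  proof (cases "0 \<le> \<alpha> - \<kappa>")
    case True
    then have "\<alpha> - \<kappa> \<in> {0..1}" using \<open>0 \<le> \<kappa>\<close> \<open>\<alpha> \<in> {0..1}\<close> by simp
    from GF[of "\<alpha> - \<kappa>"] G[OF this] show ?thesis by simp
  qed (use F(1)[of \<alpha>] d \<open>0 \<le> c\<close> in linarith)
  ultimately show ?thesis by (auto simp: abs_le_iff)
qed

context iid_array
begin

text \<open>The small change of the inflation is absorbed by comparing inflation \<open>\<delta>\<close> of one method with
  \<open>\<delta> / 2\<close> of the other.\<close>
lemma conservative_cong:
  assumes \<rho>: "pvalue_of Y p PS \<rho>" and \<sigma>: "pvalue_of Y p PS' \<sigma>" and close: "pvalues_close \<rho> \<sigma>"
  shows "inflated_conservative M P t PS \<longleftrightarrow> inflated_conservative M P t PS'"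
proof -
  have *: "vanishing M (\<lambda>n. {\<omega> \<in> space M. \<exists>\<alpha>\<in>{0..1}. pvalue_cdf P \<tau> n \<delta> (training t n \<omega>) \<alpha> > \<alpha> + \<epsilon>})"
    if "\<epsilon> > 0"
      and close: "vanishing M (\<lambda>n. {\<omega> \<in> space M. \<not> (\<forall>a. pvalue_cdf P \<tau> n \<delta> (training t n \<omega>) a \<le>
        pvalue_cdf P \<tau>' n (\<delta> / 2) (training t n \<omega>) (a + \<epsilon> / 4) + \<epsilon> / 4)})"
      and level: "vanishing M (\<lambda>n. {\<omega> \<in> space M. \<exists>\<alpha>\<in>{0..1}.
        pvalue_cdf P \<tau>' n (\<delta> / 2) (training t n \<omega>) \<alpha> > \<alpha> + \<epsilon> / 4})"
    for \<tau> \<tau>' \<delta> \<epsilon>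
    using vanishing_Un[OF close level]
  proof (rule vanishing_mono, intro eventually_sequentiallyI[of 1] subsetI)
    fix n \<omega> assume n: "1 \<le> n"
      and \<omega>: "\<omega> \<in> {\<omega> \<in> space M. \<exists>\<alpha>\<in>{0..1}. pvalue_cdf P \<tau> n \<delta> (training t n \<omega>) \<alpha> > \<alpha> + \<epsilon>}"
    then obtain \<alpha> where \<alpha>: "\<alpha> \<in> {0..1}" "pvalue_cdf P \<tau> n \<delta> (training t n \<omega>) \<alpha> > \<alpha> + \<epsilon>" by auto
    with pvalue_cdf_bounds(2)[OF n, of \<tau> \<delta> "training t n \<omega>" \<alpha>] \<open>\<epsilon> > 0\<close>
    have \<alpha>': "\<alpha> + \<epsilon> / 4 \<in> {0..1}" by auto
    show "\<omega> \<in> {\<omega> \<in> space M. \<not> (\<forall>a. pvalue_cdf P \<tau> n \<delta> (training t n \<omega>) a \<le>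
        pvalue_cdf P \<tau>' n (\<delta> / 2) (training t n \<omega>) (a + \<epsilon> / 4) + \<epsilon> / 4)} \<union>
      {\<omega> \<in> space M. \<exists>\<alpha>\<in>{0..1}. pvalue_cdf P \<tau>' n (\<delta> / 2) (training t n \<omega>) \<alpha> > \<alpha> + \<epsilon> / 4}"
    proof (rule ccontr)
      assume c: "\<not> ?thesis"
      then have "\<omega> \<notin> {\<omega> \<in> space M. \<exists>\<alpha>\<in>{0..1}. pvalue_cdf P \<tau>' n (\<delta> / 2) (training t n \<omega>) \<alpha> > \<alpha> + \<epsilon> / 4}"
        by blast
      then have "\<not> pvalue_cdf P \<tau>' n (\<delta> / 2) (training t n \<omega>) (\<alpha> + \<epsilon> / 4) > (\<alpha> + \<epsilon> / 4) + \<epsilon> / 4"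
        using \<omega> \<alpha>' by blast
      moreover have "pvalue_cdf P \<tau> n \<delta> (training t n \<omega>) \<alpha> \<le>
          pvalue_cdf P \<tau>' n (\<delta> / 2) (training t n \<omega>) (\<alpha> + \<epsilon> / 4) + \<epsilon> / 4"
        using c \<omega> by blast
      ultimately show False using \<alpha> \<open>\<epsilon> > 0\<close> by simp
    qed
  qed
  show ?thesis
    unfolding inflated_conservative_iff[OF \<rho>] inflated_conservative_iff[OF \<sigma>]
  proof (intro iffI allI impI)
    fix \<delta> \<epsilon> :: real assume "\<delta> > 0" "\<epsilon> > 0"
    then have pos: "\<delta> / 2 \<ge> 0" "\<delta> / 2 > 0" "\<epsilon> / 4 > 0" "\<delta> \<ge> 0" by auto
    {
      assume c: "\<forall>\<delta>>0. \<forall>\<epsilon>>0. vanishing M (\<lambda>n. {\<omega> \<in> space M. \<exists>\<alpha>\<in>{0..1}.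
        pvalue_cdf P \<rho> n \<delta> (training t n \<omega>) \<alpha> > \<alpha> + \<epsilon>})"
      show "vanishing M (\<lambda>n. {\<omega> \<in> space M. \<exists>\<alpha>\<in>{0..1}. pvalue_cdf P \<sigma> n \<delta> (training t n \<omega>) \<alpha> > \<alpha> + \<epsilon>})"
        by (rule *[OF \<open>\<epsilon> > 0\<close> vanishing_mono[OF
              pvalues_close_cdf[OF \<rho> \<sigma> close pos(1,2,3,3)]] c[rule_format, OF pos(2,3)]])
          (rule always_eventually, simp, blast)
    }
    {
      assume c: "\<forall>\<delta>>0. \<forall>\<epsilon>>0. vanishing M (\<lambda>n. {\<omega> \<in> space M. \<exists>\<alpha>\<in>{0..1}.
        pvalue_cdf P \<sigma> n \<delta> (training t n \<omega>) \<alpha> > \<alpha> + \<epsilon>})"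
      show "vanishing M (\<lambda>n. {\<omega> \<in> space M. \<exists>\<alpha>\<in>{0..1}. pvalue_cdf P \<rho> n \<delta> (training t n \<omega>) \<alpha> > \<alpha> + \<epsilon>})"
        by (rule *[OF \<open>\<epsilon> > 0\<close> vanishing_mono[OF
              pvalues_close_cdf[OF \<rho> \<sigma> close pos(4,2,3,3)]] c[rule_format, OF pos(2,3)]])
          (rule always_eventually, simp, blast)
    }
  qed
qed

text \<open>The closeness of the p-values involves \<open>\<sigma>\<close> with inflations \<open>-\<eta>\<close> and \<open>\<eta>\<close>; by continuity in
  the inflation both can be replaced by no inflation.\<close>
lemma valid_cong:
  assumes \<rho>: "pvalue_of Y p PS \<rho>" and \<sigma>: "pvalue_of Y p PS' \<sigma>" and close: "pvalues_close \<rho> \<sigma>"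
    and cont: "inflation_continuous \<sigma>"
  shows "noninflated_valid M P t PS \<longleftrightarrow> noninflated_valid M P t PS'"
proof -
  let ?R = "\<lambda>n \<omega>. pvalue_cdf P \<rho> n 0 (training t n \<omega>)"
    and ?S = "\<lambda>n \<omega>. pvalue_cdf P \<sigma> n 0 (training t n \<omega>)"
  have pair: "\<exists>A'. vanishing M A' \<and> (\<forall>n\<ge>1. \<exists>B\<in>sets M. prob B \<le> e \<and> (\<forall>\<omega>\<in>space M - A' n - B. \<forall>a.
      ?R n \<omega> a \<le> ?S n \<omega> (a + \<epsilon> / 4) + \<epsilon> / 2 \<and> ?S n \<omega> a \<le> ?R n \<omega> (a + \<epsilon> / 4) + \<epsilon> / 2))"
    if "e > 0" "\<epsilon> > 0" for e \<epsilon>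
  proof -
    have \<epsilon>4: "\<epsilon> / 4 > 0" using \<open>\<epsilon> > 0\<close> by simp
    obtain \<eta> where \<eta>: "\<eta> > 0" and B: "\<forall>n\<ge>1. \<exists>B\<in>sets M. prob B \<le> e \<and>
      (\<forall>\<omega>\<in>space M - B. \<forall>a.
        pvalue_cdf P \<sigma> n (- \<eta>) (training t n \<omega>) a \<le> ?S n \<omega> a + \<epsilon> / 4 \<and>
        ?S n \<omega> a \<le> pvalue_cdf P \<sigma> n \<eta> (training t n \<omega>) a + \<epsilon> / 4)"
      using cont[unfolded inflation_continuous_def, rule_format, OF \<epsilon>4 \<open>e > 0\<close>] by blast
    let ?A = "\<lambda>n. {\<omega> \<in> space M. \<not> (\<forall>a.
      ?R n \<omega> a \<le> pvalue_cdf P \<sigma> n (0 - \<eta>) (training t n \<omega>) (a + \<epsilon> / 4) + \<epsilon> / 4 \<and>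
      pvalue_cdf P \<sigma> n (0 + \<eta>) (training t n \<omega>) a \<le> ?R n \<omega> (a + \<epsilon> / 4) + \<epsilon> / 4)}"
    have "vanishing M ?A"
      by (rule pvalues_close_cdf[OF \<rho> \<sigma> close order_refl \<eta> \<epsilon>4 \<epsilon>4])
    moreover have "\<exists>B\<in>sets M. prob B \<le> e \<and> (\<forall>\<omega>\<in>space M - ?A n - B. \<forall>a.
      ?R n \<omega> a \<le> ?S n \<omega> (a + \<epsilon> / 4) + \<epsilon> / 2 \<and> ?S n \<omega> a \<le> ?R n \<omega> (a + \<epsilon> / 4) + \<epsilon> / 2)"
      if n: "n \<ge> 1" for n
    proof -
      obtain B where B1: "B \<in> sets M" and B': "prob B \<le> e \<and> (\<forall>\<omega>\<in>space M - B. \<forall>a.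
        pvalue_cdf P \<sigma> n (- \<eta>) (training t n \<omega>) a \<le> ?S n \<omega> a + \<epsilon> / 4 \<and>
        ?S n \<omega> a \<le> pvalue_cdf P \<sigma> n \<eta> (training t n \<omega>) a + \<epsilon> / 4)"
        using B[rule_format, OF n] by (elim bexE)
      note B2 = B'[THEN conjunct1] and B3 = B'[THEN conjunct2, rule_format]
      have "?R n \<omega> a \<le> ?S n \<omega> (a + \<epsilon> / 4) + \<epsilon> / 2 \<and> ?S n \<omega> a \<le> ?R n \<omega> (a + \<epsilon> / 4) + \<epsilon> / 2"
        if \<omega>: "\<omega> \<in> space M - ?A n - B" for \<omega> a
      proof -
        have "?R n \<omega> a \<le> pvalue_cdf P \<sigma> n (- \<eta>) (training t n \<omega>) (a + \<epsilon> / 4) + \<epsilon> / 4"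
          "pvalue_cdf P \<sigma> n \<eta> (training t n \<omega>) a \<le> ?R n \<omega> (a + \<epsilon> / 4) + \<epsilon> / 4"
          using \<omega> by simp_all
        moreover have "\<omega> \<in> space M - B" using \<omega> by blast
        ultimately show ?thesis using B3[of \<omega> a] B3[of \<omega> "a + \<epsilon> / 4"] by linarith
      qed
      with B1 B2 show ?thesis by blast
    qed
    ultimately show ?thesis by blast
  qed
  have transfer: "\<forall>\<epsilon>>0. vanishing M (\<lambda>n. {\<omega> \<in> space M. \<exists>\<alpha>\<in>{0..1}. \<bar>F n \<omega> \<alpha> - \<alpha>\<bar> > \<epsilon>})"
    if FG: "F = ?R \<and> G = ?S \<or> F = ?S \<and> G = ?R"
      and G: "\<forall>\<epsilon>>0. vanishing M (\<lambda>n. {\<omega> \<in> space M. \<exists>\<alpha>\<in>{0..1}. \<bar>G n \<omega> \<alpha> - \<alpha>\<bar> > \<epsilon>})" for F G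
  proof (intro allI impI vanishing_approx)
    fix \<epsilon> e :: real assume "\<epsilon> > 0" "e > 0"
    obtain A' where A': "vanishing M A'"
      and B: "\<And>n. n \<ge> 1 \<Longrightarrow> \<exists>B\<in>sets M. prob B \<le> e \<and> (\<forall>\<omega>\<in>space M - A' n - B. \<forall>a.
        ?R n \<omega> a \<le> ?S n \<omega> (a + \<epsilon> / 4) + \<epsilon> / 2 \<and> ?S n \<omega> a \<le> ?R n \<omega> (a + \<epsilon> / 4) + \<epsilon> / 2)"
      using pair[OF \<open>e > 0\<close> \<open>\<epsilon> > 0\<close>] by blast
    let ?A = "\<lambda>n. A' n \<union> {\<omega> \<in> space M. \<exists>\<alpha>\<in>{0..1}. \<bar>G n \<omega> \<alpha> - \<alpha>\<bar> > \<epsilon> / 4}"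
    have "vanishing M ?A" using \<open>\<epsilon> > 0\<close> by (intro vanishing_Un A' G[rule_format]) simp
    moreover have "\<forall>\<^sub>F n in sequentially. \<exists>B\<in>sets M. prob B \<le> e \<and>
      {\<omega> \<in> space M. \<exists>\<alpha>\<in>{0..1}. \<bar>F n \<omega> \<alpha> - \<alpha>\<bar> > \<epsilon>} \<subseteq> ?A n \<union> B"
    proof (rule eventually_sequentiallyI[of 1])
      fix n :: nat assume n: "1 \<le> n"
      obtain B where B1: "B \<in> sets M" and B2: "prob B \<le> e \<and> (\<forall>\<omega>\<in>space M - A' n - B. \<forall>a.
        ?R n \<omega> a \<le> ?S n \<omega> (a + \<epsilon> / 4) + \<epsilon> / 2 \<and> ?S n \<omega> a \<le> ?R n \<omega> (a + \<epsilon> / 4) + \<epsilon> / 2)"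
        using B[OF n] by (elim bexE)
      note B3 = B2[THEN conjunct2, rule_format]
      have le: "\<bar>F n \<omega> \<alpha> - \<alpha>\<bar> \<le> \<epsilon> / 4 + \<epsilon> / 2 + \<epsilon> / 4"
        if \<omega>: "\<omega> \<in> space M - ?A n - B" and \<alpha>: "\<alpha> \<in> {0..1}" for \<omega> \<alpha>
      proof (rule approximate_level[where G = "G n \<omega>"])
        have \<omega>': "\<omega> \<in> space M - A' n - B" using \<omega> by blast
        show "F n \<omega> a \<le> G n \<omega> (a + \<epsilon> / 4) + \<epsilon> / 2" "G n \<omega> a \<le> F n \<omega> (a + \<epsilon> / 4) + \<epsilon> / 2" for a
          using FG B3[OF \<omega>', of a] by blast+
        show "0 \<le> F n \<omega> a" "F n \<omega> a \<le> 1" for a using FG pvalue_cdf_bounds[OF n] by blast+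
        show "\<bar>G n \<omega> a - a\<bar> \<le> \<epsilon> / 4" if "a \<in> {0..1}" for a
        proof (rule ccontr)
          assume "\<not> ?thesis"
          then have "\<bar>G n \<omega> a - a\<bar> > \<epsilon> / 4" by (simp only: not_le)
          with \<omega> that show False by blast
        qed
      qed (use \<alpha> \<open>\<epsilon> > 0\<close> in auto)
      have "{\<omega> \<in> space M. \<exists>\<alpha>\<in>{0..1}. \<bar>F n \<omega> \<alpha> - \<alpha>\<bar> > \<epsilon>} \<subseteq> ?A n \<union> B"
      proof (intro subsetI, rule ccontr)
        fix \<omega> assume *: "\<omega> \<in> {\<omega> \<in> space M. \<exists>\<alpha>\<in>{0..1}. \<bar>F n \<omega> \<alpha> - \<alpha>\<bar> > \<epsilon>}" "\<omega> \<notin> ?A n \<union> B"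
        then obtain \<alpha> where \<alpha>: "\<alpha> \<in> {0..1}" "\<bar>F n \<omega> \<alpha> - \<alpha>\<bar> > \<epsilon>" by blast
        from * have "\<omega> \<in> space M - ?A n - B" by blast
        from le[OF this \<alpha>(1)] \<alpha>(2) show False by simp
      qed
      with B1 B2[THEN conjunct1] show "\<exists>B\<in>sets M. prob B \<le> e \<and>
        {\<omega> \<in> space M. \<exists>\<alpha>\<in>{0..1}. \<bar>F n \<omega> \<alpha> - \<alpha>\<bar> > \<epsilon>} \<subseteq> ?A n \<union> B" by blast
    qed
    ultimately show "\<exists>A'. vanishing M A' \<and> (\<forall>\<^sub>F n in sequentially. \<exists>B\<in>sets M. prob B \<le> e \<and>
      {\<omega> \<in> space M. \<exists>\<alpha>\<in>{0..1}. \<bar>F n \<omega> \<alpha> - \<alpha>\<bar> > \<epsilon>} \<subseteq> A' n \<union> B)" by blast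
  qed
  show ?thesis
    unfolding noninflated_valid_iff[OF \<rho>] noninflated_valid_iff[OF \<sigma>]
    using transfer[of ?R ?S] transfer[of ?S ?R] by blast
qed

lemma asymp_equiv_if_close:
  assumes "pvalue_of Y p PS \<rho>" "pvalue_of Y p PS' \<sigma>" "pvalues_close \<rho> \<sigma>"
    and "CC M P t C \<Longrightarrow> inflation_continuous \<sigma>"
  shows "asymp_equiv_methods M P t C PS PS'"
  unfolding asymp_equiv_methods_def
  using conservative_cong[OF assms(1-3)] valid_cong[OF assms(1-3)] assms(4) by blast

end

lemma asymp_equiv_sym: "asymp_equiv_methods M P t C PS PS' \<Longrightarrow> asymp_equiv_methods M P t C PS' PS"
  by (auto simp: asymp_equiv_methods_def)

lemma asymp_equiv_trans:
  "asymp_equiv_methods M P t C PS PS' \<Longrightarrow> asymp_equiv_methods M P t C PS' PS'' \<Longrightarrow>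
    asymp_equiv_methods M P t C PS PS''"
  by (auto simp: asymp_equiv_methods_def)

section \<open>Symmetric scores and stability\<close>

text \<open>The points of w with index in S, in some order. As scores are symmetric, the order does not matter,
  and any enumeration of S can be used (see \<open>score_reorder\<close>).\<close>
definition subsample :: "nat set \<Rightarrow> sample \<Rightarrow> sample" where
  "subsample S w = (\<lambda>j\<in>{1..card S}. w ((SOME \<iota>. bij_betw \<iota> {1..card S} S) j))"

text \<open>The score of the point a among n + 1 points with respect to all n others.\<close>
definition score_all :: "score_family \<Rightarrow> nat \<Rightarrow> nat \<Rightarrow> sample \<Rightarrow> real" where
  "score_all C n a w = C n n (w a) (subsample ({1..n + 1} - {a}) w)"

text \<open>The score of the point a among n + 1 points with respect to all others except b. For a training
  point a and the new point b = n + 1 it is the leave-one-out score of a.\<close>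
definition score_but :: "score_family \<Rightarrow> nat \<Rightarrow> nat \<Rightarrow> nat \<Rightarrow> sample \<Rightarrow> real" where
  "score_but C n a b w = C n (n - 1) (w a) (subsample ({1..n + 1} - {a, b}) w)"

lemma bij_betw_subsample:
  assumes "finite S"
  shows "bij_betw (SOME \<iota>. bij_betw \<iota> {1..card S} S) {1..card S} S"
proof -
  obtain h where "bij_betw h {1..card S} S" using ex_bij_betw_nat_finite_1[OF assms] by blast
  then show ?thesis by (rule someI[where P = "\<lambda>\<iota>. bij_betw \<iota> {1..card S} S"])
qed

lemma subsample_space:
  assumes w: "w \<in> space (sample_space Y d N)" and S: "S \<subseteq> {1..N}"
  shows "subsample S w \<in> space (sample_space Y d (card S))"
proof -
  have "finite S" using S finite_subset by blast
  then have "(SOME \<iota>. bij_betw \<iota> {1..card S} S) j \<in> {1..N}" if "j \<in> {1..card S}" for j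
    using bij_betwE[OF bij_betw_subsample] that S by blast
  then show ?thesis
    using w by (auto simp: sample_space_def space_PiM subsample_def PiE_def Pi_def)
qed

lemma measurable_subsample:
  assumes S: "S \<subseteq> {1..N}"
  shows "subsample S \<in> measurable (sample_space Y d N) (sample_space Y d (card S))"
proof -
  have "finite S" using S finite_subset by blast
  then have "(SOME \<iota>. bij_betw \<iota> {1..card S} S) j \<in> {1..N}" if "j \<in> {1..card S}" for j
    using bij_betwE[OF bij_betw_subsample] that S by blast
  then show ?thesis
    unfolding sample_space_def subsample_def[abs_def]
    by (intro measurable_restrict measurable_component_singleton)
qed

text \<open>Any enumeration of the index set S may be used to form the training sample.\<close>
lemma score_reorder:
  assumes C: "conformity_scores Y p C" and n: "1 \<le> n"
    and z: "z \<in> space (data_space (Y n) (p n))" and w: "w \<in> space (sample_space (Y n) (p n) N)"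
    and S: "S \<subseteq> {1..N}" and \<iota>: "bij_betw \<iota> {1..m} S"
  shows "C n m z (\<lambda>j\<in>{1..m}. w (\<iota> j)) = C n m z (subsample S w)"
proof -
  have m: "card S = m" using bij_betw_same_card[OF \<iota>] by simp
  define \<kappa> where "\<kappa> = (SOME \<iota>. bij_betw \<iota> {1..card S} S)"
  have \<kappa>: "bij_betw \<kappa> {1..m} S"
    using bij_betw_subsample[OF finite_subset[OF S finite_atLeastAtMost]] unfolding \<kappa>_def m .
  define \<pi> where "\<pi> = (\<lambda>j. if j \<in> {1..m} then inv_into {1..m} \<kappa> (\<iota> j) else j)"
  have "bij_betw (inv_into {1..m} \<kappa> \<circ> \<iota>) {1..m} {1..m}"
    by (rule bij_betw_trans[OF \<iota> bij_betw_inv_into[OF \<kappa>]])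
  then have "bij_betw \<pi> {1..m} {1..m}"
    by (rule bij_betw_cong[THEN iffD1, rotated]) (simp add: \<pi>_def)
  then have \<pi>: "\<pi> permutes {1..m}"
    by (rule bij_imp_permutes) (simp add: \<pi>_def del: atLeastAtMost_iff)
  have "subsample S w \<circ> \<pi> = (\<lambda>j\<in>{1..m}. w (\<iota> j))"
  proof
    fix j
    show "(subsample S w \<circ> \<pi>) j = (\<lambda>j\<in>{1..m}. w (\<iota> j)) j"
    proof (cases "j \<in> {1..m}")
      case True
      then have "\<pi> j \<in> {1..m}" using permutes_in_image[OF \<pi>] by blast
      moreover have "\<kappa> (\<pi> j) = \<iota> j"
        using True bij_betw_inv_into_right[OF \<kappa>] bij_betwE[OF \<iota>] by (simp add: \<pi>_def)
      ultimately show ?thesis using True 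
        by (simp add: subsample_def m \<kappa>_def[unfolded m, symmetric] del: One_nat_def)
    next
      case False
      then show ?thesis by (auto simp: subsample_def m \<pi>_def)
    qed
  qed
  moreover have "C n m z (subsample S w \<circ> \<pi>) = C n m z (subsample S w)"
    using C n z subsample_space[OF w S] \<pi> unfolding m by (simp add: conformity_scores_def)
  ultimately show ?thesis by simp
qed

lemma measurable_score_subsample:
  assumes C: "conformity_scores Y p C" and n: "1 \<le> n" and a: "a \<in> {1..N}" and S: "S \<subseteq> {1..N}"
    and m: "card S = m"
  shows "(\<lambda>w. C n m (w a) (subsample S w)) \<in> borel_measurable (sample_space (Y n) (p n) N)"
proof -
  have "(\<lambda>w. w a) \<in> measurable (sample_space (Y n) (p n) N) (data_space (Y n) (p n))"
    unfolding sample_space_def using a by (rule measurable_component_singleton)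
  moreover have "case_prod (C n m) \<in> borel_measurable
      (data_space (Y n) (p n) \<Otimes>\<^sub>M sample_space (Y n) (p n) m)"
    using C n by (simp add: conformity_scores_def)
  moreover have "subsample S \<in> measurable (sample_space (Y n) (p n) N) (sample_space (Y n) (p n) m)"
    using measurable_subsample[OF S] unfolding m .
  ultimately have "(\<lambda>w. case_prod (C n m) (w a, subsample S w)) \<in>
      borel_measurable (sample_space (Y n) (p n) N)"
    using measurable_compose[OF measurable_Pair] by blast
  then show ?thesis by simp
qed

lemma measurable_score_all:
  assumes "conformity_scores Y p C" "1 \<le> n" "a \<in> {1..n + 1}"
  shows "score_all C n a \<in> borel_measurable (sample_space (Y n) (p n) (n + 1))"
  unfolding score_all_def[abs_def] using assms(3)
  by (intro measurable_score_subsample[OF assms]) auto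

lemma measurable_score_but:
  assumes "conformity_scores Y p C" "1 \<le> n" "a \<in> {1..n + 1}" "b \<in> {1..n + 1}" "a \<noteq> b"
  shows "score_but C n a b \<in> borel_measurable (sample_space (Y n) (p n) (n + 1))"
  unfolding score_but_def[abs_def] using assms(3-5)
  by (intro measurable_score_subsample[OF assms(1-3)]) (auto simp: card_Diff_subset)

lemma component_space:
  "w \<in> space (sample_space Y d N) \<Longrightarrow> a \<in> {1..N} \<Longrightarrow> w a \<in> space (data_space Y d)"
  by (auto simp: sample_space_def space_PiM)

lemma skip_bij_betw:
  fixes i m :: nat
  assumes "i \<in> {1..m}"
  shows "bij_betw (\<lambda>j. if j < i then j else j + 1) {1..m - 1} ({1..m} - {i})"
  using assms
  by (intro bij_betw_byWitness[where f' = "\<lambda>j. if j < i then j else j - 1"]) auto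

lemma score_all_eq_remove_entry:
  assumes "conformity_scores Y p C" "1 \<le> n" "i \<in> {1..n + 1}"
    and w: "w \<in> space (sample_space (Y n) (p n) (n + 1))"
  shows "C n n (w i) (remove_entry (n + 1) i w) = score_all C n i w"
proof -
  have eq: "remove_entry (n + 1) i w = (\<lambda>j\<in>{1..n}. w (if j < i then j else j + 1))"
    unfolding remove_entry_def by (rule restrict_cong) (simp_all only: diff_add_inverse2 if_distrib[of w])
  have b: "bij_betw (\<lambda>j. if j < i then j else j + 1) {1..n} ({1..n + 1} - {i})"
    using skip_bij_betw[OF assms(3)] by (simp only: diff_add_inverse2)
  show ?thesis
    unfolding score_all_def eq
    by (rule score_reorder[OF assms(1,2) component_space[OF w assms(3)] w Diff_subset b])
qed

lemma score_all_eq_restrict: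
  assumes "conformity_scores Y p C" "1 \<le> n"
    and w: "w \<in> space (sample_space (Y n) (p n) (n + 1))"
  shows "C n n (w (n + 1)) (restrict w {1..n}) = score_all C n (n + 1) w"
proof -
  have b: "bij_betw (\<lambda>j. j) {1..n} ({1..n + 1} - {n + 1})" by (auto simp: bij_betw_def inj_on_def)
  have "n + 1 \<in> {1..n + 1}" by simp
  from score_reorder[OF assms(1,2) component_space[OF w this] w Diff_subset b]
  show ?thesis unfolding score_all_def .
qed

lemma score_but_eq_remove_entry:
  assumes "conformity_scores Y p C" "1 \<le> n" "i \<in> {1..n}" "a \<in> {i, n + 1}"
    and w: "w \<in> space (sample_space (Y n) (p n) (n + 1))"
  shows "C n (n - 1) (w a) (remove_entry n i (restrict w {1..n})) =
    score_but C n a (if a = i then n + 1 else i) w"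
proof -
  have eq: "remove_entry n i (restrict w {1..n}) = (\<lambda>j\<in>{1..n - 1}. w (if j < i then j else j + 1))"
    unfolding remove_entry_def
  proof (rule restrict_ext)
    fix j assume "j \<in> {1..n - 1}"
    then have "j \<in> {1..n}" "j + 1 \<in> {1..n}" by auto
    then show "(if j < i then restrict w {1..n} j else restrict w {1..n} (j + 1)) = w (if j < i then j else j + 1)"
      by (simp only: restrict_apply' if_distrib[of w])
  qed
  have b: "bij_betw (\<lambda>j. if j < i then j else j + 1) {1..n - 1}
      ({1..n + 1} - {a, if a = i then n + 1 else i})"
  proof -
    have "{1..n} - {i} = {1..n + 1} - {a, if a = i then n + 1 else i}"
      using assms(3,4) by auto
    then show ?thesis using skip_bij_betw[OF assms(3)] by (simp only:)
  qed
  have "a \<in> {1..n + 1}" using assms(3,4) by auto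
  from score_reorder[OF assms(1,2) component_space[OF w this] w Diff_subset b]
  show ?thesis unfolding score_but_def eq .
qed

lemma ex_permutation_two_points:
  fixes a b c d :: nat
  assumes "a \<in> S" "b \<in> S" "a \<noteq> b" "c \<in> S" "d \<in> S" "c \<noteq> d"
  shows "\<exists>\<pi>. \<pi> permutes S \<and> \<pi> a = c \<and> \<pi> b = d"
proof -
  let ?\<pi>1 = "Transposition.transpose a c"
  have "?\<pi>1 d \<in> S" using assms by (auto simp: Transposition.transpose_def)
  moreover have "?\<pi>1 d \<noteq> a" using assms by (auto simp: Transposition.transpose_def)
  moreover have "(?\<pi>1 \<circ> Transposition.transpose b (?\<pi>1 d)) a = c"
    using calculation(2) assms(3) by (simp add: transpose_apply_other)
  moreover have "(?\<pi>1 \<circ> Transposition.transpose b (?\<pi>1 d)) b = d" by simp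
  ultimately show ?thesis
    using permutes_compose[OF permutes_swap_id[OF assms(2)] permutes_swap_id[OF assms(1,4)], of "?\<pi>1 d"]
    by blast
qed

context iid_array
begin

lemma score_all_reindex:
  assumes C: "conformity_scores Y p C" "1 \<le> n" and a: "a \<in> {1..n + 1}"
    and \<pi>: "\<pi> permutes {1..n + 1}" and w: "w \<in> space (sample_space (Y n) (p n) (n + 1))"
  shows "score_all C n a (reindex n \<pi> w) = score_all C n (\<pi> a) w"
proof -
  let ?S = "{1..n + 1} - {a}"
  have card: "card ?S = n" using a by simp
  define \<kappa> where "\<kappa> = (SOME \<iota>. bij_betw \<iota> {1..n} ?S)"
  have \<kappa>: "bij_betw \<kappa> {1..n} ?S"
    using bij_betw_subsample[of ?S] unfolding card \<kappa>_def by simp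
  have a': "\<pi> a \<in> {1..n + 1}" using permutes_in_image[OF \<pi>] a by blast
  have "bij_betw \<pi> ?S ({1..n + 1} - {\<pi> a})"
    using bij_betw_DiffI[OF permutes_imp_bij[OF \<pi>], of "{a}" "{\<pi> a}"] a a' by (simp add: bij_betw_def)
  then have b: "bij_betw (\<pi> \<circ> \<kappa>) {1..n} ({1..n + 1} - {\<pi> a})" by (rule bij_betw_trans[OF \<kappa>])
  have "subsample ?S (reindex n \<pi> w) = (\<lambda>j\<in>{1..n}. w ((\<pi> \<circ> \<kappa>) j))"
    unfolding subsample_def card \<kappa>_def[symmetric] using bij_betwE[OF \<kappa>]
    by (auto simp: reindex_def fun_eq_iff restrict_def simp del: atLeastAtMost_iff)
  then show ?thesis
    using score_reorder[OF C component_space[OF w a'] w _ b] a by (auto simp: score_all_def reindex_def)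
qed

lemma score_but_reindex:
  assumes C: "conformity_scores Y p C" "1 \<le> n" and a: "a \<in> {1..n + 1}" "b \<in> {1..n + 1}" "a \<noteq> b"
    and \<pi>: "\<pi> permutes {1..n + 1}" and w: "w \<in> space (sample_space (Y n) (p n) (n + 1))"
  shows "score_but C n a b (reindex n \<pi> w) = score_but C n (\<pi> a) (\<pi> b) w"
proof -
  let ?S = "{1..n + 1} - {a, b}"
  have card: "card ?S = n - 1" using a by (simp add: card_Diff_subset)
  define \<kappa> where "\<kappa> = (SOME \<iota>. bij_betw \<iota> {1..n - 1} ?S)"
  have \<kappa>: "bij_betw \<kappa> {1..n - 1} ?S"
    using bij_betw_subsample[of ?S] unfolding card \<kappa>_def by simp
  have a': "\<pi> a \<in> {1..n + 1}" "\<pi> b \<in> {1..n + 1}" using permutes_in_image[OF \<pi>] a by blast+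
  have "bij_betw \<pi> {a, b} {\<pi> a, \<pi> b}"
    using permutes_inj[OF \<pi>] by (auto simp: bij_betw_def inj_on_def dest: injD)
  then have "bij_betw \<pi> ?S ({1..n + 1} - {\<pi> a, \<pi> b})"
    using bij_betw_DiffI[OF permutes_imp_bij[OF \<pi>], of "{a, b}" "{\<pi> a, \<pi> b}"] a a' by simp
  then have b: "bij_betw (\<pi> \<circ> \<kappa>) {1..n - 1} ({1..n + 1} - {\<pi> a, \<pi> b})" by (rule bij_betw_trans[OF \<kappa>])
  have "subsample ?S (reindex n \<pi> w) = (\<lambda>j\<in>{1..n - 1}. w ((\<pi> \<circ> \<kappa>) j))"
    unfolding subsample_def card \<kappa>_def[symmetric] using bij_betwE[OF \<kappa>]
    by (auto simp: reindex_def fun_eq_iff restrict_def simp del: atLeastAtMost_iff)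
  then show ?thesis
    using score_reorder[OF C component_space[OF w a'(1)] w _ b] a by (auto simp: score_but_def reindex_def)
qed

text \<open>By exchangeability, all pairs of points behave like the last two.\<close>
lemma integral_score_pair:
  fixes \<phi> :: "real \<Rightarrow> real \<Rightarrow> real \<Rightarrow> real"
  assumes C: "conformity_scores Y p C" and n: "1 \<le> n"
    and a: "a \<in> {1..n + 1}" "b \<in> {1..n + 1}" "a \<noteq> b"
    and \<phi>: "(\<lambda>(x, y, u). \<phi> x y u) \<in> borel_measurable borel"
  shows "(\<integral>\<omega>. \<phi> (score_all C n a (full_sample t n \<omega>)) (score_but C n a b (full_sample t n \<omega>))
      (score_but C n b a (full_sample t n \<omega>)) \<partial>M) =
    (\<integral>\<omega>. \<phi> (score_all C n (n + 1) (full_sample t n \<omega>)) (score_but C n (n + 1) n (full_sample t n \<omega>))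
      (score_but C n n (n + 1) (full_sample t n \<omega>)) \<partial>M)"
proof -
  \<comment> \<open>Reorder the full sample so that a and b become the last two points.\<close>
  have e: "n + 1 \<in> {1..n + 1}" "n \<in> {1..n + 1}" "n + 1 \<noteq> n" using n by auto
  obtain \<pi> where \<pi>: "\<pi> permutes {1..n + 1}" "\<pi> (n + 1) = a" "\<pi> n = b"
    using ex_permutation_two_points[OF e a] by blast
  let ?f = "\<lambda>w. \<phi> (score_all C n (n + 1) w) (score_but C n (n + 1) n w) (score_but C n n (n + 1) w)"
  have [measurable]: "score_all C n (n + 1) \<in> borel_measurable (sample_space (Y n) (p n) (n + 1))"
    "score_but C n (n + 1) n \<in> borel_measurable (sample_space (Y n) (p n) (n + 1))"
    "score_but C n n (n + 1) \<in> borel_measurable (sample_space (Y n) (p n) (n + 1))"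
    by (rule measurable_score_all[OF C n e(1)] measurable_score_but[OF C n e]
        measurable_score_but[OF C n e(2,1) e(3)[symmetric]])+
  have "(\<lambda>w. (score_all C n (n + 1) w, score_but C n (n + 1) n w, score_but C n n (n + 1) w)) \<in>
      borel_measurable (sample_space (Y n) (p n) (n + 1))"
    unfolding borel_prod[symmetric] by measurable
  from measurable_compose[OF this \<phi>]
  have f: "?f \<in> borel_measurable (sample_space (Y n) (p n) (n + 1))" by simp
  have "?f (reindex n \<pi> w) = \<phi> (score_all C n a w) (score_but C n a b w) (score_but C n b a w)"
    if "w \<in> space (sample_space (Y n) (p n) (n + 1))" for w
    using score_all_reindex[OF C n e(1) \<pi>(1) that] score_but_reindex[OF C n e \<pi>(1) that]
      score_but_reindex[OF C n e(2,1) e(3)[symmetric] \<pi>(1) that] \<pi>(2,3) by simp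
  then have "(\<integral>\<omega>. \<phi> (score_all C n a (full_sample t n \<omega>)) (score_but C n a b (full_sample t n \<omega>))
      (score_but C n b a (full_sample t n \<omega>)) \<partial>M) = (\<integral>\<omega>. ?f (reindex n \<pi> (full_sample t n \<omega>)) \<partial>M)"
    using full_sample_space[OF n] by (intro Bochner_Integration.integral_cong) auto
  also have "\<dots> = (\<integral>\<omega>. ?f (full_sample t n \<omega>) \<partial>M)"
    by (rule integral_exchangeable[OF n f \<pi>(1)])
  finally show ?thesis .
qed

text \<open>The probability that a score changes by more than \<open>\<eta>\<close> when a training point is removed. By
  exchangeability it is the same for all pairs of points (\<open>prob_unstable\<close>), and stability of the scores
  says that it tends to zero.\<close>
definition instability :: "score_family \<Rightarrow> nat \<Rightarrow> real \<Rightarrow> real" where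
  "instability C n \<eta> = prob {\<omega> \<in> space M.
    \<bar>score_all C n (n + 1) (full_sample t n \<omega>) - score_but C n (n + 1) n (full_sample t n \<omega>)\<bar> > \<eta>}"

lemma prob_unstable:
  assumes C: "conformity_scores Y p C" and n: "1 \<le> n"
    and a: "a \<in> {1..n + 1}" "b \<in> {1..n + 1}" "a \<noteq> b"
  shows "prob {\<omega> \<in> space M.
    \<bar>score_all C n a (full_sample t n \<omega>) - score_but C n a b (full_sample t n \<omega>)\<bar> > \<eta>} = instability C n \<eta>"
proof -
  have ind: "(\<integral>\<omega>. of_bool (Q \<omega>) \<partial>M) = prob {\<omega> \<in> space M. Q \<omega>}" for Q :: "'w \<Rightarrow> bool"
  proof -
    have "(\<integral>\<omega>. of_bool (Q \<omega>) \<partial>M) = (\<integral>\<omega>. indicator {\<omega> \<in> space M. Q \<omega>} \<omega> \<partial>M :: real)"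
      by (rule Bochner_Integration.integral_cong) (auto simp: indicator_def)
    then show ?thesis by (simp add: Int_absorb2 subsetI)
  qed
  have "(\<lambda>(x, y, u). of_bool (\<bar>x - y\<bar> > \<eta>) :: real) \<in> borel_measurable (borel :: (real \<times> real \<times> real) measure)"
    unfolding borel_prod[symmetric] by measurable
  from integral_score_pair[OF C n a this] show ?thesis
    by (simp add: ind instability_def)
qed

lemma instability_tendsto_0:
  assumes C: "conformity_scores Y p C" and s: "stable_scores M t C" and "\<eta> > 0"
  shows "(\<lambda>n. instability C n \<eta>) \<longlonglongrightarrow> 0"
proof -
  have "instability C n \<eta> = prob {\<omega> \<in> space M. \<bar>\<bar>C n n (t n (n + 1) \<omega>) (training t n \<omega>)
      - C n (n - 1) (t n (n + 1) \<omega>) (remove_entry n n (training t n \<omega>))\<bar>\<bar> > \<eta>}" if n: "n \<ge> 1" for n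
  proof -
    have w: "restrict (full_sample t n \<omega>) {1..n} = training t n \<omega>"
      "full_sample t n \<omega> (n + 1) = t n (n + 1) \<omega>" for \<omega>
      by (auto simp: full_sample_def training_def fun_eq_iff restrict_def)
    show ?thesis
      unfolding instability_def
    proof (intro arg_cong[where f = prob] Collect_cong conj_cong refl)
      fix \<omega> assume "\<omega> \<in> space M"
      then have W: "full_sample t n \<omega> \<in> space (sample_space (Y n) (p n) (n + 1))"
        by (rule full_sample_space[OF n])
      have "n \<in> {1..n}" "n + 1 \<noteq> n" using n by auto
      then have "score_but C n (n + 1) n (full_sample t n \<omega>) =
          C n (n - 1) (t n (n + 1) \<omega>) (remove_entry n n (training t n \<omega>))"
        using score_but_eq_remove_entry[OF C n _ _ W, of n "n + 1"] unfolding w by simp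
      moreover have "score_all C n (n + 1) (full_sample t n \<omega>) =
          C n n (t n (n + 1) \<omega>) (training t n \<omega>)"
        using score_all_eq_restrict[OF C n W] unfolding w by simp
      ultimately show "(\<eta> < \<bar>score_all C n (n + 1) (full_sample t n \<omega>) -
          score_but C n (n + 1) n (full_sample t n \<omega>)\<bar>) \<longleftrightarrow>
        (\<eta> < \<bar>\<bar>C n n (t n (n + 1) \<omega>) (training t n \<omega>) -
          C n (n - 1) (t n (n + 1) \<omega>) (remove_entry n n (training t n \<omega>))\<bar>\<bar>)"
        by (simp only: abs_abs)
    qed
  qed
  then have "\<forall>\<^sub>F n in sequentially. instability C n \<eta> = prob {\<omega> \<in> space M. \<bar>\<bar>C n n (t n (n + 1) \<omega>) (training t n \<omega>)
      - C n (n - 1) (t n (n + 1) \<omega>) (remove_entry n n (training t n \<omega>))\<bar>\<bar> > \<eta>}"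
    by (intro eventually_sequentiallyI[of 1])
  then show ?thesis
    using s \<open>\<eta> > 0\<close> unfolding stable_scores_def tendsto_zero_in_prob_def
    by (simp only: tendsto_cong)
qed

text \<open>If the events \<open>E n i\<close> are uniformly improbable, then with high probability only a small fraction
  of them occurs, by Markov's inequality for their expected number.\<close>
lemma vanishing_fraction:
  assumes E: "\<And>n i. 1 \<le> n \<Longrightarrow> i \<in> {1..n} \<Longrightarrow> {\<omega> \<in> space M. E n i \<omega>} \<in> sets M"
    and s: "\<And>n i. 1 \<le> n \<Longrightarrow> i \<in> {1..n} \<Longrightarrow> prob {\<omega> \<in> space M. E n i \<omega>} \<le> s n"
    and lim: "s \<longlonglongrightarrow> 0" and "\<kappa> > 0"
  shows "vanishing M (\<lambda>n. {\<omega> \<in> space M. (\<Sum>i=1..n. of_bool (E n i \<omega>)) > \<kappa> * real n})"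
proof -
  let ?X = "\<lambda>n \<omega>. (\<Sum>i=1..n. indicator {\<omega> \<in> space M. E n i \<omega>} \<omega>) / real n :: real"
  have int: "integrable M (\<lambda>\<omega>. \<Sum>i=1..n. indicator {\<omega> \<in> space M. E n i \<omega>} \<omega> :: real)" if "1 \<le> n" for n
    using E[OF that] by (intro Bochner_Integration.integrable_sum) (simp add: less_top[symmetric])
  have "vanishing M (\<lambda>n. {\<omega> \<in> space M. ?X n \<omega> > \<kappa>})"
  proof (rule vanishing_Markov[OF _ _ \<open>\<kappa> > 0\<close>])
    show "\<forall>\<^sub>F n in sequentially. integrable M (?X n) \<and> (\<forall>\<omega>\<in>space M. 0 \<le> ?X n \<omega>)"
      using int by (intro eventually_sequentiallyI[of 1] conjI ballI divide_nonneg_nonneg sum_nonneg)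
        (auto intro!: integrable_divide)
    have "0 \<le> expectation (?X n) \<and> expectation (?X n) \<le> s n" if n: "1 \<le> n" for n
    proof -
      have "expectation (?X n) = (\<Sum>i=1..n. prob {\<omega> \<in> space M. E n i \<omega>}) / real n"
        using E[OF n] by (simp add: Bochner_Integration.integral_sum less_top[symmetric] Int_absorb2 subsetI)
      moreover have "(\<Sum>i=1..n. prob {\<omega> \<in> space M. E n i \<omega>}) \<le> (\<Sum>i=1..n. s n)"
        using s[OF n] by (intro sum_mono) auto
      ultimately show ?thesis using n by (auto simp: field_simps intro!: divide_nonneg_nonneg sum_nonneg)
    qed
    then show "(\<lambda>n. expectation (?X n)) \<longlonglongrightarrow> 0"
      by (intro tendsto_sandwich[OF _ _ tendsto_const lim] eventually_sequentiallyI[of 1]) auto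
  qed
  then show ?thesis
  proof (rule vanishing_mono, intro eventually_sequentiallyI[of 1] subsetI)
    fix n \<omega> assume n: "1 \<le> n" and \<omega>: "\<omega> \<in> {\<omega> \<in> space M. (\<Sum>i=1..n. of_bool (E n i \<omega>)) > \<kappa> * real n}"
    then have "(\<Sum>i=1..n. of_bool (E n i \<omega>)) = (\<Sum>i=1..n. indicator {\<omega> \<in> space M. E n i \<omega>} \<omega> :: real)"
      by (intro sum.cong) (auto simp: indicator_def)
    then show "\<omega> \<in> {\<omega> \<in> space M. ?X n \<omega> > \<kappa>}" using n \<omega> by (auto simp: field_simps)
  qed
qed

end

section \<open>The p-values of the methods and their comparison\<close>

lemma sum_of_bool_le:
  assumes "\<And>i. i \<in> I \<Longrightarrow> A i \<Longrightarrow> B i \<or> E i"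
  shows "(\<Sum>i\<in>I. of_bool (A i) :: real) \<le> (\<Sum>i\<in>I. of_bool (B i)) + (\<Sum>i\<in>I. of_bool (E i))"
proof -
  have "(\<Sum>i\<in>I. of_bool (A i) :: real) \<le> (\<Sum>i\<in>I. of_bool (B i) + of_bool (E i))"
    using assms by (intro sum_mono) auto
  then show ?thesis by (simp add: sum.distrib)
qed

lemma sum_of_bool_bounds:
  "0 \<le> (\<Sum>i=1..n. of_bool (A i) :: real)" "(\<Sum>i=1..n. of_bool (A i) :: real) \<le> real n"
proof -
  show "0 \<le> (\<Sum>i=1..n. of_bool (A i) :: real)" by (intro sum_nonneg) auto
  have "(\<Sum>i=1..n. of_bool (A i) :: real) \<le> (\<Sum>i=1..n. 1)" by (intro sum_mono) auto
  then show "(\<Sum>i=1..n. of_bool (A i) :: real) \<le> real n" by simp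
qed

text \<open>A value exceeds the inflated empirical quantile iff few of the sample values, inflated,
  reach it.\<close>
lemma not_le_quantile_emp_cdf:
  assumes n: "1 \<le> n"
  shows "\<not> ereal a \<le> quantile (emp_cdf n v) (1 - \<alpha>) + ereal \<delta> \<longleftrightarrow>
    (\<Sum>i=1..n. of_bool (a \<le> v i + \<delta>)) / real n \<le> \<alpha>"
proof -
  let ?Q = "quantile (emp_cdf n v) (1 - \<alpha>)"
  have emp: "emp_cdf n v s = (\<Sum>i=1..n. of_bool (v i \<le> s)) / real n" for s
    by (simp only: emp_cdf_def times_divide_eq_left mult_1_left)
  have "\<not> ereal a \<le> ?Q + ereal \<delta> \<longleftrightarrow> ?Q < ereal (a - \<delta>)"
    by (cases ?Q) auto
  also have "\<dots> \<longleftrightarrow> (\<exists>s < a - \<delta>. 1 - \<alpha> \<le> emp_cdf n v s)"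
    unfolding quantile_def Inf_less_iff by auto
  also have "\<dots> \<longleftrightarrow> 1 - \<alpha> \<le> (\<Sum>i=1..n. of_bool (v i < a - \<delta>)) / real n"
  proof
    assume "\<exists>s < a - \<delta>. 1 - \<alpha> \<le> emp_cdf n v s"
    then obtain s where s: "s < a - \<delta>" "1 - \<alpha> \<le> emp_cdf n v s" by blast
    have "(\<Sum>i=1..n. of_bool (v i \<le> s) :: real) \<le> (\<Sum>i=1..n. of_bool (v i < a - \<delta>))"
      using s(1) by (intro sum_mono) auto
    then have "emp_cdf n v s \<le> (\<Sum>i=1..n. of_bool (v i < a - \<delta>)) / real n"
      unfolding emp by (rule divide_right_mono) simp
    with s(2) show "1 - \<alpha> \<le> (\<Sum>i=1..n. of_bool (v i < a - \<delta>)) / real n" by (rule order_trans)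
  next
    assume l: "1 - \<alpha> \<le> (\<Sum>i=1..n. of_bool (v i < a - \<delta>)) / real n"
    let ?V = "insert (a - \<delta> - 1) {v i |i. i \<in> {1..n} \<and> v i < a - \<delta>}"
    have fin: "finite ?V" by simp
    have "Max ?V \<in> ?V" by (rule Max_in) (use fin in auto)
    moreover have "\<forall>x\<in>?V. x < a - \<delta>" by auto
    ultimately have s: "Max ?V < a - \<delta>" by blast
    have "(\<Sum>i=1..n. of_bool (v i < a - \<delta>) :: real) = (\<Sum>i=1..n. of_bool (v i \<le> Max ?V))"
    proof (rule sum.cong[OF refl])
      fix i assume i: "i \<in> {1..n}"
      have "v i < a - \<delta> \<longleftrightarrow> v i \<le> Max ?V"
      proof
        assume "v i < a - \<delta>"
        then show "v i \<le> Max ?V" using i by (intro Max_ge[OF fin]) blast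
      qed (use s in linarith)
      then show "of_bool (v i < a - \<delta>) = (of_bool (v i \<le> Max ?V) :: real)" by simp
    qed
    with l have "1 - \<alpha> \<le> emp_cdf n v (Max ?V)" unfolding emp by (simp only:)
    with s show "\<exists>s < a - \<delta>. 1 - \<alpha> \<le> emp_cdf n v s" by blast
  qed
  also have "(\<Sum>i=1..n. of_bool (v i < a - \<delta>)) = real n - (\<Sum>i=1..n. of_bool (a \<le> v i + \<delta>))"
  proof -
    have "(\<Sum>i=1..n. of_bool (v i < a - \<delta>)) + (\<Sum>i=1..n. of_bool (a \<le> v i + \<delta>)) = (\<Sum>i=1..n. 1 :: real)"
      unfolding sum.distrib[symmetric] by (intro sum.cong) auto
    then show ?thesis by simp
  qed
  also have "1 - \<alpha> \<le> (real n - (\<Sum>i=1..n. of_bool (a \<le> v i + \<delta>))) / real n \<longleftrightarrow>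
      (\<Sum>i=1..n. of_bool (a \<le> v i + \<delta>)) / real n \<le> \<alpha>"
    using n by (auto simp: field_simps)
  finally show ?thesis .
qed

text \<open>The p-value of the shortcut. The inflation \<open>\<delta>\<close> may be negative.\<close>
definition pv_sc :: "score_family \<Rightarrow> nat \<Rightarrow> real \<Rightarrow> sample \<Rightarrow> real" where
  "pv_sc C n \<delta> w =
    (\<Sum>i=1..n. of_bool (score_all C n (n + 1) w \<le> score_but C n i (n + 1) w + \<delta>)) / real n"

text \<open>The p-value of full conformal prediction. The score of the new point does not exceed itself, which
  gives the additional one.\<close>
definition pv_fc :: "score_family \<Rightarrow> nat \<Rightarrow> real \<Rightarrow> sample \<Rightarrow> real" where
  "pv_fc C n \<delta> w =
    (1 + (\<Sum>i=1..n. of_bool (score_all C n (n + 1) w \<le> score_all C n i w + \<delta>))) / real (n + 1)"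

text \<open>The p-value of cross-conformal prediction.\<close>
definition pv_cc :: "score_family \<Rightarrow> nat \<Rightarrow> real \<Rightarrow> sample \<Rightarrow> real" where
  "pv_cc C n \<delta> w =
    (1 + (\<Sum>i=1..n. of_bool (score_but C n (n + 1) i w \<le> score_but C n i (n + 1) w + \<delta>))) / real (n + 1)"

text \<open>The predictions of an algorithm, regarded as a score; stability of this score is stability of the
  algorithm.\<close>
definition prediction :: "algorithm \<Rightarrow> score_family" where
  "prediction A n m z T = A n m (snd z) T"

text \<open>The p-value of the Jackknife+. A response is not covered if it lies above the upper or below the
  lower end of the interval; the two counts belong to the two ends.\<close>
definition pv_sJ_plus :: "algorithm \<Rightarrow> nat \<Rightarrow> real \<Rightarrow> sample \<Rightarrow> real" where
  "pv_sJ_plus A n \<delta> w = min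
    (\<Sum>i=1..n. of_bool (fst (w (n + 1)) - score_but (prediction A) n (n + 1) i w
      \<le> score_but (oos_error A) n i (n + 1) w + \<delta>))
    (\<Sum>i=1..n. of_bool (score_but (prediction A) n (n + 1) i w - fst (w (n + 1))
      \<le> score_but (oos_error A) n i (n + 1) w + \<delta>)) / real n"

lemma conformity_scores_prediction:
  assumes A: "symmetric_algorithm Y p A"
  shows "conformity_scores Y p (prediction A)"
  unfolding conformity_scores_def
proof (intro allI impI conjI ballI)
  fix n m :: nat assume n: "1 \<le> n"
  let ?Z = "data_space (Y n) (p n)" and ?N = "sample_space (Y n) (p n) m"
  have 1: "case_prod (A n m) \<in> borel_measurable (feature_space (p n) \<Otimes>\<^sub>M ?N)"
    using A n unfolding symmetric_algorithm_def by (auto simp: measurable_restrict_space2_iff)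
  have "(\<lambda>(z, T). (snd z, T)) \<in> measurable (?Z \<Otimes>\<^sub>M ?N) (feature_space (p n) \<Otimes>\<^sub>M ?N)"
    unfolding data_space_def by measurable
  from measurable_compose[OF this 1]
  show "case_prod (prediction A n m) \<in> borel_measurable (?Z \<Otimes>\<^sub>M ?N)"
    by (simp add: prediction_def case_prod_unfold)
  fix z T \<pi> assume z: "z \<in> space ?Z" and T: "T \<in> space ?N" and \<pi>: "\<pi> permutes {1..m}"
  have "snd z \<in> space (feature_space (p n))"
    using z by (auto simp: data_space_def space_pair_measure)
  then show "prediction A n m z (T \<circ> \<pi>) = prediction A n m z T"
    using A n T \<pi> by (simp add: symmetric_algorithm_def prediction_def)
qed

lemma measurable_fst_data: "fst \<in> borel_measurable (data_space Y d)"
proof -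
  have "fst \<in> measurable (data_space Y d) (restrict_space borel Y)"
    unfolding data_space_def by measurable
  then show ?thesis by (simp add: measurable_restrict_space2_iff)
qed

lemma oos_error_eq: "oos_error A n m z T = \<bar>fst z - prediction A n m z T\<bar>"
  by (simp add: oos_error_def prediction_def)

lemma conformity_scores_oos_error:
  assumes A: "symmetric_algorithm Y p A"
  shows "conformity_scores Y p (oos_error A)"
  unfolding conformity_scores_def
proof (intro allI impI conjI ballI)
  fix n m :: nat assume n: "1 \<le> n"
  let ?Z = "data_space (Y n) (p n)" and ?N = "sample_space (Y n) (p n) m"
  note D = conformity_scores_prediction[OF A, unfolded conformity_scores_def, rule_format, OF n, of m]
  note [measurable] = D[THEN conjunct1] measurable_fst_data
  have "(\<lambda>x. \<bar>fst (fst x) - case_prod (prediction A n m) x\<bar>) \<in> borel_measurable (?Z \<Otimes>\<^sub>M ?N)"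
    by measurable
  then show "case_prod (oos_error A n m) \<in> borel_measurable (?Z \<Otimes>\<^sub>M ?N)"
    by (simp add: oos_error_eq case_prod_unfold)
  fix z T \<pi> assume "z \<in> space ?Z" "T \<in> space ?N" "\<pi> permutes {1..m}"
  then show "oos_error A n m z (T \<circ> \<pi>) = oos_error A n m z T"
    using D by (simp add: oos_error_eq)
qed

lemma measurable_sum_of_bool_le:
  fixes f g :: "nat \<Rightarrow> 'b \<Rightarrow> real"
  assumes "\<And>i. i \<in> {1..n} \<Longrightarrow> f i \<in> borel_measurable N" "\<And>i. i \<in> {1..n} \<Longrightarrow> g i \<in> borel_measurable N"
  shows "(\<lambda>x. \<Sum>i=1..n. of_bool (f i x \<le> g i x + \<delta>) :: real) \<in> borel_measurable N"
proof (rule borel_measurable_sum)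
  fix i assume "i \<in> {1..n}"
  note [measurable] = assms[OF this]
  show "(\<lambda>x. of_bool (f i x \<le> g i x + \<delta>) :: real) \<in> borel_measurable N" by measurable
qed

lemma count_plus_one:
  fixes N :: real
  assumes "1 \<le> n" "0 \<le> N" "N \<le> real n"
  shows "N \<le> real n * ((1 + N) / real (n + 1))" "real n * ((1 + N) / real (n + 1)) \<le> N + 1"
  using assms by (auto simp: field_simps)

context iid_array
begin

lemma scores_fun_upd:
  assumes C: "conformity_scores Y p C" "1 \<le> n" and T: "T \<in> space (sample_space (Y n) (p n) n)"
    and z: "z \<in> space (data_space (Y n) (p n))"
  shows "score_all C n (n + 1) (T(n + 1 := z)) = C n n z T"
    and "i \<in> {1..n} \<Longrightarrow> score_all C n i (T(n + 1 := z)) = C n n (T i) (remove_entry (n + 1) i (T(n + 1 := z)))"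
    and "i \<in> {1..n} \<Longrightarrow> score_but C n i (n + 1) (T(n + 1 := z)) = C n (n - 1) (T i) (remove_entry n i T)"
    and "i \<in> {1..n} \<Longrightarrow> score_but C n (n + 1) i (T(n + 1 := z)) = C n (n - 1) z (remove_entry n i T)"
proof -
  note w = space_sample_fun_upd[OF T z]
  have r: "restrict (T(n + 1 := z)) {1..n} = T" by (rule restrict_fun_upd_sample[OF T])
  have last: "(T(n + 1 := z)) (n + 1) = z" by simp
  show "score_all C n (n + 1) (T(n + 1 := z)) = C n n z T"
    using score_all_eq_restrict[OF C w] unfolding r last by (rule sym)
  assume i: "i \<in> {1..n}"
  then have i': "i \<noteq> n + 1" "i \<in> {1..n + 1}" by auto
  have other: "(T(n + 1 := z)) i = T i" using i'(1) by simp
  show "score_all C n i (T(n + 1 := z)) = C n n (T i) (remove_entry (n + 1) i (T(n + 1 := z)))"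
    using score_all_eq_remove_entry[OF C i'(2) w] unfolding other by (rule sym)
  show "score_but C n i (n + 1) (T(n + 1 := z)) = C n (n - 1) (T i) (remove_entry n i T)"
    using score_but_eq_remove_entry[OF C i insertI1 w] unfolding r other by (simp only: if_True simp_thms)
  show "score_but C n (n + 1) i (T(n + 1 := z)) = C n (n - 1) z (remove_entry n i T)"
    using score_but_eq_remove_entry[OF C i insertI2[OF singletonI] w] i'(1)[symmetric] unfolding r last
    by (simp only: if_False simp_thms)
qed

lemma fst_data: "z \<in> space (data_space (Y n) (p n)) \<Longrightarrow> fst z \<in> Y n"
  by (auto simp: data_space_def space_pair_measure space_restrict_space)

lemma measurable_score_last:
  assumes C: "conformity_scores Y p C" and n: "1 \<le> n"
  shows "score_all C n (n + 1) \<in> borel_measurable (sample_space (Y n) (p n) (n + 1))"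
    and "i \<in> {1..n} \<Longrightarrow> score_all C n i \<in> borel_measurable (sample_space (Y n) (p n) (n + 1))"
    and "i \<in> {1..n} \<Longrightarrow> score_but C n i (n + 1) \<in> borel_measurable (sample_space (Y n) (p n) (n + 1))"
    and "i \<in> {1..n} \<Longrightarrow> score_but C n (n + 1) i \<in> borel_measurable (sample_space (Y n) (p n) (n + 1))"
proof -
  have e: "n + 1 \<in> {1..n + 1}" by simp
  show "score_all C n (n + 1) \<in> borel_measurable (sample_space (Y n) (p n) (n + 1))"
    by (rule measurable_score_all[OF C n e])
  assume "i \<in> {1..n}"
  then have i: "i \<in> {1..n + 1}" "i \<noteq> n + 1" by auto
  show "score_all C n i \<in> borel_measurable (sample_space (Y n) (p n) (n + 1))"
    by (rule measurable_score_all[OF C n i(1)])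
  show "score_but C n i (n + 1) \<in> borel_measurable (sample_space (Y n) (p n) (n + 1))"
    by (rule measurable_score_but[OF C n i(1) e i(2)])
  show "score_but C n (n + 1) i \<in> borel_measurable (sample_space (Y n) (p n) (n + 1))"
    by (rule measurable_score_but[OF C n e i(1) i(2)[symmetric]])
qed

lemma pvalue_of_sc:
  assumes C: "conformity_scores Y p C"
  shows "pvalue_of Y p (PS_sc Y C) (pv_sc C)"
  unfolding pvalue_of_def
proof (intro allI impI conjI ballI)
  fix n :: nat and \<delta> :: real assume n: "1 \<le> n"
  show "pv_sc C n \<delta> \<in> borel_measurable (sample_space (Y n) (p n) (n + 1))"
    unfolding pv_sc_def[abs_def]
    by (intro borel_measurable_divide measurable_sum_of_bool_le measurable_score_last[OF C n]
        borel_measurable_const)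
  fix \<alpha> :: real and z :: point and T :: sample
  assume z: "z \<in> space (data_space (Y n) (p n))" and T: "T \<in> space (sample_space (Y n) (p n) n)"
  note eq = scores_fun_upd[OF C n T z]
  have "(\<Sum>i=1..n. of_bool (C n n z T \<le> C n (n - 1) (T i) (remove_entry n i T) + \<delta>) :: real) =
      (\<Sum>i=1..n. of_bool (score_all C n (n + 1) (T(n + 1 := z)) \<le> score_but C n i (n + 1) (T(n + 1 := z)) + \<delta>))"
    by (intro sum.cong refl) (simp only: eq)
  then show "fst z \<notin> PS_sc Y C n \<alpha> \<delta> (snd z) T \<longleftrightarrow> pv_sc C n \<delta> (T(n + 1 := z)) \<le> \<alpha>"
    using not_le_quantile_emp_cdf[OF n, of "C n n z T" "\<lambda>i. C n (n - 1) (T i) (remove_entry n i T)" \<alpha> \<delta>] fst_data[OF z]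
    by (simp add: PS_sc_def pv_sc_def del: fun_upd_apply)
qed

lemma pvalue_of_fc:
  assumes C: "conformity_scores Y p C"
  shows "pvalue_of Y p (PS_fc Y C) (pv_fc C)"
  unfolding pvalue_of_def
proof (intro allI impI conjI ballI)
  fix n :: nat and \<delta> :: real assume n: "1 \<le> n"
  show "pv_fc C n \<delta> \<in> borel_measurable (sample_space (Y n) (p n) (n + 1))"
    unfolding pv_fc_def[abs_def]
    by (intro borel_measurable_divide borel_measurable_add measurable_sum_of_bool_le
        measurable_score_last[OF C n] borel_measurable_const)
  fix \<alpha> :: real and z :: point and T :: sample
  assume \<delta>: "0 \<le> \<delta>" and z: "z \<in> space (data_space (Y n) (p n))"
    and T: "T \<in> space (sample_space (Y n) (p n) n)"
  note eq = scores_fun_upd[OF C n T z]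
  \<comment> \<open>All n + 1 scores, that of the new point being the last one; as \<open>\<delta> \<ge> 0\<close>, it always counts.\<close>
  define v where "v = (\<lambda>i. if i = n + 1 then C n n z T else C n n (T i) (remove_entry (n + 1) i (T(n + 1 := z))))"
  have sum: "(\<Sum>i=1..n + 1. of_bool (Q (v i)) :: real) = of_bool (Q (C n n z T)) +
      (\<Sum>i=1..n. of_bool (Q (C n n (T i) (remove_entry (n + 1) i (T(n + 1 := z))))))" for Q
  proof -
    have "(\<Sum>i=1..n. of_bool (Q (v i)) :: real) =
        (\<Sum>i=1..n. of_bool (Q (C n n (T i) (remove_entry (n + 1) i (T(n + 1 := z))))))"
      by (intro sum.cong) (auto simp: v_def)
    then show ?thesis by (simp add: v_def)
  qed
  have "fc_cdf C n z T = emp_cdf (n + 1) v"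
  proof
    fix s
    show "fc_cdf C n z T s = emp_cdf (n + 1) v s"
      unfolding fc_cdf_def emp_cdf_def sum[of "\<lambda>x. x \<le> s"] by (rule distrib_left[symmetric])
  qed
  moreover have "(\<Sum>i=1..n + 1. of_bool (C n n z T \<le> v i + \<delta>) :: real) =
      1 + (\<Sum>i=1..n. of_bool (score_all C n (n + 1) (T(n + 1 := z)) \<le> score_all C n i (T(n + 1 := z)) + \<delta>))"
    unfolding sum[of "\<lambda>x. C n n z T \<le> x + \<delta>"] using \<delta> eq(1,2) by (simp del: fun_upd_apply)
  ultimately show "fst z \<notin> PS_fc Y C n \<alpha> \<delta> (snd z) T \<longleftrightarrow> pv_fc C n \<delta> (T(n + 1 := z)) \<le> \<alpha>"
    using not_le_quantile_emp_cdf[of "n + 1" "C n n z T" v \<alpha> \<delta>] fst_data[OF z]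
    by (simp add: PS_fc_def pv_fc_def del: fun_upd_apply sum.cl_ivl_Suc)
qed

lemma pvalue_of_cc:
  assumes C: "conformity_scores Y p C"
  shows "pvalue_of Y p (PS_cc Y C) (pv_cc C)"
  unfolding pvalue_of_def
proof (intro allI impI conjI ballI)
  fix n :: nat and \<delta> :: real assume n: "1 \<le> n"
  show "pv_cc C n \<delta> \<in> borel_measurable (sample_space (Y n) (p n) (n + 1))"
    unfolding pv_cc_def[abs_def]
    by (intro borel_measurable_divide borel_measurable_add measurable_sum_of_bool_le
        measurable_score_last[OF C n] borel_measurable_const)
  fix \<alpha> :: real and z :: point and T :: sample
  assume z: "z \<in> space (data_space (Y n) (p n))" and T: "T \<in> space (sample_space (Y n) (p n) n)"
  note eq = scores_fun_upd[OF C n T z]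
  have "(\<Sum>i=1..n. of_bool (C n (n - 1) z (remove_entry n i T) \<le> C n (n - 1) (T i) (remove_entry n i T) + \<delta>) :: real) =
      (\<Sum>i=1..n. of_bool (score_but C n (n + 1) i (T(n + 1 := z)) \<le> score_but C n i (n + 1) (T(n + 1 := z)) + \<delta>))"
    by (intro sum.cong refl) (simp only: eq)
  then show "fst z \<notin> PS_cc Y C n \<alpha> \<delta> (snd z) T \<longleftrightarrow> pv_cc C n \<delta> (T(n + 1 := z)) \<le> \<alpha>"
    using fst_data[OF z] n
    by (simp add: PS_cc_def pv_cc_def not_less pos_divide_le_eq add.commute del: fun_upd_apply)
qed

lemma pvalue_of_sJ_plus:
  assumes A: "symmetric_algorithm Y p A"
  shows "pvalue_of Y p (PI_sJ_plus Y A) (pv_sJ_plus A)"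
  unfolding pvalue_of_def
proof (intro allI impI conjI ballI)
  note C = conformity_scores_oos_error[OF A] and D = conformity_scores_prediction[OF A]
  fix n :: nat and \<delta> :: real assume n: "1 \<le> n"
  have "(\<lambda>w. w (n + 1)) \<in> measurable (sample_space (Y n) (p n) (n + 1)) (data_space (Y n) (p n))"
    unfolding sample_space_def by (rule measurable_component_singleton) simp
  from measurable_compose[OF this measurable_fst_data]
  show "pv_sJ_plus A n \<delta> \<in> borel_measurable (sample_space (Y n) (p n) (n + 1))"
    unfolding pv_sJ_plus_def[abs_def]
    by (intro borel_measurable_divide borel_measurable_min measurable_sum_of_bool_le borel_measurable_diff
        measurable_score_last[OF C n] measurable_score_last[OF D n] borel_measurable_const)
  fix \<alpha> :: real and z :: point and T :: sample
  assume z: "z \<in> space (data_space (Y n) (p n))" and T: "T \<in> space (sample_space (Y n) (p n) n)"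
  note eq = scores_fun_upd[OF C n T z] scores_fun_upd[OF D n T z]
  let ?w = "T(n + 1 := z)" and ?m = "loo_prediction A n (snd z) T" and ?u = "\<lambda>i. \<bar>loo_residual A n T i\<bar>"
  have m: "score_but (prediction A) n (n + 1) i ?w = ?m i"
    and u: "score_but (oos_error A) n i (n + 1) ?w = ?u i" if "i \<in> {1..n}" for i
    using that by (simp_all only: eq prediction_def loo_prediction_def oos_error_def loo_residual_def)
  have y: "fst (?w (n + 1)) = fst z" by simp
  have 1: "(\<Sum>i=1..n. of_bool (fst (?w (n + 1)) - score_but (prediction A) n (n + 1) i ?w
      \<le> score_but (oos_error A) n i (n + 1) ?w + \<delta>) :: real) = (\<Sum>i=1..n. of_bool (fst z \<le> (?m i + ?u i) + \<delta>))"
    unfolding y by (intro sum.cong refl arg_cong[where f = of_bool]) (simp only: m u, linarith)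
  have 2: "(\<Sum>i=1..n. of_bool (score_but (prediction A) n (n + 1) i ?w - fst (?w (n + 1))
      \<le> score_but (oos_error A) n i (n + 1) ?w + \<delta>) :: real) = (\<Sum>i=1..n. of_bool (- fst z \<le> (- ?m i + ?u i) + \<delta>))"
    unfolding y by (intro sum.cong refl arg_cong[where f = of_bool]) (simp only: m u, linarith)
  let ?q = "quantile (emp_cdf n (\<lambda>i. - ?m i + ?u i)) (1 - \<alpha>)"
  have q: "- ?q - ereal \<delta> \<le> ereal (fst z) \<longleftrightarrow> ereal (- fst z) \<le> ?q + ereal \<delta>"
    by (cases ?q) auto
  have min: "min a b / real n \<le> \<alpha> \<longleftrightarrow> a / real n \<le> \<alpha> \<or> b / real n \<le> \<alpha>" for a b :: real
    using n by (auto simp: min_def field_simps)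
  show "fst z \<notin> PI_sJ_plus Y A n \<alpha> \<delta> (snd z) T \<longleftrightarrow> pv_sJ_plus A n \<delta> (T(n + 1 := z)) \<le> \<alpha>"
    unfolding pv_sJ_plus_def 1 2 min not_le_quantile_emp_cdf[OF n, symmetric]
    using fst_data[OF z] q by (auto simp: PI_sJ_plus_def Let_def)
qed

text \<open>The criterion for closeness of a p-value to another one: the corresponding counts differ by at most
  the number of pairs (a n i, b n i) for which removing b n i changes the score of a n i by more than
  \<open>\<eta>\<close>, plus one. The score D that is assumed stable need not be the one in the p-values.\<close>
lemma pvalues_close_count:
  assumes D: "conformity_scores Y p D"
    and stable: "\<And>\<eta>. \<eta> > 0 \<Longrightarrow> (\<lambda>n. instability D n \<eta>) \<longlonglongrightarrow> 0"
    and ab: "\<And>n i. i \<in> {1..n} \<Longrightarrow> a n i \<in> {1..n + 1} \<and> b n i \<in> {1..n + 1} \<and> a n i \<noteq> b n i"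
    and count: "\<And>n w \<delta> \<eta> e. 1 \<le> n \<Longrightarrow> \<delta> \<ge> 0 \<Longrightarrow> \<eta> > 0 \<Longrightarrow>
      e = (\<Sum>i=1..n. of_bool (\<bar>score_all D n (a n i) w - score_but D n (a n i) (b n i) w\<bar> > \<eta>)) \<Longrightarrow>
      real n * \<sigma> n (\<delta> - \<eta>) w - e \<le> real n * \<rho> n \<delta> w \<and> real n * \<rho> n \<delta> w \<le> real n * \<sigma> n (\<delta> + \<eta>) w + e + 1"
  shows "pvalues_close \<rho> \<sigma>"
  unfolding pvalues_close_def
proof (intro allI impI)
  fix \<delta> \<eta> \<kappa> :: real assume "\<delta> \<ge> 0" "\<eta> > 0" "\<kappa> > 0"
  let ?E = "\<lambda>n i \<omega>. \<bar>score_all D n (a n i) (full_sample t n \<omega>) -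
    score_but D n (a n i) (b n i) (full_sample t n \<omega>)\<bar> > \<eta>"
  have "vanishing M (\<lambda>n. {\<omega> \<in> space M. (\<Sum>i=1..n. of_bool (?E n i \<omega>)) > \<kappa> / 2 * real n})"
  proof (rule vanishing_fraction[OF _ _ stable[OF \<open>\<eta> > 0\<close>]])
    fix n i :: nat assume n: "1 \<le> n" and i: "i \<in> {1..n}"
    note [measurable] = measurable_full_sample[OF n]
    have [measurable]: "score_all D n (a n i) \<in> borel_measurable (sample_space (Y n) (p n) (n + 1))"
      "score_but D n (a n i) (b n i) \<in> borel_measurable (sample_space (Y n) (p n) (n + 1))"
      using ab[OF i] by (blast intro: measurable_score_all[OF D n] measurable_score_but[OF D n])+
    show "{\<omega> \<in> space M. ?E n i \<omega>} \<in> sets M" by measurable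
    show "prob {\<omega> \<in> space M. ?E n i \<omega>} \<le> instability D n \<eta>"
      using prob_unstable[OF D n, of "a n i" "b n i" \<eta>] ab[OF i] by simp
  qed (use \<open>\<kappa> > 0\<close> in simp)
  then show "vanishing M (\<lambda>n. {\<omega> \<in> space M. \<not> (\<sigma> n (\<delta> - \<eta>) (full_sample t n \<omega>) - \<kappa> \<le> \<rho> n \<delta> (full_sample t n \<omega>) \<and>
      \<rho> n \<delta> (full_sample t n \<omega>) \<le> \<sigma> n (\<delta> + \<eta>) (full_sample t n \<omega>) + \<kappa>)})"
  proof (rule vanishing_mono, intro eventually_sequentiallyI[of "nat \<lceil>2 / \<kappa>\<rceil> + 1"] subsetI)
    fix n \<omega> assume n: "nat \<lceil>2 / \<kappa>\<rceil> + 1 \<le> n"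
      and \<omega>: "\<omega> \<in> {\<omega> \<in> space M. \<not> (\<sigma> n (\<delta> - \<eta>) (full_sample t n \<omega>) - \<kappa> \<le> \<rho> n \<delta> (full_sample t n \<omega>) \<and>
        \<rho> n \<delta> (full_sample t n \<omega>) \<le> \<sigma> n (\<delta> + \<eta>) (full_sample t n \<omega>) + \<kappa>)}"
    have "2 / \<kappa> \<le> real n" using n by linarith
    then have n1: "1 \<le> \<kappa> / 2 * real n" using \<open>\<kappa> > 0\<close> by (simp add: field_simps)
    have n0: "1 \<le> n" using n by simp
    let ?w = "full_sample t n \<omega>"
    note c = count[OF n0 \<open>\<delta> \<ge> 0\<close> \<open>\<eta> > 0\<close> refl, of ?w]
    show "\<omega> \<in> {\<omega> \<in> space M. (\<Sum>i=1..n. of_bool (?E n i \<omega>)) > \<kappa> / 2 * real n}"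
    proof (rule ccontr)
      assume "\<not> ?thesis"
      then have e: "(\<Sum>i=1..n. of_bool (?E n i \<omega>)) \<le> \<kappa> / 2 * real n" using \<omega> by simp
      have "real n * (\<sigma> n (\<delta> - \<eta>) ?w - \<kappa>) \<le> real n * \<rho> n \<delta> ?w"
        using c e n1 by (simp add: algebra_simps)
      moreover have "real n * \<rho> n \<delta> ?w \<le> real n * (\<sigma> n (\<delta> + \<eta>) ?w + \<kappa>)"
        using c e n1 by (simp add: algebra_simps)
      ultimately show False using \<omega> n0 by (simp add: mult_le_cancel_left)
    qed
  qed
qed

lemma close_cc_sc:
  assumes C: "conformity_scores Y p C"
    and stable: "\<And>\<eta>. \<eta> > 0 \<Longrightarrow> (\<lambda>n. instability C n \<eta>) \<longlonglongrightarrow> 0"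
  shows "pvalues_close (pv_cc C) (pv_sc C)"
proof (rule pvalues_close_count[OF C stable, where a = "\<lambda>n i. n + 1" and b = "\<lambda>n i. i"])
  fix n :: nat and w :: sample and \<delta> \<eta> e :: real
  assume n: "1 \<le> n" and "\<delta> \<ge> 0" "\<eta> > 0"
    and e: "e = (\<Sum>i=1..n. of_bool (\<bar>score_all C n (n + 1) w - score_but C n (n + 1) i w\<bar> > \<eta>) :: real)"
  let ?N = "\<Sum>i=1..n. of_bool (score_but C n (n + 1) i w \<le> score_but C n i (n + 1) w + \<delta>) :: real"
  let ?S = "\<lambda>\<delta>. \<Sum>i=1..n. of_bool (score_all C n (n + 1) w \<le> score_but C n i (n + 1) w + \<delta>) :: real"
  have "?S (\<delta> - \<eta>) \<le> ?N + e" unfolding e by (rule sum_of_bool_le) linarith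
  moreover have "?N \<le> ?S (\<delta> + \<eta>) + e" unfolding e by (rule sum_of_bool_le) linarith
  moreover note count_plus_one[OF n sum_of_bool_bounds[of "\<lambda>i. score_but C n (n + 1) i w \<le> score_but C n i (n + 1) w + \<delta>" n]]
  ultimately show "real n * pv_sc C n (\<delta> - \<eta>) w - e \<le> real n * pv_cc C n \<delta> w \<and>
      real n * pv_cc C n \<delta> w \<le> real n * pv_sc C n (\<delta> + \<eta>) w + e + 1"
    using n unfolding pv_sc_def pv_cc_def by simp
qed auto

lemma close_fc_sc:
  assumes C: "conformity_scores Y p C"
    and stable: "\<And>\<eta>. \<eta> > 0 \<Longrightarrow> (\<lambda>n. instability C n \<eta>) \<longlonglongrightarrow> 0"
  shows "pvalues_close (pv_fc C) (pv_sc C)"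
proof (rule pvalues_close_count[OF C stable, where a = "\<lambda>n i. i" and b = "\<lambda>n i. n + 1"])
  fix n :: nat and w :: sample and \<delta> \<eta> e :: real
  assume n: "1 \<le> n" and "\<delta> \<ge> 0" "\<eta> > 0"
    and e: "e = (\<Sum>i=1..n. of_bool (\<bar>score_all C n i w - score_but C n i (n + 1) w\<bar> > \<eta>) :: real)"
  let ?N = "\<Sum>i=1..n. of_bool (score_all C n (n + 1) w \<le> score_all C n i w + \<delta>) :: real"
  let ?S = "\<lambda>\<delta>. \<Sum>i=1..n. of_bool (score_all C n (n + 1) w \<le> score_but C n i (n + 1) w + \<delta>) :: real"
  have "?S (\<delta> - \<eta>) \<le> ?N + e" unfolding e by (rule sum_of_bool_le) linarith
  moreover have "?N \<le> ?S (\<delta> + \<eta>) + e" unfolding e by (rule sum_of_bool_le) linarith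
  moreover note count_plus_one[OF n sum_of_bool_bounds[of "\<lambda>i. score_all C n (n + 1) w \<le> score_all C n i w + \<delta>" n]]
  ultimately show "real n * pv_sc C n (\<delta> - \<eta>) w - e \<le> real n * pv_fc C n \<delta> w \<and>
      real n * pv_fc C n \<delta> w \<le> real n * pv_sc C n (\<delta> + \<eta>) w + e + 1"
    using n unfolding pv_sc_def pv_fc_def by simp
qed auto

lemma close_sJ_plus_sc:
  assumes A: "symmetric_algorithm Y p A"
    and stable: "\<And>\<eta>. \<eta> > 0 \<Longrightarrow> (\<lambda>n. instability (prediction A) n \<eta>) \<longlonglongrightarrow> 0"
  shows "pvalues_close (pv_sJ_plus A) (pv_sc (oos_error A))"
proof (rule pvalues_close_count[OF conformity_scores_prediction[OF A] stable,
      where a = "\<lambda>n i. n + 1" and b = "\<lambda>n i. i"])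
  fix n :: nat and w :: sample and \<delta> \<eta> e :: real
  let ?y = "fst (w (n + 1))" and ?m = "score_all (prediction A) n (n + 1) w"
    and ?m' = "\<lambda>i. score_but (prediction A) n (n + 1) i w"
    and ?r = "\<lambda>i. score_but (oos_error A) n i (n + 1) w"
  assume n: "1 \<le> n" and "\<delta> \<ge> 0" "\<eta> > 0"
    and e: "e = (\<Sum>i=1..n. of_bool (\<bar>?m - ?m' i\<bar> > \<eta>) :: real)"
  have L: "score_all (oos_error A) n (n + 1) w = \<bar>?y - ?m\<bar>"
    by (simp add: score_all_def oos_error_eq)
  let ?U = "\<Sum>i=1..n. of_bool (?y - ?m' i \<le> ?r i + \<delta>) :: real"
  let ?V = "\<Sum>i=1..n. of_bool (?m' i - ?y \<le> ?r i + \<delta>) :: real"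
  let ?S = "\<lambda>\<delta>. \<Sum>i=1..n. of_bool (\<bar>?y - ?m\<bar> \<le> ?r i + \<delta>) :: real"
  have "?S (\<delta> - \<eta>) \<le> ?U + e" unfolding e by (rule sum_of_bool_le) linarith
  moreover have "?S (\<delta> - \<eta>) \<le> ?V + e" unfolding e by (rule sum_of_bool_le) linarith
  moreover have "?U \<le> ?S (\<delta> + \<eta>) + e" if "?m \<le> ?y"
    unfolding e by (rule sum_of_bool_le) (use that in linarith)
  moreover have "?V \<le> ?S (\<delta> + \<eta>) + e" if "\<not> ?m \<le> ?y"
    unfolding e by (rule sum_of_bool_le) (use that in linarith)
  ultimately have "?S (\<delta> - \<eta>) - e \<le> min ?U ?V \<and> min ?U ?V \<le> ?S (\<delta> + \<eta>) + e + 1"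
    by linarith
  then show "real n * pv_sc (oos_error A) n (\<delta> - \<eta>) w - e \<le> real n * pv_sJ_plus A n \<delta> w \<and>
      real n * pv_sJ_plus A n \<delta> w \<le> real n * pv_sc (oos_error A) n (\<delta> + \<eta>) w + e + 1"
    using n unfolding pv_sc_def pv_sJ_plus_def L by simp
qed auto

end

section \<open>Scores with a bounded density, and the level of the shortcut\<close>

lemma distributed_interval_le:
  fixes X :: "'a \<Rightarrow> real"
  assumes "prob_space N" and X: "distributed N lborel X f" and f: "(SUP s. f s) \<le> ennreal K"
    and "0 \<le> K" "a \<le> b"
  shows "measure N {x \<in> space N. X x \<in> {a..b}} \<le> K * (b - a)"
proof -
  interpret prob_space N by fact
  have [measurable]: "f \<in> borel_measurable lborel" using X by (simp add: distributed_def)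
  have "emeasure N (X -` {a..b} \<inter> space N) = (\<integral>\<^sup>+x. f x * indicator {a..b} x \<partial>lborel)"
    by (rule distributed_emeasure[OF X]) simp
  also have "\<dots> \<le> (\<integral>\<^sup>+x. ennreal K * indicator {a..b} x \<partial>lborel)"
  proof (rule nn_integral_mono)
    fix x
    have "f x \<le> ennreal K" using f by (meson SUP_upper UNIV_I order_trans)
    then show "f x * indicator {a..b} x \<le> ennreal K * indicator {a..b} x"
      by (rule mult_right_mono) simp
  qed
  also have "\<dots> = ennreal (K * (b - a))"
    using assms by (subst nn_integral_cmult_indicator) (auto simp: ennreal_mult)
  also have "X -` {a..b} \<inter> space N = {x \<in> space N. X x \<in> {a..b}}" by auto
  finally show ?thesis using assms by (simp add: emeasure_eq_measure)
qed

text \<open>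
  For a nonincreasing function of a variable with bounded density, a shift of the variable has
  a small effect: it only matters on a set of diameter at most the size of the shift.
\<close>
lemma distributed_shift_le:
  fixes X :: "'a \<Rightarrow> real" and G :: "real \<Rightarrow> real"
  assumes N: "prob_space N" and X: "distributed N lborel X f" and f: "(SUP s. f s) \<le> ennreal K"
    and "0 \<le> K" and G: "antimono G" "G \<in> borel_measurable borel" and \<eta>: "\<eta> > 0"
  shows "measure N {x \<in> space N. G (X x + c + \<eta>) \<le> a} \<le>
    measure N {x \<in> space N. G (X x + c) \<le> a} + K * (2 * \<eta>)"
proof -
  interpret prob_space N by fact
  note G(2)[measurable]
  have [measurable]: "X \<in> borel_measurable N" using X by (simp add: distributed_def)
  \<comment> \<open>J collects the values for which the shift matters. Any two of them differ by at most \<open>\<eta>\<close>.\<close>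
  define J where "J = {s. G (s + c + \<eta>) \<le> a \<and> \<not> G (s + c) \<le> a}"
  have "\<exists>s0. J \<subseteq> {s0 - \<eta>..s0 + \<eta>}"
  proof (cases "J = {}")
    case False
    then obtain s0 where s0: "s0 \<in> J" by blast
    have close: "s' \<le> s + \<eta>" if "s \<in> J" "s' \<in> J" for s s'
    proof (rule ccontr)
      assume "\<not> s' \<le> s + \<eta>"
      then have "G (s' + c) \<le> G (s + c + \<eta>)" by (intro antimonoD[OF G(1)]) simp
      then show False using that by (simp add: J_def)
    qed
    have "J \<subseteq> {s0 - \<eta>..s0 + \<eta>}" using close[OF s0] close[OF _ s0] by force
    then show ?thesis by blast
  qed simp
  then obtain s0 where s0: "J \<subseteq> {s0 - \<eta>..s0 + \<eta>}" by blast
  have "measure N {x \<in> space N. G (X x + c + \<eta>) \<le> a} \<le>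
      measure N ({x \<in> space N. G (X x + c) \<le> a} \<union> {x \<in> space N. X x \<in> {s0 - \<eta>..s0 + \<eta>}})"
  proof (rule finite_measure_mono)
    show "{x \<in> space N. G (X x + c + \<eta>) \<le> a} \<subseteq>
        {x \<in> space N. G (X x + c) \<le> a} \<union> {x \<in> space N. X x \<in> {s0 - \<eta>..s0 + \<eta>}}"
      using s0 by (auto simp: J_def subset_iff)
  qed measurable
  also have "\<dots> \<le> measure N {x \<in> space N. G (X x + c) \<le> a} + measure N {x \<in> space N. X x \<in> {s0 - \<eta>..s0 + \<eta>}}"
    by (rule measure_Un_le) measurable
  also have "measure N {x \<in> space N. X x \<in> {s0 - \<eta>..s0 + \<eta>}} \<le> K * ((s0 + \<eta>) - (s0 - \<eta>))"
    using \<eta> by (intro distributed_interval_le[OF N X f \<open>0 \<le> K\<close>]) simp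
  finally show ?thesis by simp
qed

text \<open>The fraction of the values R 1, \<dots>, R n that are at least u.\<close>
definition upper_fraction :: "nat \<Rightarrow> (nat \<Rightarrow> real) \<Rightarrow> real \<Rightarrow> real" where
  "upper_fraction n R u = (\<Sum>i=1..n. of_bool (u \<le> R i)) / real n"

lemma antimono_upper_fraction: "antimono (upper_fraction n R)"
  unfolding upper_fraction_def by (intro antimonoI divide_right_mono sum_mono) auto

lemma measurable_upper_fraction: "upper_fraction n R \<in> borel_measurable borel"
  unfolding upper_fraction_def[abs_def] by measurable

lemma upper_fraction_le_1: "upper_fraction n R u \<le> 1"
  unfolding upper_fraction_def using sum_of_bool_bounds(2)[where n = n]
  by (cases "n = 0") (auto simp: divide_le_eq_1)

lemma upper_fraction_lower:
  assumes "1 \<le> n"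
  shows "upper_fraction n R u = 1 - (\<Sum>i=1..n. of_bool (R i < u)) / real n"
proof -
  have "(\<Sum>i=1..n. of_bool (R i < u)) + (\<Sum>i=1..n. of_bool (u \<le> R i)) = (\<Sum>i=1..n. 1 :: real)"
    unfolding sum.distrib[symmetric] by (intro sum.cong) auto
  then have "(\<Sum>i=1..n. of_bool (u \<le> R i)) = real n - (\<Sum>i=1..n. of_bool (R i < u))" by simp
  then show ?thesis using assms unfolding upper_fraction_def by (simp only:) (simp add: diff_divide_distrib)
qed

lemma upper_fraction_eq_1:
  assumes "1 \<le> n" "\<And>i. i \<in> {1..n} \<Longrightarrow> u \<le> R i"
  shows "upper_fraction n R u = 1"
proof -
  have "(\<Sum>i=1..n. of_bool (u \<le> R i) :: real) = (\<Sum>i=1..n. 1)"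
    using assms(2) by (intro sum.cong refl) (simp only: of_bool_eq)
  then show ?thesis using assms(1) unfolding upper_fraction_def by (simp only:) simp
qed

lemma emp_cdf_alt: "emp_cdf n R s = (\<Sum>i=1..n. of_bool (R i \<le> s)) / real n"
  by (simp only: emp_cdf_def times_divide_eq_left mult_1_left)

lemma emp_cdf_mono: "s \<le> s' \<Longrightarrow> emp_cdf n R s \<le> emp_cdf n R s'"
  unfolding emp_cdf_alt by (intro divide_right_mono sum_mono) auto

text \<open>If the empirical distribution function is at most the distribution function of X, up to a
  shift and an error, then the inflated test has at most its nominal level up to the error.\<close>
lemma level_upper:
  fixes X :: "'a \<Rightarrow> real"
  assumes "prob_space N" and X[measurable]: "X \<in> borel_measurable N" and n: "1 \<le> n"
    and R: "\<And>i. i \<in> {1..n} \<Longrightarrow> 0 \<le> R i" and "\<delta> > 0" "\<epsilon> \<ge> 0" "\<alpha> \<in> {0..1}"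
    and emp: "\<And>s. emp_cdf n R s \<le> measure N {x \<in> space N. X x \<le> s + \<delta> / 2} + \<epsilon>"
  shows "measure N {x \<in> space N. upper_fraction n R (X x - \<delta>) \<le> \<alpha>} \<le> \<alpha> + \<epsilon>"
proof -
  interpret prob_space N by fact
  \<comment> \<open>J is an up-set. Its infimum is an empirical quantile, and it is finite unless \<open>\<alpha> = 1\<close>.\<close>
  define J where "J = {u. upper_fraction n R u \<le> \<alpha>}"
  consider "\<alpha> = 1" | "J = {}" | "\<alpha> < 1" "J \<noteq> {}" using \<open>\<alpha> \<in> {0..1}\<close> by force
  then show ?thesis
  proof cases
    case 1
    then show ?thesis using \<open>\<epsilon> \<ge> 0\<close> by (intro order_trans[OF prob_le_1]) simp
  next
    case 2
    then have "{x \<in> space N. upper_fraction n R (X x - \<delta>) \<le> \<alpha>} = {}" by (auto simp: J_def)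
    then show ?thesis using \<open>\<epsilon> \<ge> 0\<close> \<open>\<alpha> \<in> {0..1}\<close> by (simp only: measure_empty) simp
  next
    case 3
    have "0 \<le> u" if "u \<in> J" for u
    proof (rule ccontr)
      assume "\<not> 0 \<le> u"
      then have "upper_fraction n R u = 1"
        using R by (intro upper_fraction_eq_1[OF n]) (meson less_le_trans not_less order_less_imp_le)
      then show False using that 3(1) by (simp add: J_def)
    qed
    then have bdd: "bdd_below J" by (rule bdd_belowI)
    obtain u where u: "u \<in> J" "u < Inf J + \<delta> / 4"
      using cInf_lessD[OF 3(2), of "Inf J + \<delta> / 4"] \<open>\<delta> > 0\<close> by auto
    have "(\<Sum>i=1..n. of_bool (R i < u)) / real n \<le> emp_cdf n R u"
      unfolding emp_cdf_alt by (intro divide_right_mono sum_mono) auto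
    then have 1: "1 - \<alpha> \<le> emp_cdf n R u"
      using u(1) by (simp add: J_def upper_fraction_lower[OF n])
    have "prob {x \<in> space N. upper_fraction n R (X x - \<delta>) \<le> \<alpha>} \<le> prob (space N - {x \<in> space N. X x \<le> u + \<delta> / 2})"
    proof (rule finite_measure_mono)
      show "{x \<in> space N. upper_fraction n R (X x - \<delta>) \<le> \<alpha>} \<subseteq> space N - {x \<in> space N. X x \<le> u + \<delta> / 2}"
      proof
        fix x assume x: "x \<in> {x \<in> space N. upper_fraction n R (X x - \<delta>) \<le> \<alpha>}"
        then have "Inf J \<le> X x - \<delta>" by (intro cInf_lower bdd) (simp add: J_def)
        then show "x \<in> space N - {x \<in> space N. X x \<le> u + \<delta> / 2}"
          using u(2) x \<open>\<delta> > 0\<close> by auto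
      qed
    qed measurable
    also have "\<dots> = 1 - prob {x \<in> space N. X x \<le> u + \<delta> / 2}"
      by (rule prob_compl) measurable
    finally show ?thesis using emp[of u] 1 by linarith
  qed
qed

text \<open>The converse estimate, with a negative inflation.\<close>
lemma level_lower:
  fixes X :: "'a \<Rightarrow> real"
  assumes "prob_space N" and X[measurable]: "X \<in> borel_measurable N" and n: "1 \<le> n"
    and R: "\<And>i. i \<in> {1..n} \<Longrightarrow> 0 \<le> R i" and "\<delta> > 0" "\<epsilon> \<ge> 0" "\<alpha> \<in> {0..1}"
    and emp: "\<And>s. measure N {x \<in> space N. X x \<le> s} \<le> emp_cdf n R (s + \<delta> / 2) + \<epsilon>"
  shows "\<alpha> - \<epsilon> \<le> measure N {x \<in> space N. upper_fraction n R (X x + \<delta>) \<le> \<alpha>}"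
proof -
  interpret prob_space N by fact
  note measurable_upper_fraction[measurable]
  define J where "J = {u. upper_fraction n R u \<le> \<alpha>}"
  show ?thesis
  proof (cases "\<alpha> = 1")
    case True
    then have "{x \<in> space N. upper_fraction n R (X x + \<delta>) \<le> \<alpha>} = space N"
      using upper_fraction_le_1 by auto
    then show ?thesis using True \<open>\<epsilon> \<ge> 0\<close> by (simp add: prob_space)
  next
    case False
    have "0 \<le> u" if "u \<in> J" for u
    proof (rule ccontr)
      assume "\<not> 0 \<le> u"
      then have "upper_fraction n R u = 1"
        using R by (intro upper_fraction_eq_1[OF n]) (meson less_le_trans not_less order_less_imp_le)
      then show False using that False \<open>\<alpha> \<in> {0..1}\<close> by (simp add: J_def)
    qed
    then have bdd: "bdd_below J" by (rule bdd_belowI)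
    let ?u = "Max (R ` {1..n}) + 1"
    have "(\<Sum>i=1..n. of_bool (?u \<le> R i) :: real) = (\<Sum>i=1..n. 0)"
    proof (rule sum.cong[OF refl])
      fix i assume "i \<in> {1..n}"
      then have "R i \<le> Max (R ` {1..n})" by (intro Max_ge) auto
      then show "of_bool (?u \<le> R i) = (0 :: real)" by simp
    qed
    then have "?u \<in> J" using \<open>\<alpha> \<in> {0..1}\<close> by (simp add: J_def upper_fraction_def)
    then have ne: "J \<noteq> {}" by blast
    let ?q = "Inf J"
    have "?q - \<delta> / 4 \<notin> J" using cInf_lower[OF _ bdd, of "?q - \<delta> / 4"] \<open>\<delta> > 0\<close> by auto
    then have "(\<Sum>i=1..n. of_bool (R i < ?q - \<delta> / 4)) / real n < 1 - \<alpha>"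
      by (simp add: J_def upper_fraction_lower[OF n])
    moreover have "emp_cdf n R (?q - \<delta> + \<delta> / 2) \<le> (\<Sum>i=1..n. of_bool (R i < ?q - \<delta> / 4)) / real n"
      unfolding emp_cdf_alt using \<open>\<delta> > 0\<close> by (intro divide_right_mono sum_mono) auto
    ultimately have 1: "prob {x \<in> space N. X x \<le> ?q - \<delta>} \<le> 1 - \<alpha> + \<epsilon>"
      using emp[of "?q - \<delta>"] by linarith
    have "1 - prob {x \<in> space N. X x \<le> ?q - \<delta>} = prob (space N - {x \<in> space N. X x \<le> ?q - \<delta>})"
      by (rule prob_compl[symmetric]) measurable
    also have "\<dots> \<le> prob {x \<in> space N. upper_fraction n R (X x + \<delta>) \<le> \<alpha>}"
    proof (rule finite_measure_mono)
      show "space N - {x \<in> space N. X x \<le> ?q - \<delta>} \<subseteq> {x \<in> space N. upper_fraction n R (X x + \<delta>) \<le> \<alpha>}"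
      proof
        fix x assume x: "x \<in> space N - {x \<in> space N. X x \<le> ?q - \<delta>}"
        then have "?q < X x + \<delta>" by auto
        then obtain u where u: "u \<in> J" "u < X x + \<delta>" using cInf_lessD[OF ne] by blast
        then have "upper_fraction n R (X x + \<delta>) \<le> upper_fraction n R u"
          by (intro antimonoD[OF antimono_upper_fraction]) simp
        then show "x \<in> {x \<in> space N. upper_fraction n R (X x + \<delta>) \<le> \<alpha>}" using u(1) x by (simp add: J_def)
      qed
    qed measurable
    finally show ?thesis using 1 by linarith
  qed
qed

context iid_array
begin

text \<open>Given the training sample, the p-value of the shortcut depends on the new point only through its
  score.\<close>
lemma pvalue_cdf_sc:
  assumes C: "conformity_scores Y p C" and n: "1 \<le> n" and \<omega>: "\<omega> \<in> space M"
  shows "pvalue_cdf P (pv_sc C) n \<delta> (training t n \<omega>) a = measure (P n) {z \<in> space (P n).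
    upper_fraction n (\<lambda>i. score_but C n i (n + 1) (full_sample t n \<omega>)) (C n n z (training t n \<omega>) - \<delta>) \<le> a}"
  unfolding pvalue_cdf_def
proof (intro arg_cong[where f = "measure (P n)"] Collect_cong conj_cong refl)
  fix z assume "z \<in> space (P n)"
  then have z: "z \<in> space (data_space (Y n) (p n))" by (simp add: space_P[OF n])
  let ?T = "training t n \<omega>"
  have T: "?T \<in> space (sample_space (Y n) (p n) n)" by (rule training_space[OF n \<omega>])
  have t: "t n (n + 1) \<omega> \<in> space (data_space (Y n) (p n))"
    using measurable_space[OF measurable_t[OF n] \<omega>] by simp
  have "score_all C n (n + 1) (?T(n + 1 := z)) = C n n z ?T"
    by (rule scores_fun_upd(1)[OF C n T z])
  moreover have "score_but C n i (n + 1) (?T(n + 1 := z)) = score_but C n i (n + 1) (full_sample t n \<omega>)"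
    if "i \<in> {1..n}" for i
    unfolding full_sample_eq using scores_fun_upd(3)[OF C n T _ that] z t by simp
  ultimately have "pv_sc C n \<delta> (?T(n + 1 := z)) = upper_fraction n
      (\<lambda>i. score_but C n i (n + 1) (full_sample t n \<omega>)) (C n n z ?T - \<delta>)"
    unfolding pv_sc_def upper_fraction_def
    by (intro arg_cong2[where f = "(/)"] sum.cong refl) (simp only: diff_le_eq)
  then show "(pv_sc C n \<delta> (?T(n + 1 := z)) \<le> a) \<longleftrightarrow> (upper_fraction n
      (\<lambda>i. score_but C n i (n + 1) (full_sample t n \<omega>)) (C n n z ?T - \<delta>) \<le> a)"
    by (simp only:)
qed

text \<open>Under a stochastically bounded density the shortcut with a small inflation hardly differs from the
  one without.\<close>
lemma inflation_continuous_sc: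
  assumes C: "conformity_scores Y p C" and CC: "CC M P t C"
  shows "inflation_continuous (pv_sc C)"
  unfolding inflation_continuous_def
proof (intro allI impI)
  fix \<epsilon> e :: real assume "\<epsilon> > 0" "e > 0"
  obtain f :: "nat \<Rightarrow> sample \<Rightarrow> real \<Rightarrow> ennreal" where
    f: "\<And>n. 1 \<le> n \<Longrightarrow> AE \<omega> in M.
      distributed (P n) lborel (\<lambda>z. C n n z (training t n \<omega>)) (f n (training t n \<omega>))"
    and bdd: "stoch_bounded M (\<lambda>n \<omega>. SUP s. f n (training t n \<omega>) s)"
    using CC unfolding CC_def by blast
  obtain K' :: real where K': "\<And>n. 1 \<le> n \<Longrightarrow> \<exists>B\<in>sets M.
      {\<omega> \<in> space M. (SUP s. f n (training t n \<omega>) s) > ennreal K'} \<subseteq> B \<and> measure M B \<le> e"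
    using bdd \<open>e > 0\<close> unfolding stoch_bounded_def by meson
  define K where "K = max K' 0"
  \<comment> \<open>A set of values of diameter \<open>\<eta>\<close> has probability at most \<open>2 \<eta> K\<close> if the density is bounded by K.\<close>
  define \<eta> where "\<eta> = \<epsilon> / (2 * (K + 1))"
  have K0: "0 \<le> K" by (simp add: K_def)
  then have \<eta>: "\<eta> > 0" using \<open>\<epsilon> > 0\<close> by (simp add: \<eta>_def)
  have K\<eta>: "K * (2 * \<eta>) \<le> \<epsilon>" using K0 \<open>\<epsilon> > 0\<close> by (simp add: \<eta>_def field_simps)
  show "\<exists>\<eta>>0. \<forall>n\<ge>1. \<exists>B\<in>sets M. prob B \<le> e \<and> (\<forall>\<omega>\<in>space M - B. \<forall>a.
      pvalue_cdf P (pv_sc C) n (- \<eta>) (training t n \<omega>) a \<le> pvalue_cdf P (pv_sc C) n 0 (training t n \<omega>) a + \<epsilon> \<and>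
      pvalue_cdf P (pv_sc C) n 0 (training t n \<omega>) a \<le> pvalue_cdf P (pv_sc C) n \<eta> (training t n \<omega>) a + \<epsilon>)"
  proof (intro exI[of _ \<eta>] conjI \<eta> allI impI)
    fix n :: nat assume n: "1 \<le> n"
    obtain B where B: "B \<in> sets M" "measure M B \<le> e"
      "{\<omega> \<in> space M. (SUP s. f n (training t n \<omega>) s) > ennreal K'} \<subseteq> B" using K'[OF n] by blast
    obtain N where N: "N \<in> null_sets M" "{\<omega> \<in> space M. \<not> distributed (P n) lborel
        (\<lambda>z. C n n z (training t n \<omega>)) (f n (training t n \<omega>))} \<subseteq> N"
      using f[OF n] unfolding eventually_ae_filter by blast
    show "\<exists>B\<in>sets M. prob B \<le> e \<and> (\<forall>\<omega>\<in>space M - B. \<forall>a.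
      pvalue_cdf P (pv_sc C) n (- \<eta>) (training t n \<omega>) a \<le> pvalue_cdf P (pv_sc C) n 0 (training t n \<omega>) a + \<epsilon> \<and>
      pvalue_cdf P (pv_sc C) n 0 (training t n \<omega>) a \<le> pvalue_cdf P (pv_sc C) n \<eta> (training t n \<omega>) a + \<epsilon>)"
    proof (intro bexI[of _ "B \<union> N"] conjI ballI allI)
      show "B \<union> N \<in> sets M" using B N by auto
      show "prob (B \<union> N) \<le> e" using B N by (simp add: measure_Un_null_set)
      fix \<omega> a assume \<omega>: "\<omega> \<in> space M - (B \<union> N)"
      let ?T = "training t n \<omega>" and ?R = "\<lambda>i. score_but C n i (n + 1) (full_sample t n \<omega>)"
      have d: "distributed (P n) lborel (\<lambda>z. C n n z ?T) (f n ?T)" using \<omega> N(2) by blast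
      have "\<not> (SUP s. f n ?T s) > ennreal K'" using \<omega> B(3) by blast
      then have s: "(SUP s. f n ?T s) \<le> ennreal K"
        unfolding not_less K_def by (rule order_trans) (simp add: ennreal_leI)
      have \<omega>': "\<omega> \<in> space M" using \<omega> by blast
      note le = distributed_shift_le[OF prob_space_P[OF n] d s K0 antimono_upper_fraction
          measurable_upper_fraction \<eta>, of n ?R _ a]
      show "pvalue_cdf P (pv_sc C) n (- \<eta>) ?T a \<le> pvalue_cdf P (pv_sc C) n 0 ?T a + \<epsilon>"
        using le[of 0] K\<eta> unfolding pvalue_cdf_sc[OF C n \<omega>'] by simp
      show "pvalue_cdf P (pv_sc C) n 0 ?T a \<le> pvalue_cdf P (pv_sc C) n \<eta> ?T a + \<epsilon>"
        using le[of "- \<eta>"] K\<eta> unfolding pvalue_cdf_sc[OF C n \<omega>'] by simp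
    qed
  qed
qed

end

section \<open>Leave-one-out means and conditional means\<close>

text \<open>Measurable functions with values in the unit interval.\<close>
definition unit_rv :: "'a measure \<Rightarrow> ('a \<Rightarrow> real) \<Rightarrow> bool" where
  "unit_rv N X \<longleftrightarrow> X \<in> borel_measurable N \<and> (\<forall>x\<in>space N. 0 \<le> X x \<and> X x \<le> 1)"

lemma (in prob_space) integrable_unit_rv: "unit_rv M X \<Longrightarrow> integrable M X"
  by (rule integrable_const_bound[where B = 1]) (auto simp: unit_rv_def intro!: AE_I2)

lemma unit_rv_mult: "unit_rv N X \<Longrightarrow> unit_rv N Z \<Longrightarrow> unit_rv N (\<lambda>x. X x * Z x)"
  by (auto simp: unit_rv_def intro!: mult_le_one)

lemma unit_rv_abs_diff: "unit_rv N X \<Longrightarrow> unit_rv N Z \<Longrightarrow> unit_rv N (\<lambda>x. \<bar>X x - Z x\<bar>)"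
  by (auto simp: unit_rv_def abs_le_iff) (smt (verit))+

lemma unit_rv_measurable: "unit_rv N X \<Longrightarrow> X \<in> borel_measurable N"
  by (simp add: unit_rv_def)

lemma last_indices:
  fixes n :: nat
  assumes "1 \<le> n"
  shows "n + 1 \<in> {1..n + 1}" "n \<in> {1..n + 1}" "n \<in> {1..n}" "n + 1 \<noteq> n"
  using assms by auto

lemma mult_le_mult_perturbed:
  fixes x y x' y' :: real
  assumes "0 \<le> x" "x \<le> 1" "0 \<le> y'" "y' \<le> 1"
  shows "x * y \<le> x' * y' + \<bar>x - x'\<bar> + \<bar>y - y'\<bar>"
proof -
  have "x * y - x' * y' = x * (y - y') + (x - x') * y'" by (simp add: algebra_simps)
  also have "\<dots> \<le> \<bar>x * (y - y')\<bar> + \<bar>(x - x') * y'\<bar>" by linarith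
  also have "\<dots> \<le> 1 * \<bar>y - y'\<bar> + \<bar>x - x'\<bar> * 1"
    unfolding abs_mult using assms by (intro add_mono mult_mono) auto
  finally show ?thesis by simp
qed

context iid_array
begin

text \<open>The mean change of g at a score when one training point is removed.\<close>
definition mean_instability :: "score_family \<Rightarrow> nat \<Rightarrow> (real \<Rightarrow> real) \<Rightarrow> real" where
  "mean_instability C n g = (\<integral>\<omega>. \<bar>g (score_all C n (n + 1) (full_sample t n \<omega>)) -
    g (score_but C n (n + 1) n (full_sample t n \<omega>))\<bar> \<partial>M)"

text \<open>The mean of the product of g at the scores of two points, where neither of them is in the training
  sample of the other.\<close>
definition pair_mean :: "score_family \<Rightarrow> nat \<Rightarrow> (real \<Rightarrow> real) \<Rightarrow> real" where
  "pair_mean C n g = (\<integral>\<omega>. g (score_but C n (n + 1) n (full_sample t n \<omega>)) *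
    g (score_but C n n (n + 1) (full_sample t n \<omega>)) \<partial>M)"

text \<open>The conditional mean, given the training sample, of g at the score of the new point.\<close>
definition cond_mean :: "score_family \<Rightarrow> nat \<Rightarrow> (real \<Rightarrow> real) \<Rightarrow> 'w \<Rightarrow> real" where
  "cond_mean C n g \<omega> = (\<integral>z. g (score_all C n (n + 1) ((training t n \<omega>)(n + 1 := z))) \<partial>P n)"

text \<open>The same with the last training point removed.\<close>
definition cond_mean_but :: "score_family \<Rightarrow> nat \<Rightarrow> (real \<Rightarrow> real) \<Rightarrow> 'w \<Rightarrow> real" where
  "cond_mean_but C n g \<omega> = (\<integral>z. g (score_but C n (n + 1) n ((training t n \<omega>)(n + 1 := z))) \<partial>P n)"

text \<open>The mean of g over the leave-one-out scores of the training points.\<close>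
definition loo_mean :: "score_family \<Rightarrow> nat \<Rightarrow> (real \<Rightarrow> real) \<Rightarrow> 'w \<Rightarrow> real" where
  "loo_mean C n g \<omega> = (\<Sum>i=1..n. g (score_but C n i (n + 1) (full_sample t n \<omega>))) / real n"

context
  fixes C :: score_family and n :: nat and g :: "real \<Rightarrow> real"
  assumes C: "conformity_scores Y p C" and n: "1 \<le> n"
    and g[measurable]: "g \<in> borel_measurable borel" and g01: "\<And>x. 0 \<le> g x" "\<And>x. g x \<le> 1"
begin

lemma unit_rv_all: "a \<in> {1..n + 1} \<Longrightarrow> unit_rv M (\<lambda>\<omega>. g (score_all C n a (full_sample t n \<omega>)))"
  using measurable_compose[OF measurable_full_sample[OF n] measurable_compose[OF measurable_score_all[OF C n] g]] g01
  by (simp add: unit_rv_def)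

lemma unit_rv_but:
  "a \<in> {1..n + 1} \<Longrightarrow> b \<in> {1..n + 1} \<Longrightarrow> a \<noteq> b \<Longrightarrow> unit_rv M (\<lambda>\<omega>. g (score_but C n a b (full_sample t n \<omega>)))"
  using measurable_compose[OF measurable_full_sample[OF n] measurable_compose[OF measurable_score_but[OF C n] g]] g01
  by (simp add: unit_rv_def)

lemma unit_rv_section:
  assumes \<psi>: "unit_rv (sample_space (Y n) (p n) (n + 1)) \<psi>" and T: "T \<in> space (sample_space (Y n) (p n) n)"
  shows "unit_rv (P n) (\<lambda>z. \<psi> (T(n + 1 := z)))"
  using measurable_fun_upd_P[OF n unit_rv_measurable[OF \<psi>] T] \<psi> space_sample_fun_upd[OF T]
  by (simp add: unit_rv_def space_P[OF n] del: fun_upd_apply)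

lemma integral_unit_rv:
  assumes "unit_rv (P n) X"
  shows "0 \<le> (\<integral>z. X z \<partial>P n) \<and> (\<integral>z. X z \<partial>P n) \<le> 1"
proof -
  interpret Pn: prob_space "P n" by (rule prob_space_P[OF n])
  have int: "integrable (P n) X" by (rule Pn.integrable_unit_rv[OF assms])
  have "0 \<le> (\<integral>z. X z \<partial>P n)" using assms by (intro integral_nonneg_AE AE_I2) (auto simp: unit_rv_def)
  moreover have "(\<integral>z. X z \<partial>P n) \<le> (\<integral>z. 1 \<partial>P n)"
    using assms int by (intro integral_mono) (auto simp: unit_rv_def)
  ultimately show ?thesis by (simp add: Pn.prob_space)
qed

lemma unit_rv_conditional:
  assumes \<psi>: "unit_rv (sample_space (Y n) (p n) (n + 1)) \<psi>"
  shows "unit_rv M (\<lambda>\<omega>. \<integral>z. \<psi> ((training t n \<omega>)(n + 1 := z)) \<partial>P n)"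
proof -
  have "(\<lambda>\<omega>. \<integral>z. \<psi> ((training t n \<omega>)(n + 1 := z)) \<partial>P n) \<in> borel_measurable M"
    using measurable_compose[OF measurable_training[OF n] measurable_integral_P[OF n unit_rv_measurable[OF \<psi>]]] .
  then show ?thesis
    using integral_unit_rv[OF unit_rv_section[OF \<psi> training_space[OF n]]] unfolding unit_rv_def by blast
qed

text \<open>The leave-one-out scores of the training points do not depend on the new point.\<close>
lemma expectation_loo_conditional:
  assumes \<psi>: "unit_rv (sample_space (Y n) (p n) (n + 1)) \<psi>" and i: "i \<in> {1..n}"
  shows "(\<integral>\<omega>. g (score_but C n i (n + 1) (full_sample t n \<omega>)) * (\<integral>z. \<psi> ((training t n \<omega>)(n + 1 := z)) \<partial>P n) \<partial>M) =
    (\<integral>\<omega>. g (score_but C n i (n + 1) (full_sample t n \<omega>)) * \<psi> (full_sample t n \<omega>) \<partial>M)"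
proof -
  let ?f = "\<lambda>w. g (score_but C n i (n + 1) w) * \<psi> w"
  have f: "?f \<in> borel_measurable (sample_space (Y n) (p n) (n + 1))"
    using measurable_compose[OF measurable_score_last(3)[OF C n i] g] unit_rv_measurable[OF \<psi>] by simp
  have "(\<integral>\<omega>. ?f (full_sample t n \<omega>) \<partial>M) = (\<integral>\<omega>. (\<integral>z. ?f ((training t n \<omega>)(n + 1 := z)) \<partial>P n) \<partial>M)"
  proof (rule integral_full_sample_Fubini[OF n f, of 1])
    fix w assume "w \<in> space (sample_space (Y n) (p n) (n + 1))"
    then have "0 \<le> \<psi> w" "\<psi> w \<le> 1" using \<psi> by (auto simp: unit_rv_def)
    then show "\<bar>?f w\<bar> \<le> 1" using g01 by (simp add: abs_mult mult_le_one)
  qed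
  also have "\<dots> = (\<integral>\<omega>. g (score_but C n i (n + 1) (full_sample t n \<omega>)) *
      (\<integral>z. \<psi> ((training t n \<omega>)(n + 1 := z)) \<partial>P n) \<partial>M)"
  proof (rule Bochner_Integration.integral_cong[OF refl])
    fix \<omega> assume \<omega>: "\<omega> \<in> space M"
    let ?T = "training t n \<omega>"
    have T: "?T \<in> space (sample_space (Y n) (p n) n)" by (rule training_space[OF n \<omega>])
    have t: "t n (n + 1) \<omega> \<in> space (data_space (Y n) (p n))"
      using measurable_space[OF measurable_t[OF n] \<omega>] by simp
    have "(\<integral>z. ?f (?T(n + 1 := z)) \<partial>P n) =
        (\<integral>z. g (score_but C n i (n + 1) (full_sample t n \<omega>)) * \<psi> (?T(n + 1 := z)) \<partial>P n)"
    proof (rule Bochner_Integration.integral_cong[OF refl])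
      fix z assume "z \<in> space (P n)"
      then have z: "z \<in> space (data_space (Y n) (p n))" by (simp add: space_P[OF n])
      have "score_but C n i (n + 1) (?T(n + 1 := z)) = score_but C n i (n + 1) (full_sample t n \<omega>)"
        unfolding full_sample_eq scores_fun_upd(3)[OF C n T z i] scores_fun_upd(3)[OF C n T t i] ..
      then show "?f (?T(n + 1 := z)) =
          g (score_but C n i (n + 1) (full_sample t n \<omega>)) * \<psi> (?T(n + 1 := z))" by (simp only:)
    qed
    also have "\<dots> = g (score_but C n i (n + 1) (full_sample t n \<omega>)) * (\<integral>z. \<psi> (?T(n + 1 := z)) \<partial>P n)"
      by (rule integral_mult_right_zero)
    finally show "(\<integral>z. ?f (?T(n + 1 := z)) \<partial>P n) =
        g (score_but C n i (n + 1) (full_sample t n \<omega>)) * (\<integral>z. \<psi> (?T(n + 1 := z)) \<partial>P n)" .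
  qed
  finally show ?thesis ..
qed

lemma expectation_instability:
  assumes a: "a \<in> {1..n + 1}" "b \<in> {1..n + 1}" "a \<noteq> b"
  shows "(\<integral>\<omega>. \<bar>g (score_all C n a (full_sample t n \<omega>)) - g (score_but C n a b (full_sample t n \<omega>))\<bar> \<partial>M) =
    mean_instability C n g"
proof -
  have "(\<lambda>(x, y, u). \<bar>g x - g y\<bar>) \<in> borel_measurable (borel :: (real \<times> real \<times> real) measure)"
    unfolding borel_prod[symmetric] by measurable
  from integral_score_pair[OF C n a this] show ?thesis by (simp add: mean_instability_def)
qed

lemma expectation_pair:
  assumes a: "a \<in> {1..n + 1}" "b \<in> {1..n + 1}" "a \<noteq> b"
  shows "(\<integral>\<omega>. g (score_but C n a b (full_sample t n \<omega>)) * g (score_but C n b a (full_sample t n \<omega>)) \<partial>M) = pair_mean C n g"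
proof -
  have "(\<lambda>(x, y, u). g y * g u) \<in> borel_measurable (borel :: (real \<times> real \<times> real) measure)"
    unfolding borel_prod[symmetric] by measurable
  from integral_score_pair[OF C n a this] show ?thesis by (simp add: pair_mean_def)
qed

text \<open>
  Two leave-one-out scores are nearly the scores of two points that both see the same training
  sample, which contains neither of them: each can be compared with the score that also sees the
  new point, and from there the other point can be dropped.
\<close>
lemma expectation_loo_pair_le:
  assumes i: "i \<in> {1..n}" "j \<in> {1..n}" "i \<noteq> j"
  shows "(\<integral>\<omega>. g (score_but C n i (n + 1) (full_sample t n \<omega>)) * g (score_but C n j (n + 1) (full_sample t n \<omega>)) \<partial>M)
    \<le> pair_mean C n g + 4 * mean_instability C n g"
proof -
  define l where "l = (\<lambda>a \<omega>. g (score_all C n a (full_sample t n \<omega>)))"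
  define k where "k = (\<lambda>a b \<omega>. g (score_but C n a b (full_sample t n \<omega>)))"
  have i': "i \<in> {1..n + 1}" "j \<in> {1..n + 1}" "i \<noteq> n + 1" "j \<noteq> n + 1" using i by auto
  have u: "unit_rv M (l i)" "unit_rv M (l j)" "unit_rv M (k i (n + 1))" "unit_rv M (k j (n + 1))"
    "unit_rv M (k i j)" "unit_rv M (k j i)"
    unfolding l_def k_def using i(3) i' last_indices(1)[OF n] by (auto intro!: unit_rv_all unit_rv_but simp del: atLeastAtMost_iff)
  note int = u[THEN unit_rv_abs_diff, THEN integrable_unit_rv]
  have "(\<integral>\<omega>. k i (n + 1) \<omega> * k j (n + 1) \<omega> \<partial>M) \<le> (\<integral>\<omega>. k i j \<omega> * k j i \<omega> +
      (\<bar>l i \<omega> - k i (n + 1) \<omega>\<bar> + \<bar>l i \<omega> - k i j \<omega>\<bar> + \<bar>l j \<omega> - k j (n + 1) \<omega>\<bar> + \<bar>l j \<omega> - k j i \<omega>\<bar>) \<partial>M)"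
  proof (rule integral_mono)
    fix \<omega> assume "\<omega> \<in> space M"
    have "0 \<le> k a b \<omega>" "k a b \<omega> \<le> 1" for a b by (auto simp: k_def g01)
    then have "k i (n + 1) \<omega> * k j (n + 1) \<omega> \<le>
        k i j \<omega> * k j i \<omega> + \<bar>k i (n + 1) \<omega> - k i j \<omega>\<bar> + \<bar>k j (n + 1) \<omega> - k j i \<omega>\<bar>"
      by (intro mult_le_mult_perturbed)
    then show "k i (n + 1) \<omega> * k j (n + 1) \<omega> \<le> k i j \<omega> * k j i \<omega> +
      (\<bar>l i \<omega> - k i (n + 1) \<omega>\<bar> + \<bar>l i \<omega> - k i j \<omega>\<bar> + \<bar>l j \<omega> - k j (n + 1) \<omega>\<bar> + \<bar>l j \<omega> - k j i \<omega>\<bar>)"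
      by linarith
  qed (intro Bochner_Integration.integrable_add integrable_unit_rv unit_rv_mult unit_rv_abs_diff u)+
  also have "\<dots> = (\<integral>\<omega>. k i j \<omega> * k j i \<omega> \<partial>M) + ((\<integral>\<omega>. \<bar>l i \<omega> - k i (n + 1) \<omega>\<bar> \<partial>M) +
      (\<integral>\<omega>. \<bar>l i \<omega> - k i j \<omega>\<bar> \<partial>M) + (\<integral>\<omega>. \<bar>l j \<omega> - k j (n + 1) \<omega>\<bar> \<partial>M) + (\<integral>\<omega>. \<bar>l j \<omega> - k j i \<omega>\<bar> \<partial>M))"
    by (subst Bochner_Integration.integral_add, (intro Bochner_Integration.integrable_add
      integrable_unit_rv unit_rv_mult unit_rv_abs_diff u)+)+ (rule refl)
  also have "\<dots> = pair_mean C n g + 4 * mean_instability C n g"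
    unfolding l_def k_def
    using expectation_pair[OF i'(1,2) i(3)] expectation_instability[OF i'(1,2) i(3)]
      expectation_instability[OF i'(2,1) i(3)[symmetric]]
      expectation_instability[OF i'(1) last_indices(1)[OF n] i'(3)] expectation_instability[OF i'(2) last_indices(1)[OF n] i'(4)]
    by simp
  finally show ?thesis by (simp add: k_def)
qed

lemma unit_rv_sample_all: "unit_rv (sample_space (Y n) (p n) (n + 1)) (\<lambda>w. g (score_all C n (n + 1) w))"
  using measurable_compose[OF measurable_score_last(1)[OF C n] g] g01 by (simp add: unit_rv_def)

lemma unit_rv_sample_but: "unit_rv (sample_space (Y n) (p n) (n + 1)) (\<lambda>w. g (score_but C n (n + 1) n w))"
  using measurable_compose[OF measurable_score_last(4)[OF C n last_indices(3)[OF n]] g] g01 by (simp add: unit_rv_def)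

lemma expectation_loo_cond_mean_ge:
  assumes i: "i \<in> {1..n}"
  shows "pair_mean C n g - mean_instability C n g \<le>
    (\<integral>\<omega>. g (score_but C n i (n + 1) (full_sample t n \<omega>)) * cond_mean C n g \<omega> \<partial>M)"
proof -
  define l where "l = (\<lambda>\<omega>. g (score_all C n (n + 1) (full_sample t n \<omega>)))"
  define k where "k = (\<lambda>a b \<omega>. g (score_but C n a b (full_sample t n \<omega>)))"
  have i': "i \<in> {1..n + 1}" "i \<noteq> n + 1" using i by auto
  have u: "unit_rv M l" "unit_rv M (k i (n + 1))" "unit_rv M (k (n + 1) i)"
    unfolding l_def k_def using i' last_indices(1)[OF n] by (auto intro!: unit_rv_all unit_rv_but simp del: atLeastAtMost_iff)
  have "(\<integral>\<omega>. k i (n + 1) \<omega> * k (n + 1) i \<omega> \<partial>M) \<le> (\<integral>\<omega>. k i (n + 1) \<omega> * l \<omega> + \<bar>l \<omega> - k (n + 1) i \<omega>\<bar> \<partial>M)"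
  proof (rule integral_mono)
    fix \<omega>
    have "k i (n + 1) \<omega> * k (n + 1) i \<omega> \<le> k i (n + 1) \<omega> * l \<omega> + \<bar>k i (n + 1) \<omega> - k i (n + 1) \<omega>\<bar> + \<bar>k (n + 1) i \<omega> - l \<omega>\<bar>"
      by (rule mult_le_mult_perturbed) (auto simp: k_def l_def g01)
    then show "k i (n + 1) \<omega> * k (n + 1) i \<omega> \<le> k i (n + 1) \<omega> * l \<omega> + \<bar>l \<omega> - k (n + 1) i \<omega>\<bar>" by linarith
  qed (intro Bochner_Integration.integrable_add integrable_unit_rv unit_rv_mult unit_rv_abs_diff u)+
  also have "\<dots> = (\<integral>\<omega>. k i (n + 1) \<omega> * l \<omega> \<partial>M) + (\<integral>\<omega>. \<bar>l \<omega> - k (n + 1) i \<omega>\<bar> \<partial>M)"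
    by (intro Bochner_Integration.integral_add integrable_unit_rv unit_rv_mult unit_rv_abs_diff u)
  finally show ?thesis
    using expectation_loo_conditional[OF unit_rv_sample_all i] expectation_pair[OF i'(1) last_indices(1)[OF n] i'(2)]
      expectation_instability[OF last_indices(1)[OF n] i'(1) i'(2)[symmetric]]
    by (simp add: k_def l_def cond_mean_def)
qed

text \<open>Given the other points, the last training point and the new point are independent with the
  same distribution.\<close>
lemma expectation_cond_mean_but_square: "(\<integral>\<omega>. cond_mean_but C n g \<omega> * cond_mean_but C n g \<omega> \<partial>M) = pair_mean C n g"
proof -
  \<comment> \<open>H is the conditional mean as a function of the full sample; it does not depend on the last two
    points, so that the swap \<open>\<pi>\<close> of these two points leaves it unchanged.\<close>
  define H where "H = (\<lambda>w. \<integral>z. g (score_but C n (n + 1) n ((restrict w {1..n})(n + 1 := z))) \<partial>P n)"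
  have restr: "(\<lambda>w. restrict w {1..n}) \<in>
      measurable (sample_space (Y n) (p n) (n + 1)) (sample_space (Y n) (p n) n)"
    unfolding sample_space_def by (rule measurable_restrict_subset) auto
  have H: "unit_rv (sample_space (Y n) (p n) (n + 1)) H"
    unfolding unit_rv_def
  proof
    show "H \<in> borel_measurable (sample_space (Y n) (p n) (n + 1))"
      unfolding H_def
      by (rule measurable_compose[OF restr measurable_integral_P[OF n unit_rv_measurable[OF unit_rv_sample_but]]])
    show "\<forall>w\<in>space (sample_space (Y n) (p n) (n + 1)). 0 \<le> H w \<and> H w \<le> 1"
      unfolding H_def
      by (intro ballI integral_unit_rv unit_rv_section[OF unit_rv_sample_but] space_restrict_sample)
  qed
  have H_upd: "H ((training t n \<omega>)(n + 1 := z)) = cond_mean_but C n g \<omega>" if "\<omega> \<in> space M" for \<omega> z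
    unfolding H_def restrict_fun_upd_sample[OF training_space[OF n that]] cond_mean_but_def ..
  have H_full: "H (full_sample t n \<omega>) = cond_mean_but C n g \<omega>" if "\<omega> \<in> space M" for \<omega>
    unfolding full_sample_eq by (rule H_upd[OF that])
  have f1: "unit_rv (sample_space (Y n) (p n) (n + 1)) (\<lambda>w. H w * g (score_but C n (n + 1) n w))"
    by (rule unit_rv_mult[OF H unit_rv_sample_but])
  have "(\<integral>\<omega>. H (full_sample t n \<omega>) * g (score_but C n (n + 1) n (full_sample t n \<omega>)) \<partial>M) =
      (\<integral>\<omega>. (\<integral>z. H ((training t n \<omega>)(n + 1 := z)) * g (score_but C n (n + 1) n ((training t n \<omega>)(n + 1 := z))) \<partial>P n) \<partial>M)"
    using f1 by (intro integral_full_sample_Fubini[OF n unit_rv_measurable[OF f1], of 1]) (auto simp: unit_rv_def)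
  also have "\<dots> = (\<integral>\<omega>. cond_mean_but C n g \<omega> * cond_mean_but C n g \<omega> \<partial>M)"
  proof (rule Bochner_Integration.integral_cong[OF refl])
    fix \<omega> assume \<omega>: "\<omega> \<in> space M"
    show "(\<integral>z. H ((training t n \<omega>)(n + 1 := z)) * g (score_but C n (n + 1) n ((training t n \<omega>)(n + 1 := z))) \<partial>P n) =
      cond_mean_but C n g \<omega> * cond_mean_but C n g \<omega>"
      unfolding H_upd[OF \<omega>] by (subst integral_mult_right_zero) (simp only: cond_mean_but_def)
  qed
  finally have 1: "(\<integral>\<omega>. cond_mean_but C n g \<omega> * cond_mean_but C n g \<omega> \<partial>M) =
    (\<integral>\<omega>. H (full_sample t n \<omega>) * g (score_but C n (n + 1) n (full_sample t n \<omega>)) \<partial>M)" ..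
  define \<pi> where "\<pi> = Transposition.transpose n (n + 1)"
  have \<pi>: "\<pi> permutes {1..n + 1}" "\<pi> (n + 1) = n" "\<pi> n = n + 1"
    unfolding \<pi>_def using permutes_swap_id[OF last_indices(2,1)[OF n]] by auto
  have H_reindex: "H (reindex n \<pi> w) = H w" if w: "w \<in> space (sample_space (Y n) (p n) (n + 1))" for w
    unfolding H_def
  proof (rule Bochner_Integration.integral_cong[OF refl])
    fix z assume "z \<in> space (P n)"
    then have z: "z \<in> space (data_space (Y n) (p n))" by (simp add: space_P[OF n])
    have "remove_entry n n (restrict (reindex n \<pi> w) {1..n}) = remove_entry n n (restrict w {1..n})"
      unfolding remove_entry_def
    proof (rule restrict_ext)
      fix j assume j: "j \<in> {1..n - 1}"
      then have "j < n" "j \<in> {1..n}" "j \<in> {1..n + 1}" "j \<noteq> n" "j \<noteq> n + 1" using n by auto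
      then show "(if j < n then restrict (reindex n \<pi> w) {1..n} j else restrict (reindex n \<pi> w) {1..n} (j + 1)) =
          (if j < n then restrict w {1..n} j else restrict w {1..n} (j + 1))"
        by (simp add: reindex_def \<pi>_def transpose_apply_other)
    qed
    then show "g (score_but C n (n + 1) n ((restrict (reindex n \<pi> w) {1..n})(n + 1 := z))) =
        g (score_but C n (n + 1) n ((restrict w {1..n})(n + 1 := z)))"
      unfolding scores_fun_upd(4)[OF C n space_restrict_sample[OF w] z last_indices(3)[OF n]]
        scores_fun_upd(4)[OF C n space_restrict_sample[OF space_reindex[OF \<pi>(1) w]] z last_indices(3)[OF n]]
      by (simp only:)
  qed
  have "(\<integral>\<omega>. H (full_sample t n \<omega>) * g (score_but C n (n + 1) n (full_sample t n \<omega>)) \<partial>M) =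
      (\<integral>\<omega>. H (reindex n \<pi> (full_sample t n \<omega>)) * g (score_but C n (n + 1) n (reindex n \<pi> (full_sample t n \<omega>))) \<partial>M)"
    by (rule integral_exchangeable[OF n unit_rv_measurable[OF f1] \<pi>(1), symmetric])
  also have "\<dots> = (\<integral>\<omega>. g (score_but C n n (n + 1) (full_sample t n \<omega>)) * cond_mean_but C n g \<omega> \<partial>M)"
  proof (rule Bochner_Integration.integral_cong[OF refl])
    fix \<omega> assume \<omega>: "\<omega> \<in> space M"
    note W = full_sample_space[OF n \<omega>]
    have "score_but C n (n + 1) n (reindex n \<pi> (full_sample t n \<omega>)) = score_but C n n (n + 1) (full_sample t n \<omega>)"
      using score_but_reindex[OF C n last_indices(1,2,4)[OF n] \<pi>(1) W] unfolding \<pi>(2,3) .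
    then show "H (reindex n \<pi> (full_sample t n \<omega>)) * g (score_but C n (n + 1) n (reindex n \<pi> (full_sample t n \<omega>))) =
        g (score_but C n n (n + 1) (full_sample t n \<omega>)) * cond_mean_but C n g \<omega>"
      unfolding H_reindex[OF W] H_full[OF \<omega>] by (simp only: mult.commute)
  qed
  also have "\<dots> = (\<integral>\<omega>. g (score_but C n n (n + 1) (full_sample t n \<omega>)) * g (score_but C n (n + 1) n (full_sample t n \<omega>)) \<partial>M)"
    unfolding cond_mean_but_def by (rule expectation_loo_conditional[OF unit_rv_sample_but last_indices(3)[OF n]])
  also have "\<dots> = pair_mean C n g" unfolding pair_mean_def by (simp only: mult.commute)
  finally show ?thesis using 1 by simp
qed

lemma unit_rv_cond_mean: "unit_rv M (cond_mean C n g)"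
  unfolding cond_mean_def[abs_def] by (rule unit_rv_conditional[OF unit_rv_sample_all])

lemma unit_rv_cond_mean_but: "unit_rv M (cond_mean_but C n g)"
  unfolding cond_mean_but_def[abs_def] by (rule unit_rv_conditional[OF unit_rv_sample_but])

lemma expectation_cond_mean_square_le: "(\<integral>\<omega>. cond_mean C n g \<omega> * cond_mean C n g \<omega> \<partial>M) \<le> pair_mean C n g + 2 * mean_instability C n g"
proof -
  interpret Pn: prob_space "P n" by (rule prob_space_P[OF n])
  let ?d = "\<lambda>w. \<bar>g (score_all C n (n + 1) w) - g (score_but C n (n + 1) n w)\<bar>"
  let ?D = "\<lambda>\<omega>. \<integral>z. ?d ((training t n \<omega>)(n + 1 := z)) \<partial>P n"
  have d: "unit_rv (sample_space (Y n) (p n) (n + 1)) ?d"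
    by (rule unit_rv_abs_diff[OF unit_rv_sample_all unit_rv_sample_but])
  have D: "unit_rv M ?D" by (rule unit_rv_conditional[OF d])
  have le: "\<bar>cond_mean C n g \<omega> - cond_mean_but C n g \<omega>\<bar> \<le> ?D \<omega>" if "\<omega> \<in> space M" for \<omega>
  proof -
    note T = training_space[OF n that]
    have eq: "cond_mean C n g \<omega> - cond_mean_but C n g \<omega> = (\<integral>z. g (score_all C n (n + 1) ((training t n \<omega>)(n + 1 := z))) -
        g (score_but C n (n + 1) n ((training t n \<omega>)(n + 1 := z))) \<partial>P n)"
      unfolding cond_mean_def cond_mean_but_def
      by (intro Bochner_Integration.integral_diff[symmetric] Pn.integrable_unit_rv
          unit_rv_section[OF unit_rv_sample_all T] unit_rv_section[OF unit_rv_sample_but T])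
    show ?thesis unfolding eq by (rule integral_abs_bound)
  qed
  have "(\<integral>\<omega>. cond_mean C n g \<omega> * cond_mean C n g \<omega> \<partial>M) \<le> (\<integral>\<omega>. cond_mean_but C n g \<omega> * cond_mean_but C n g \<omega> + (?D \<omega> + ?D \<omega>) \<partial>M)"
  proof (rule integral_mono)
    fix \<omega> assume \<omega>: "\<omega> \<in> space M"
    have "cond_mean C n g \<omega> * cond_mean C n g \<omega> \<le> cond_mean_but C n g \<omega> * cond_mean_but C n g \<omega> +
        \<bar>cond_mean C n g \<omega> - cond_mean_but C n g \<omega>\<bar> + \<bar>cond_mean C n g \<omega> - cond_mean_but C n g \<omega>\<bar>"
      using unit_rv_cond_mean unit_rv_cond_mean_but \<omega> by (intro mult_le_mult_perturbed) (auto simp: unit_rv_def)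
    then show "cond_mean C n g \<omega> * cond_mean C n g \<omega> \<le> cond_mean_but C n g \<omega> * cond_mean_but C n g \<omega> + (?D \<omega> + ?D \<omega>)"
      using le[OF \<omega>] by linarith
  qed (intro Bochner_Integration.integrable_add integrable_unit_rv unit_rv_mult unit_rv_cond_mean unit_rv_cond_mean_but D)+
  also have "\<dots> = (\<integral>\<omega>. cond_mean_but C n g \<omega> * cond_mean_but C n g \<omega> \<partial>M) + ((\<integral>\<omega>. ?D \<omega> \<partial>M) + (\<integral>\<omega>. ?D \<omega> \<partial>M))"
  proof -
    have "integrable M (\<lambda>\<omega>. cond_mean_but C n g \<omega> * cond_mean_but C n g \<omega>)" "integrable M ?D"
      by (intro integrable_unit_rv unit_rv_mult unit_rv_cond_mean_but D)+
    then show ?thesis by (simp only: Bochner_Integration.integral_add Bochner_Integration.integrable_add)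
  qed
  finally have 1: "(\<integral>\<omega>. cond_mean C n g \<omega> * cond_mean C n g \<omega> \<partial>M) \<le>
    (\<integral>\<omega>. cond_mean_but C n g \<omega> * cond_mean_but C n g \<omega> \<partial>M) + ((\<integral>\<omega>. ?D \<omega> \<partial>M) + (\<integral>\<omega>. ?D \<omega> \<partial>M))" .
  have "mean_instability C n g = (\<integral>\<omega>. ?D \<omega> \<partial>M)"
    unfolding mean_instability_def
  proof (rule integral_full_sample_Fubini[OF n unit_rv_measurable[OF d]])
    fix w assume "w \<in> space (sample_space (Y n) (p n) (n + 1))"
    then have "?d w \<le> 1" using d unfolding unit_rv_def by blast
    then show "\<bar>?d w\<bar> \<le> 1" by (simp only: abs_abs)
  qed
  with 1 show ?thesis unfolding expectation_cond_mean_but_square by linarith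
qed

lemma unit_rv_loo: "i \<in> {1..n} \<Longrightarrow> unit_rv M (\<lambda>\<omega>. g (score_but C n i (n + 1) (full_sample t n \<omega>)))"
  by (rule unit_rv_but) auto

lemma unit_rv_loo_mean: "unit_rv M (loo_mean C n g)"
  unfolding unit_rv_def
proof (intro conjI ballI)
  show "loo_mean C n g \<in> borel_measurable M"
    unfolding loo_mean_def[abs_def]
    by (intro borel_measurable_divide borel_measurable_sum unit_rv_measurable[OF unit_rv_loo] borel_measurable_const)
  fix \<omega>
  show "0 \<le> loo_mean C n g \<omega>" unfolding loo_mean_def by (intro divide_nonneg_nonneg sum_nonneg g01) auto
  have "(\<Sum>i=1..n. g (score_but C n i (n + 1) (full_sample t n \<omega>))) \<le> (\<Sum>i=1..n. 1)"
    by (intro sum_mono g01)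
  then show "loo_mean C n g \<omega> \<le> 1" using n unfolding loo_mean_def by (simp add: divide_le_eq_1)
qed

lemma expectation_loo_mean_square_le:
  "(\<integral>\<omega>. loo_mean C n g \<omega> * loo_mean C n g \<omega> \<partial>M) \<le> 1 / real n + (pair_mean C n g + 4 * mean_instability C n g)"
proof -
  define k where "k = (\<lambda>i \<omega>. g (score_but C n i (n + 1) (full_sample t n \<omega>)))"
  have k: "unit_rv M (k i)" if "i \<in> {1..n}" for i unfolding k_def by (rule unit_rv_loo[OF that])
  have pos: "0 \<le> pair_mean C n g + 4 * mean_instability C n g"
    unfolding pair_mean_def mean_instability_def
    by (intro add_nonneg_nonneg mult_nonneg_nonneg integral_nonneg_AE AE_I2) (auto simp: g01)
  have "(\<integral>\<omega>. loo_mean C n g \<omega> * loo_mean C n g \<omega> \<partial>M) = (\<integral>\<omega>. (\<Sum>i=1..n. \<Sum>j=1..n. k i \<omega> * k j \<omega>) / (real n * real n) \<partial>M)"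
    unfolding loo_mean_def k_def by (simp add: sum_product)
  also have "\<dots> = (\<Sum>i=1..n. \<Sum>j=1..n. (\<integral>\<omega>. k i \<omega> * k j \<omega> \<partial>M)) / (real n * real n)"
  proof -
    have int: "integrable M (\<lambda>\<omega>. k i \<omega> * k j \<omega>)" if "i \<in> {1..n}" "j \<in> {1..n}" for i j
      using that by (intro integrable_unit_rv unit_rv_mult k)
    have "(\<integral>\<omega>. (\<Sum>i=1..n. \<Sum>j=1..n. k i \<omega> * k j \<omega>) \<partial>M) = (\<Sum>i=1..n. (\<integral>\<omega>. (\<Sum>j=1..n. k i \<omega> * k j \<omega>) \<partial>M))"
      using int by (intro Bochner_Integration.integral_sum Bochner_Integration.integrable_sum)
    also have "\<dots> = (\<Sum>i=1..n. \<Sum>j=1..n. (\<integral>\<omega>. k i \<omega> * k j \<omega> \<partial>M))"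
      using int by (intro sum.cong refl Bochner_Integration.integral_sum)
    finally show ?thesis by simp
  qed
  also have "\<dots> \<le> (\<Sum>i=1..n. \<Sum>j=1..n. of_bool (i = j) + (pair_mean C n g + 4 * mean_instability C n g)) / (real n * real n)"
  proof (intro divide_right_mono sum_mono)
    fix i j assume ij: "i \<in> {1..n}" "j \<in> {1..n}"
    show "(\<integral>\<omega>. k i \<omega> * k j \<omega> \<partial>M) \<le> of_bool (i = j) + (pair_mean C n g + 4 * mean_instability C n g)"
    proof (cases "i = j")
      case True
      have "(\<integral>\<omega>. k i \<omega> * k j \<omega> \<partial>M) \<le> (\<integral>\<omega>. 1 \<partial>M)"
      proof (rule integral_mono)
        show "integrable M (\<lambda>\<omega>. k i \<omega> * k j \<omega>)"
          by (intro integrable_unit_rv unit_rv_mult k ij)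
      qed (auto simp: k_def g01 mult_le_one)
      then show ?thesis using True pos by (simp add: prob_space)
    next
      case False
      then show ?thesis using expectation_loo_pair_le[OF ij] by (simp add: k_def)
    qed
  qed simp
  also have "(\<Sum>i=1..n. \<Sum>j=1..n. of_bool (i = j) + (pair_mean C n g + 4 * mean_instability C n g)) =
      real n + real n * (real n * (pair_mean C n g + 4 * mean_instability C n g))"
  proof -
    have "(\<Sum>j=1..n. of_bool (i = j) :: real) = 1" if "i \<in> {1..n}" for i
      using that by (subst sum.remove[of _ i]) (auto intro!: sum.neutral)
    then have "(\<Sum>i=1..n. \<Sum>j=1..n. of_bool (i = j) + (pair_mean C n g + 4 * mean_instability C n g)) =
        (\<Sum>i=1..n. 1 + real n * (pair_mean C n g + 4 * mean_instability C n g))"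
      by (intro sum.cong refl) (simp only: sum.distrib distrib_left sum_constant card_atLeastAtMost diff_Suc_1 Suc_eq_plus1 add_diff_cancel_right')
    then show ?thesis by (simp add: algebra_simps)
  qed
  also have "(real n + real n * (real n * (pair_mean C n g + 4 * mean_instability C n g))) / (real n * real n) =
      1 / real n + (pair_mean C n g + 4 * mean_instability C n g)"
    using n by (simp add: field_simps)
  finally show ?thesis .
qed

text \<open>The mean of g over the leave-one-out scores is close, in mean square, to the conditional mean of
  g at the score of the new point.\<close>
lemma mean_square_loo_mean_le:
  "(\<integral>\<omega>. (loo_mean C n g \<omega> - cond_mean C n g \<omega>)\<^sup>2 \<partial>M) \<le> 1 / real n + 8 * mean_instability C n g"
proof -
  note u = unit_rv_loo_mean unit_rv_cond_mean
  have cross: "pair_mean C n g - mean_instability C n g \<le> (\<integral>\<omega>. loo_mean C n g \<omega> * cond_mean C n g \<omega> \<partial>M)"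
  proof -
    have "(\<integral>\<omega>. loo_mean C n g \<omega> * cond_mean C n g \<omega> \<partial>M) =
        (\<integral>\<omega>. (\<Sum>i=1..n. g (score_but C n i (n + 1) (full_sample t n \<omega>)) * cond_mean C n g \<omega>) / real n \<partial>M)"
      unfolding loo_mean_def by (simp add: sum_distrib_right)
    also have "\<dots> = (\<Sum>i=1..n. (\<integral>\<omega>. g (score_but C n i (n + 1) (full_sample t n \<omega>)) * cond_mean C n g \<omega> \<partial>M)) / real n"
      by (subst integral_divide_zero, subst Bochner_Integration.integral_sum)
        (intro integrable_unit_rv unit_rv_mult unit_rv_loo u, assumption, rule refl)
    finally have "(\<integral>\<omega>. loo_mean C n g \<omega> * cond_mean C n g \<omega> \<partial>M) =
      (\<Sum>i=1..n. (\<integral>\<omega>. g (score_but C n i (n + 1) (full_sample t n \<omega>)) * cond_mean C n g \<omega> \<partial>M)) / real n" .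
    moreover have "(\<Sum>i=1..n. pair_mean C n g - mean_instability C n g) \<le>
        (\<Sum>i=1..n. (\<integral>\<omega>. g (score_but C n i (n + 1) (full_sample t n \<omega>)) * cond_mean C n g \<omega> \<partial>M))"
      by (intro sum_mono expectation_loo_cond_mean_ge)
    ultimately have "real n * (pair_mean C n g - mean_instability C n g) / real n \<le> (\<integral>\<omega>. loo_mean C n g \<omega> * cond_mean C n g \<omega> \<partial>M)"
      by (simp only: divide_right_mono of_nat_0_le_iff sum_constant card_atLeastAtMost add_diff_cancel_right' diff_Suc_1)
    then show ?thesis using n by simp
  qed
  have "(\<integral>\<omega>. (loo_mean C n g \<omega> - cond_mean C n g \<omega>)\<^sup>2 \<partial>M) = (\<integral>\<omega>. loo_mean C n g \<omega> * loo_mean C n g \<omega> +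
      (cond_mean C n g \<omega> * cond_mean C n g \<omega> - 2 * (loo_mean C n g \<omega> * cond_mean C n g \<omega>)) \<partial>M)"
    by (rule Bochner_Integration.integral_cong) (auto simp: power2_eq_square algebra_simps)
  also have "\<dots> = (\<integral>\<omega>. loo_mean C n g \<omega> * loo_mean C n g \<omega> \<partial>M) +
      ((\<integral>\<omega>. cond_mean C n g \<omega> * cond_mean C n g \<omega> \<partial>M) - 2 * (\<integral>\<omega>. loo_mean C n g \<omega> * cond_mean C n g \<omega> \<partial>M))"
  proof -
    have "integrable M (\<lambda>\<omega>. loo_mean C n g \<omega> * loo_mean C n g \<omega>)" "integrable M (\<lambda>\<omega>. cond_mean C n g \<omega> * cond_mean C n g \<omega>)"
      "integrable M (\<lambda>\<omega>. loo_mean C n g \<omega> * cond_mean C n g \<omega>)"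
      by (intro integrable_unit_rv unit_rv_mult u)+
    then show ?thesis by simp
  qed
  finally show ?thesis
    using cross expectation_loo_mean_square_le expectation_cond_mean_square_le by linarith
qed

end

end

section \<open>Stochastically bounded scores\<close>

text \<open>The continuous function that is 1 up to s, 0 from s + h on, and linear in between.\<close>
definition ramp :: "real \<Rightarrow> real \<Rightarrow> real \<Rightarrow> real" where
  "ramp h s u = max 0 (min 1 ((s + h - u) / h))"

lemma ramp_bounds: "0 \<le> ramp h s u" "ramp h s u \<le> 1"
  by (auto simp: ramp_def)

lemma ramp_measurable: "ramp h s \<in> borel_measurable borel"
  unfolding ramp_def[abs_def] by measurable

lemma ramp_Lipschitz:
  assumes "h > 0"
  shows "\<bar>ramp h s x - ramp h s y\<bar> \<le> (1 / h) * \<bar>x - y\<bar>"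
proof -
  have "\<bar>ramp h s x - ramp h s y\<bar> \<le> \<bar>(s + h - x) / h - (s + h - y) / h\<bar>"
    unfolding ramp_def by (auto simp: max_def min_def)
  also have "(s + h - x) / h - (s + h - y) / h = (y - x) / h"
    by (simp add: diff_divide_distrib[symmetric])
  also have "\<bar>(y - x) / h\<bar> = (1 / h) * \<bar>x - y\<bar>"
    using assms by (simp add: abs_minus_commute)
  finally show ?thesis .
qed

lemma ramp_indicator:
  assumes "h > 0"
  shows "of_bool (u \<le> s) \<le> ramp h s u" "ramp h s u \<le> of_bool (u \<le> s + h)"
  using assms by (auto simp: ramp_def field_simps min_def max_def)

context iid_array
begin

lemma mean_instability_tendsto_0:
  assumes C: "conformity_scores Y p C"
    and stable: "\<And>\<eta>. \<eta> > 0 \<Longrightarrow> (\<lambda>n. instability C n \<eta>) \<longlonglongrightarrow> 0"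
    and g: "g \<in> borel_measurable borel" and g01: "\<And>x. 0 \<le> g x" "\<And>x. g x \<le> 1"
    and L: "L > 0" "\<And>x y. \<bar>g x - g y\<bar> \<le> L * \<bar>x - y\<bar>"
  shows "(\<lambda>n. mean_instability C n g) \<longlonglongrightarrow> 0"
proof (rule tendstoI)
  fix e :: real assume "e > 0"
  \<comment> \<open>Changes of the score below \<open>\<eta>\<close> change g by at most e / 2.\<close>
  define \<eta> where "\<eta> = e / (2 * L)"
  have \<eta>: "\<eta> > 0" "L * \<eta> = e / 2" using \<open>e > 0\<close> L(1) by (simp_all add: \<eta>_def)
  have "\<forall>\<^sub>F n in sequentially. instability C n \<eta> < e / 2"
    using order_tendstoD(2)[OF stable[OF \<eta>(1)], of "e / 2"] \<open>e > 0\<close> by simp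
  then show "\<forall>\<^sub>F n in sequentially. dist (mean_instability C n g) 0 < e"
    using eventually_ge_at_top[of 1]
  proof eventually_elim
    case (elim n)
    then have n: "1 \<le> n" by simp
    note ind = last_indices[OF n]
    let ?l = "\<lambda>\<omega>. score_all C n (n + 1) (full_sample t n \<omega>)"
    let ?k = "\<lambda>\<omega>. score_but C n (n + 1) n (full_sample t n \<omega>)"
    have [measurable]: "?l \<in> borel_measurable M" "?k \<in> borel_measurable M"
      using measurable_compose[OF measurable_full_sample[OF n] measurable_score_all[OF C n ind(1)]]
        measurable_compose[OF measurable_full_sample[OF n] measurable_score_but[OF C n ind(1,2,4)]] by auto
    let ?A = "{\<omega> \<in> space M. \<bar>?l \<omega> - ?k \<omega>\<bar> > \<eta>}"
    have A: "?A \<in> sets M" by measurable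
    have iA: "integrable M (\<lambda>\<omega>. indicator ?A \<omega> :: real)" using A by (simp add: less_top[symmetric])
    have "mean_instability C n g \<le> (\<integral>\<omega>. L * \<eta> + indicator ?A \<omega> \<partial>M)"
      unfolding mean_instability_def
    proof (rule integral_mono)
      show "integrable M (\<lambda>\<omega>. \<bar>g (?l \<omega>) - g (?k \<omega>)\<bar>)"
        by (intro integrable_unit_rv unit_rv_abs_diff unit_rv_all unit_rv_but C n g g01 ind)
      show "integrable M (\<lambda>\<omega>. L * \<eta> + indicator ?A \<omega>)" using iA by simp
      fix \<omega> assume \<omega>: "\<omega> \<in> space M"
      show "\<bar>g (?l \<omega>) - g (?k \<omega>)\<bar> \<le> L * \<eta> + indicator ?A \<omega>"
      proof (cases "\<omega> \<in> ?A")
        case True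
        have "\<bar>g (?l \<omega>) - g (?k \<omega>)\<bar> \<le> 1" using g01[of "?l \<omega>"] g01[of "?k \<omega>"] by linarith
        moreover have "0 \<le> L * \<eta>" using L(1) \<eta>(1) by simp
        moreover have "indicator ?A \<omega> = (1 :: real)" using True by (rule indicator_simps)
        ultimately show ?thesis by linarith
      next
        case False
        then have "\<bar>?l \<omega> - ?k \<omega>\<bar> \<le> \<eta>" using \<omega> by simp
        then have "L * \<bar>?l \<omega> - ?k \<omega>\<bar> \<le> L * \<eta>" using L(1) by simp
        moreover have "indicator ?A \<omega> = (0 :: real)" using False by (rule indicator_simps)
        ultimately show ?thesis using L(2)[of "?l \<omega>" "?k \<omega>"] by linarith
      qed
    qed
    also have "\<dots> = L * \<eta> + instability C n \<eta>"
      using iA A by (subst Bochner_Integration.integral_add) (auto simp: prob_space instability_def Int_absorb2 subsetI)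
    also have "\<dots> < e" using elim \<eta>(2) by simp
    finally have "mean_instability C n g < e" .
    moreover have "0 \<le> mean_instability C n g"
      unfolding mean_instability_def by (intro integral_nonneg_AE AE_I2) simp
    ultimately show ?case by simp
  qed
qed

lemma vanishing_loo_mean:
  assumes C: "conformity_scores Y p C"
    and stable: "\<And>\<eta>. \<eta> > 0 \<Longrightarrow> (\<lambda>n. instability C n \<eta>) \<longlonglongrightarrow> 0"
    and g: "g \<in> borel_measurable borel" and g01: "\<And>x. 0 \<le> g x" "\<And>x. g x \<le> 1"
    and L: "L > 0" "\<And>x y. \<bar>g x - g y\<bar> \<le> L * \<bar>x - y\<bar>" and "\<epsilon> > 0"
  shows "vanishing M (\<lambda>n. {\<omega> \<in> space M. \<bar>loo_mean C n g \<omega> - cond_mean C n g \<omega>\<bar> > \<epsilon>})"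
proof -
  let ?X = "\<lambda>n \<omega>. (loo_mean C n g \<omega> - cond_mean C n g \<omega>)\<^sup>2"
  have lim: "(\<lambda>n. 1 / real n + 8 * mean_instability C n g) \<longlonglongrightarrow> 0"
    using tendsto_add[OF lim_1_over_n tendsto_mult[OF tendsto_const[of 8]
        mean_instability_tendsto_0[OF C stable g g01 L]]] by simp
  have "vanishing M (\<lambda>n. {\<omega> \<in> space M. ?X n \<omega> > \<epsilon>\<^sup>2})"
  proof (rule vanishing_Markov)
    show "\<forall>\<^sub>F n in sequentially. integrable M (?X n) \<and> (\<forall>\<omega>\<in>space M. 0 \<le> ?X n \<omega>)"
    proof (intro eventually_sequentiallyI[of 1] conjI ballI zero_le_power2)
      fix n :: nat assume n: "1 \<le> n"
      have "unit_rv M (\<lambda>\<omega>. \<bar>loo_mean C n g \<omega> - cond_mean C n g \<omega>\<bar> * \<bar>loo_mean C n g \<omega> - cond_mean C n g \<omega>\<bar>)"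
        by (intro unit_rv_mult unit_rv_abs_diff unit_rv_loo_mean unit_rv_cond_mean C n g g01)
      from integrable_unit_rv[OF this] show "integrable M (?X n)"
        by (simp add: power2_eq_square abs_mult[symmetric])
    qed
    show "(\<lambda>n. expectation (?X n)) \<longlonglongrightarrow> 0"
    proof (rule tendsto_sandwich[OF _ _ tendsto_const lim])
      show "\<forall>\<^sub>F n in sequentially. expectation (?X n) \<le> 1 / real n + 8 * mean_instability C n g"
        by (intro eventually_sequentiallyI[of 1] mean_square_loo_mean_le C g g01)
    qed (auto intro!: always_eventually integral_nonneg_AE)
  qed (use \<open>\<epsilon> > 0\<close> in simp)
  then show ?thesis
  proof (rule vanishing_mono, intro always_eventually allI subsetI)
    fix n \<omega> assume \<omega>: "\<omega> \<in> {\<omega> \<in> space M. \<bar>loo_mean C n g \<omega> - cond_mean C n g \<omega>\<bar> > \<epsilon>}"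
    then have "\<epsilon>\<^sup>2 < \<bar>loo_mean C n g \<omega> - cond_mean C n g \<omega>\<bar>\<^sup>2"
      using \<open>\<epsilon> > 0\<close> by (intro power_strict_mono) auto
    then show "\<omega> \<in> {\<omega> \<in> space M. ?X n \<omega> > \<epsilon>\<^sup>2}" using \<omega> by simp
  qed
qed

text \<open>The conditional distribution function of the score of the new point.\<close>
definition score_cdf :: "score_family \<Rightarrow> nat \<Rightarrow> 'w \<Rightarrow> real \<Rightarrow> real" where
  "score_cdf C n \<omega> s = measure (P n) {z \<in> space (P n). C n n z (training t n \<omega>) \<le> s}"

text \<open>The empirical distribution function of the leave-one-out scores.\<close>
definition loo_cdf :: "score_family \<Rightarrow> nat \<Rightarrow> 'w \<Rightarrow> real \<Rightarrow> real" where
  "loo_cdf C n \<omega> = emp_cdf n (\<lambda>i. score_but C n i (n + 1) (full_sample t n \<omega>))"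

lemma measurable_score_new:
  assumes C: "conformity_scores Y p C" and n: "1 \<le> n" and \<omega>: "\<omega> \<in> space M"
  shows "(\<lambda>z. C n n z (training t n \<omega>)) \<in> borel_measurable (P n)"
proof -
  note T = training_space[OF n \<omega>]
  have "(\<lambda>z. score_all C n (n + 1) ((training t n \<omega>)(n + 1 := z))) \<in> borel_measurable (P n)"
    by (rule measurable_fun_upd_P[OF n measurable_score_last(1)[OF C n] T])
  moreover have "score_all C n (n + 1) ((training t n \<omega>)(n + 1 := z)) = C n n z (training t n \<omega>)"
    if "z \<in> space (P n)" for z
    using scores_fun_upd(1)[OF C n T] that unfolding space_P[OF n] .
  ultimately show ?thesis by (rule measurable_cong[THEN iffD1, rotated])
qed

lemma cond_mean_eq:
  assumes C: "conformity_scores Y p C" and n: "1 \<le> n" and \<omega>: "\<omega> \<in> space M"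
  shows "cond_mean C n g \<omega> = (\<integral>z. g (C n n z (training t n \<omega>)) \<partial>P n)"
  unfolding cond_mean_def
  by (rule Bochner_Integration.integral_cong[OF refl])
    (simp only: space_P[OF n] scores_fun_upd(1)[OF C n training_space[OF n \<omega>]])

lemma ramp_cond_mean:
  assumes C: "conformity_scores Y p C" and n: "1 \<le> n" and \<omega>: "\<omega> \<in> space M" and h: "h > 0"
  shows "score_cdf C n \<omega> s \<le> cond_mean C n (ramp h s) \<omega>"
    and "cond_mean C n (ramp h s) \<omega> \<le> score_cdf C n \<omega> (s + h)"
proof -
  interpret Pn: prob_space "P n" by (rule prob_space_P[OF n])
  let ?S = "\<lambda>z. C n n z (training t n \<omega>)"
  note S[measurable] = measurable_score_new[OF C n \<omega>]
  note ramp_measurable[measurable]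
  have ind: "score_cdf C n \<omega> s = (\<integral>z. of_bool (?S z \<le> s) \<partial>P n)" for s
  proof -
    have "(\<integral>z. of_bool (?S z \<le> s) \<partial>P n) = (\<integral>z. indicator {z \<in> space (P n). ?S z \<le> s} z \<partial>P n :: real)"
      by (rule Bochner_Integration.integral_cong) (auto simp: indicator_def)
    then show ?thesis by (simp add: score_cdf_def Int_absorb2 subsetI)
  qed
  have int: "integrable (P n) (\<lambda>z. ramp h s (?S z))" "integrable (P n) (\<lambda>z. of_bool (?S z \<le> s') :: real)" for s'
    by (intro Pn.integrable_unit_rv; auto simp: unit_rv_def ramp_bounds)+
  show "score_cdf C n \<omega> s \<le> cond_mean C n (ramp h s) \<omega>"
    unfolding ind cond_mean_eq[OF C n \<omega>] by (intro integral_mono int ramp_indicator(1)[OF h])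
  show "cond_mean C n (ramp h s) \<omega> \<le> score_cdf C n \<omega> (s + h)"
    unfolding ind cond_mean_eq[OF C n \<omega>] by (intro integral_mono int ramp_indicator(2)[OF h])
qed

lemma ramp_loo_mean:
  assumes h: "h > 0"
  shows "loo_cdf C n \<omega> s \<le> loo_mean C n (ramp h s) \<omega>"
    and "loo_mean C n (ramp h s) \<omega> \<le> loo_cdf C n \<omega> (s + h)"
proof -
  show "loo_cdf C n \<omega> s \<le> loo_mean C n (ramp h s) \<omega>"
    unfolding loo_cdf_def emp_cdf_alt loo_mean_def
    by (intro divide_right_mono sum_mono ramp_indicator(1) h of_nat_0_le_iff)
  show "loo_mean C n (ramp h s) \<omega> \<le> loo_cdf C n \<omega> (s + h)"
    unfolding loo_cdf_def emp_cdf_alt loo_mean_def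
    by (intro divide_right_mono sum_mono ramp_indicator(2) h of_nat_0_le_iff)
qed

lemma score_cdf_mono:
  assumes C: "conformity_scores Y p C" and n: "1 \<le> n" and \<omega>: "\<omega> \<in> space M" and "s \<le> s'"
  shows "score_cdf C n \<omega> s \<le> score_cdf C n \<omega> s'"
proof -
  interpret Pn: prob_space "P n" by (rule prob_space_P[OF n])
  note measurable_score_new[OF C n \<omega>, measurable]
  show ?thesis unfolding score_cdf_def
  proof (rule Pn.finite_measure_mono)
    show "{z \<in> space (P n). C n n z (training t n \<omega>) \<le> s'} \<in> sets (P n)" by measurable
  qed (use \<open>s \<le> s'\<close> in auto)
qed

text \<open>
  The empirical distribution of the leave-one-out scores and the conditional distribution of the
  score of the new point get close in the Levy metric. It is enough to compare the two on the ramps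
  of a finite grid, because nonnegative, stochastically bounded scores concentrate on a bounded interval.
\<close>
lemma vanishing_Levy:
  assumes C: "conformity_scores Y p C"
    and stable: "\<And>\<eta>. \<eta> > 0 \<Longrightarrow> (\<lambda>n. instability C n \<eta>) \<longlonglongrightarrow> 0"
    and nonneg: "\<And>n m z T. 0 \<le> C n m z T"
    and tight: "\<And>e. e > 0 \<Longrightarrow> \<exists>K. \<forall>n\<ge>1. prob {\<omega> \<in> space M. score_all C n (n + 1) (full_sample t n \<omega>) > K} \<le> e"
    and "\<delta> > 0" "\<epsilon> > 0"
  shows "vanishing M (\<lambda>n. {\<omega> \<in> space M. \<not> (\<forall>s. loo_cdf C n \<omega> s \<le> score_cdf C n \<omega> (s + \<delta>) + \<epsilon> \<and>
    score_cdf C n \<omega> s \<le> loo_cdf C n \<omega> (s + \<delta>) + \<epsilon>)})"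
proof (rule vanishing_approx)
  fix e :: real assume "e > 0"
  then have "e * (\<epsilon> / 2) > 0" using \<open>\<epsilon> > 0\<close> by simp
  from tight[OF this] obtain K where K: "\<And>n. 1 \<le> n \<Longrightarrow>
    prob {\<omega> \<in> space M. score_all C n (n + 1) (full_sample t n \<omega>) > K} \<le> e * (\<epsilon> / 2)" by blast
  \<comment> \<open>The grid consists of the multiples of \<open>h = \<delta> / 2\<close> up to a bound that the score of the new
    point rarely exceeds: one h is used for
    rounding s up to the grid, the other one is the width of the ramps.\<close>
  define h where "h = \<delta> / 2"
  have h: "h > 0" "\<delta> = h + h" using \<open>\<delta> > 0\<close> by (simp_all add: h_def)
  define J where "J = nat \<lceil>K / h\<rceil>"
  have "K / h \<le> real J" unfolding J_def by linarith
  then have J: "K \<le> real J * h" using h(1) by (simp add: pos_divide_le_eq)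
  let ?A = "\<lambda>j n. {\<omega> \<in> space M. \<bar>loo_mean C n (ramp h (real j * h)) \<omega> - cond_mean C n (ramp h (real j * h)) \<omega>\<bar> > \<epsilon> / 2}"
  have A: "vanishing M (\<lambda>n. \<Union>j\<in>{..J}. ?A j n)"
    using h(1) \<open>\<epsilon> > 0\<close>
    by (intro vanishing_UN vanishing_loo_mean[OF C stable ramp_measurable ramp_bounds, where L = "1 / h"] ramp_Lipschitz) auto
  show "\<exists>A'. vanishing M A' \<and> (\<forall>\<^sub>F n in sequentially. \<exists>B\<in>sets M. prob B \<le> e \<and>
    {\<omega> \<in> space M. \<not> (\<forall>s. loo_cdf C n \<omega> s \<le> score_cdf C n \<omega> (s + \<delta>) + \<epsilon> \<and>
      score_cdf C n \<omega> s \<le> loo_cdf C n \<omega> (s + \<delta>) + \<epsilon>)} \<subseteq> A' n \<union> B)"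
  proof (intro exI[of _ "\<lambda>n. \<Union>j\<in>{..J}. ?A j n"] conjI A eventually_sequentiallyI[of 1])
    fix n :: nat assume n: "1 \<le> n"
    interpret Pn: prob_space "P n" by (rule prob_space_P[OF n])
    let ?Q = "{w \<in> space (sample_space (Y n) (p n) (n + 1)). score_all C n (n + 1) w > K}"
    have Q: "?Q \<in> sets (sample_space (Y n) (p n) (n + 1))"
      using measurable_score_last(1)[OF C n] by measurable
    let ?X = "\<lambda>\<omega>. measure (P n) (sections P n ?Q (training t n \<omega>))"
    have X[measurable]: "?X \<in> borel_measurable M" by (rule measurable_measure_section[OF n Q])
    have X_eq: "?X \<omega> = 1 - score_cdf C n \<omega> K" if \<omega>: "\<omega> \<in> space M" for \<omega>
    proof -
      note T = training_space[OF n \<omega>]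
      note measurable_score_new[OF C n \<omega>, measurable]
      have "sections P n ?Q (training t n \<omega>) = space (P n) - {z \<in> space (P n). C n n z (training t n \<omega>) \<le> K}"
        unfolding sections_def using scores_fun_upd(1)[OF C n T] space_sample_fun_upd[OF T] space_P[OF n]
        by (auto simp del: fun_upd_apply)
      moreover have "measure (P n) (space (P n) - {z \<in> space (P n). C n n z (training t n \<omega>) \<le> K}) =
          1 - measure (P n) {z \<in> space (P n). C n n z (training t n \<omega>) \<le> K}"
        by (rule Pn.prob_compl) measurable
      ultimately show ?thesis by (simp only: score_cdf_def)
    qed
    let ?B = "{\<omega> \<in> space M. ?X \<omega> \<ge> \<epsilon> / 2}"
    have "unit_rv M ?X" using X by (simp add: unit_rv_def)
    then have "integrable M ?X" by (rule integrable_unit_rv)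
    then have "prob ?B \<le> expectation ?X / (\<epsilon> / 2)"
      using \<open>\<epsilon> > 0\<close> by (intro integral_Markov_inequality_measure[where A = "{}"]) auto
    also have "expectation ?X / (\<epsilon> / 2) \<le> e"
    proof -
      have "{\<omega> \<in> space M. full_sample t n \<omega> \<in> ?Q} = {\<omega> \<in> space M. score_all C n (n + 1) (full_sample t n \<omega>) > K}"
        using full_sample_space[OF n] by blast
      then have "expectation ?X \<le> e * (\<epsilon> / 2)" using expectation_measure_section[OF n Q] K[OF n] by (simp only:)
      then show ?thesis using \<open>\<epsilon> > 0\<close> by (subst pos_divide_le_eq) auto
    qed
    finally have B: "prob ?B \<le> e" .
    have "loo_cdf C n \<omega> s \<le> score_cdf C n \<omega> (s + \<delta>) + \<epsilon> \<and> score_cdf C n \<omega> s \<le> loo_cdf C n \<omega> (s + \<delta>) + \<epsilon>"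
      if \<omega>: "\<omega> \<in> space M" "\<omega> \<notin> (\<Union>j\<in>{..J}. ?A j n)" "\<omega> \<notin> ?B" for \<omega> s
    proof -
      note Fm = score_cdf_mono[OF C n \<omega>(1)]
      have Gm: "loo_cdf C n \<omega> s \<le> loo_cdf C n \<omega> s'" if "s \<le> s'" for s s'
        unfolding loo_cdf_def by (rule emp_cdf_mono[OF that])
      have F01: "0 \<le> score_cdf C n \<omega> s" "score_cdf C n \<omega> s \<le> 1" for s by (simp_all add: score_cdf_def)
      have G01: "0 \<le> loo_cdf C n \<omega> s" "loo_cdf C n \<omega> s \<le> 1" for s
        unfolding loo_cdf_def emp_cdf_alt
        using sum_of_bool_bounds[of "\<lambda>i. score_but C n i (n + 1) (full_sample t n \<omega>) \<le> s" n] n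
        by (auto intro: divide_nonneg_nonneg simp: divide_le_eq_1)
      have grid: "loo_cdf C n \<omega> (real j * h) \<le> score_cdf C n \<omega> (real j * h + h) + \<epsilon> / 2"
        "score_cdf C n \<omega> (real j * h) \<le> loo_cdf C n \<omega> (real j * h + h) + \<epsilon> / 2" if "j \<le> J" for j
      proof -
        have "\<omega> \<notin> ?A j n" using \<omega>(2) that by blast
        then have "\<bar>loo_mean C n (ramp h (real j * h)) \<omega> - cond_mean C n (ramp h (real j * h)) \<omega>\<bar> \<le> \<epsilon> / 2"
          using \<omega>(1) by simp
        then show "loo_cdf C n \<omega> (real j * h) \<le> score_cdf C n \<omega> (real j * h + h) + \<epsilon> / 2"
          "score_cdf C n \<omega> (real j * h) \<le> loo_cdf C n \<omega> (real j * h + h) + \<epsilon> / 2"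
          using ramp_cond_mean[OF C n \<omega>(1) h(1), of "real j * h"] 
            ramp_loo_mean[OF h(1), where C = C and n = n and \<omega> = \<omega> and s = "real j * h"]
          by linarith+
      qed
      have tail: "1 - \<epsilon> / 2 \<le> score_cdf C n \<omega> s'" if "real J * h \<le> s'" for s'
        using \<omega>(1,3) X_eq[OF \<omega>(1)] Fm[of K s'] J that by simp
      \<comment> \<open>Below zero both functions vanish, and beyond the grid both are nearly one.\<close>
      consider "s < 0" | "0 \<le> s" "s \<le> real J * h" | "real J * h < s" by linarith
      then show ?thesis
      proof cases
        case 1
        have "{z \<in> space (P n). C n n z (training t n \<omega>) \<le> s} = {}"
          using nonneg[of n n _ "training t n \<omega>"] 1 by (auto simp: not_le intro: less_le_trans)
        then have "score_cdf C n \<omega> s = 0" unfolding score_cdf_def by (simp only: measure_empty)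
        moreover have "loo_cdf C n \<omega> s = 0"
        proof -
          have "\<not> score_but C n i (n + 1) (full_sample t n \<omega>) \<le> s" for i
            using nonneg 1 unfolding score_but_def by (meson less_le_trans not_le)
          then have "(\<Sum>i=1..n. of_bool (score_but C n i (n + 1) (full_sample t n \<omega>) \<le> s) :: real) = (\<Sum>i=1..n. 0)"
            by (intro sum.cong refl) (simp only: of_bool_eq)
          then show ?thesis unfolding loo_cdf_def emp_cdf_alt by (simp only:) simp
        qed
        ultimately show ?thesis using F01(1)[of "s + \<delta>"] G01(1)[of "s + \<delta>"] \<open>\<epsilon> > 0\<close> by simp
      next
        case 2
        define j where "j = nat \<lceil>s / h\<rceil>"
        have "0 \<le> s / h" "s / h \<le> real J" using 2 h(1) by (simp_all add: pos_divide_le_eq)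
        then have "j \<le> J" "s / h \<le> real j" "real j \<le> s / h + 1" unfolding j_def by linarith+
        then have j: "j \<le> J" "s \<le> real j * h" "real j * h \<le> s + h"
          using h(1) by (simp_all add: field_simps)
        have "real j * h + h \<le> s + \<delta>" using j(3) h(2) by simp
        then show ?thesis
          using grid[OF j(1)] Fm[OF j(2)] Gm[OF j(2)] Fm[of "real j * h + h" "s + \<delta>"]
            Gm[of "real j * h + h" "s + \<delta>"] \<open>\<epsilon> > 0\<close> by linarith
      next
        case 3
        have "real J * h \<le> s + \<delta>" "real J * h + h \<le> s + \<delta>" using 3 h by linarith+
        then show ?thesis
          using tail[of "s + \<delta>"] tail[OF order_refl] grid(2)[OF order_refl] Gm[of "real J * h + h" "s + \<delta>"]
            G01(2)[of s] F01(2)[of s] \<open>\<epsilon> > 0\<close> by linarith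
      qed
    qed
    then have sub: "{\<omega> \<in> space M. \<not> (\<forall>s. loo_cdf C n \<omega> s \<le> score_cdf C n \<omega> (s + \<delta>) + \<epsilon> \<and>
      score_cdf C n \<omega> s \<le> loo_cdf C n \<omega> (s + \<delta>) + \<epsilon>)} \<subseteq> (\<Union>j\<in>{..J}. ?A j n) \<union> ?B" by blast
    have "?B \<in> sets M" by measurable
    with B sub show "\<exists>B\<in>sets M. prob B \<le> e \<and> {\<omega> \<in> space M. \<not> (\<forall>s. loo_cdf C n \<omega> s \<le> score_cdf C n \<omega> (s + \<delta>) + \<epsilon> \<and>
      score_cdf C n \<omega> s \<le> loo_cdf C n \<omega> (s + \<delta>) + \<epsilon>)} \<subseteq> (\<Union>j\<in>{..J}. ?A j n) \<union> B"
      by (intro bexI[of _ ?B] conjI)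
  qed
qed

text \<open>Closeness in the Levy metric bounds the level of the shortcut with inflation \<open>\<delta>\<close> from above, and
  the one with inflation \<open>-\<delta>\<close> from below.\<close>
lemma sc_level_if_Levy_close:
  assumes C: "conformity_scores Y p C" and nonneg: "\<And>n m z T. 0 \<le> C n m z T"
    and Levy: "\<And>\<delta> \<epsilon>. \<delta> > 0 \<Longrightarrow> \<epsilon> > 0 \<Longrightarrow> vanishing M (\<lambda>n. {\<omega> \<in> space M. \<not> (\<forall>s.
      loo_cdf C n \<omega> s \<le> score_cdf C n \<omega> (s + \<delta>) + \<epsilon> \<and> score_cdf C n \<omega> s \<le> loo_cdf C n \<omega> (s + \<delta>) + \<epsilon>)})"
    and "\<delta> > 0" "\<epsilon> > 0"
  shows "vanishing M (\<lambda>n. {\<omega> \<in> space M. \<exists>\<alpha>\<in>{0..1}. \<not> (\<alpha> - \<epsilon> \<le> pvalue_cdf P (pv_sc C) n (- \<delta>) (training t n \<omega>) \<alpha> \<and>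
    pvalue_cdf P (pv_sc C) n \<delta> (training t n \<omega>) \<alpha> \<le> \<alpha> + \<epsilon>)})"
proof -
  have "\<delta> / 2 > 0" using \<open>\<delta> > 0\<close> by simp
  from Levy[OF this \<open>\<epsilon> > 0\<close>] show ?thesis
  proof (rule vanishing_mono, intro eventually_sequentiallyI[of 1] subsetI)
    fix n \<omega> assume n: "1 \<le> n" and \<omega>: "\<omega> \<in> {\<omega> \<in> space M. \<exists>\<alpha>\<in>{0..1}.
      \<not> (\<alpha> - \<epsilon> \<le> pvalue_cdf P (pv_sc C) n (- \<delta>) (training t n \<omega>) \<alpha> \<and>
        pvalue_cdf P (pv_sc C) n \<delta> (training t n \<omega>) \<alpha> \<le> \<alpha> + \<epsilon>)}"
    then have \<omega>': "\<omega> \<in> space M" by blast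
    let ?R = "\<lambda>i. score_but C n i (n + 1) (full_sample t n \<omega>)"
    have R: "0 \<le> ?R i" for i using nonneg by (simp add: score_but_def)
    note S = measurable_score_new[OF C n \<omega>']
    show "\<omega> \<in> {\<omega> \<in> space M. \<not> (\<forall>s. loo_cdf C n \<omega> s \<le> score_cdf C n \<omega> (s + \<delta> / 2) + \<epsilon> \<and>
        score_cdf C n \<omega> s \<le> loo_cdf C n \<omega> (s + \<delta> / 2) + \<epsilon>)}"
    proof (rule ccontr)
      assume "\<not> ?thesis"
      then have le: "loo_cdf C n \<omega> s \<le> score_cdf C n \<omega> (s + \<delta> / 2) + \<epsilon>"
        "score_cdf C n \<omega> s \<le> loo_cdf C n \<omega> (s + \<delta> / 2) + \<epsilon>" for s using \<omega>' by blast+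
      have "\<alpha> - \<epsilon> \<le> pvalue_cdf P (pv_sc C) n (- \<delta>) (training t n \<omega>) \<alpha>"
        "pvalue_cdf P (pv_sc C) n \<delta> (training t n \<omega>) \<alpha> \<le> \<alpha> + \<epsilon>" if \<alpha>: "\<alpha> \<in> {0..1}" for \<alpha>
      proof -
        show "pvalue_cdf P (pv_sc C) n \<delta> (training t n \<omega>) \<alpha> \<le> \<alpha> + \<epsilon>"
          unfolding pvalue_cdf_sc[OF C n \<omega>'] using le(1) \<open>\<epsilon> > 0\<close> unfolding loo_cdf_def score_cdf_def
          by (intro level_upper[OF prob_space_P[OF n] S n R \<open>\<delta> > 0\<close> _ \<alpha>]) auto
        show "\<alpha> - \<epsilon> \<le> pvalue_cdf P (pv_sc C) n (- \<delta>) (training t n \<omega>) \<alpha>"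
          unfolding pvalue_cdf_sc[OF C n \<omega>'] diff_minus_eq_add
          using le(2) \<open>\<epsilon> > 0\<close> unfolding loo_cdf_def score_cdf_def
          by (intro level_lower[OF prob_space_P[OF n] S n R \<open>\<delta> > 0\<close> _ \<alpha>]) auto
      qed
      with \<omega> show False by blast
    qed
  qed
qed

text \<open>
  Nonnegative, stable and stochastically bounded scores make the shortcut method asymptotically
  conservative, and valid if in addition they have a stochastically bounded conditional density.
\<close>
lemma sc_conservative_valid:
  assumes C: "conformity_scores Y p C"
    and stable: "\<And>\<eta>. \<eta> > 0 \<Longrightarrow> (\<lambda>n. instability C n \<eta>) \<longlonglongrightarrow> 0"
    and nonneg: "\<And>n m z T. 0 \<le> C n m z T"
    and tight: "\<And>e. e > 0 \<Longrightarrow> \<exists>K. \<forall>n\<ge>1. prob {\<omega> \<in> space M. score_all C n (n + 1) (full_sample t n \<omega>) > K} \<le> e"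
  shows "inflated_conservative M P t (PS_sc Y C)"
    and "CC M P t C \<Longrightarrow> noninflated_valid M P t (PS_sc Y C)"
proof -
  have level: "vanishing M (\<lambda>n. {\<omega> \<in> space M. \<exists>\<alpha>\<in>{0..1}. \<not> (\<alpha> - \<epsilon> \<le>
      pvalue_cdf P (pv_sc C) n (- \<delta>) (training t n \<omega>) \<alpha> \<and>
      pvalue_cdf P (pv_sc C) n \<delta> (training t n \<omega>) \<alpha> \<le> \<alpha> + \<epsilon>)})" if "\<delta> > 0" "\<epsilon> > 0" for \<delta> \<epsilon>
    by (rule sc_level_if_Levy_close[OF C nonneg _ that]) (rule vanishing_Levy[OF C stable nonneg tight])
  show "inflated_conservative M P t (PS_sc Y C)"
    unfolding inflated_conservative_iff[OF pvalue_of_sc[OF C]]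
  proof (intro allI impI)
    fix \<delta> \<epsilon> :: real assume "\<delta> > 0" "\<epsilon> > 0"
    from level[OF this] show "vanishing M (\<lambda>n. {\<omega> \<in> space M. \<exists>\<alpha>\<in>{0..1}.
        pvalue_cdf P (pv_sc C) n \<delta> (training t n \<omega>) \<alpha> > \<alpha> + \<epsilon>})"
      by (rule vanishing_mono) (intro always_eventually allI subsetI, force)
  qed
  assume CC: "CC M P t C"
  show "noninflated_valid M P t (PS_sc Y C)"
    unfolding noninflated_valid_iff[OF pvalue_of_sc[OF C]]
  proof (intro allI impI vanishing_approx)
    fix \<epsilon> e :: real assume "\<epsilon> > 0" "e > 0"
    then have \<epsilon>2: "\<epsilon> / 2 > 0" by simp
    let ?F = "\<lambda>\<delta> n \<omega>. pvalue_cdf P (pv_sc C) n \<delta> (training t n \<omega>)"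
    obtain \<eta> where \<eta>: "\<eta> > 0" and B: "\<And>n. n \<ge> 1 \<Longrightarrow> \<exists>B\<in>sets M. prob B \<le> e \<and>
      (\<forall>\<omega>\<in>space M - B. \<forall>a. ?F (- \<eta>) n \<omega> a \<le> ?F 0 n \<omega> a + \<epsilon> / 2 \<and> ?F 0 n \<omega> a \<le> ?F \<eta> n \<omega> a + \<epsilon> / 2)"
      using inflation_continuous_sc[OF C CC, unfolded inflation_continuous_def, rule_format, OF \<epsilon>2 \<open>e > 0\<close>] by blast
    let ?A = "\<lambda>n. {\<omega> \<in> space M. \<exists>\<alpha>\<in>{0..1}. \<not> (\<alpha> - \<epsilon> / 2 \<le> ?F (- \<eta>) n \<omega> \<alpha> \<and> ?F \<eta> n \<omega> \<alpha> \<le> \<alpha> + \<epsilon> / 2)}"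
    show "\<exists>A'. vanishing M A' \<and> (\<forall>\<^sub>F n in sequentially. \<exists>B\<in>sets M. prob B \<le> e \<and>
      {\<omega> \<in> space M. \<exists>\<alpha>\<in>{0..1}. \<bar>?F 0 n \<omega> \<alpha> - \<alpha>\<bar> > \<epsilon>} \<subseteq> A' n \<union> B)"
    proof (intro exI[of _ ?A] conjI level[OF \<eta> \<epsilon>2] eventually_sequentiallyI[of 1])
      fix n :: nat assume n: "1 \<le> n"
      obtain B where B1: "B \<in> sets M" and B2: "prob B \<le> e \<and>
        (\<forall>\<omega>\<in>space M - B. \<forall>a. ?F (- \<eta>) n \<omega> a \<le> ?F 0 n \<omega> a + \<epsilon> / 2 \<and> ?F 0 n \<omega> a \<le> ?F \<eta> n \<omega> a + \<epsilon> / 2)"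
        using B[OF n] by (elim bexE)
      have "{\<omega> \<in> space M. \<exists>\<alpha>\<in>{0..1}. \<bar>?F 0 n \<omega> \<alpha> - \<alpha>\<bar> > \<epsilon>} \<subseteq> ?A n \<union> B"
      proof (intro subsetI, rule ccontr)
        fix \<omega> assume *: "\<omega> \<in> {\<omega> \<in> space M. \<exists>\<alpha>\<in>{0..1}. \<bar>?F 0 n \<omega> \<alpha> - \<alpha>\<bar> > \<epsilon>}" "\<omega> \<notin> ?A n \<union> B"
        then obtain \<alpha> where \<alpha>: "\<alpha> \<in> {0..1}" "\<bar>?F 0 n \<omega> \<alpha> - \<alpha>\<bar> > \<epsilon>" by blast
        have "\<omega> \<in> space M - B" using * by blast
        then have "?F (- \<eta>) n \<omega> \<alpha> \<le> ?F 0 n \<omega> \<alpha> + \<epsilon> / 2 \<and> ?F 0 n \<omega> \<alpha> \<le> ?F \<eta> n \<omega> \<alpha> + \<epsilon> / 2"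
          using B2[THEN conjunct2] by blast
        moreover have "\<alpha> - \<epsilon> / 2 \<le> ?F (- \<eta>) n \<omega> \<alpha> \<and> ?F \<eta> n \<omega> \<alpha> \<le> \<alpha> + \<epsilon> / 2" using * \<alpha>(1) by blast
        ultimately show False using \<alpha>(2) by linarith
      qed
      with B1 B2[THEN conjunct1] show "\<exists>B\<in>sets M. prob B \<le> e \<and>
        {\<omega> \<in> space M. \<exists>\<alpha>\<in>{0..1}. \<bar>?F 0 n \<omega> \<alpha> - \<alpha>\<bar> > \<epsilon>} \<subseteq> ?A n \<union> B" by blast
    qed
  qed
qed

end

section \<open>The equivalences and the validity of the methods\<close>

context iid_array
begin

lemma asymp_equiv_fc_sc:
  assumes "conformity_scores Y p C" "\<And>\<eta>. \<eta> > 0 \<Longrightarrow> (\<lambda>n. instability C n \<eta>) \<longlonglongrightarrow> 0"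
  shows "asymp_equiv_methods M P t C (PS_fc Y C) (PS_sc Y C)"
  by (rule asymp_equiv_if_close[OF pvalue_of_fc[OF assms(1)] pvalue_of_sc[OF assms(1)]
        close_fc_sc[OF assms] inflation_continuous_sc[OF assms(1)]])

lemma asymp_equiv_cc_sc:
  assumes "conformity_scores Y p C" "\<And>\<eta>. \<eta> > 0 \<Longrightarrow> (\<lambda>n. instability C n \<eta>) \<longlonglongrightarrow> 0"
  shows "asymp_equiv_methods M P t C (PS_cc Y C) (PS_sc Y C)"
  by (rule asymp_equiv_if_close[OF pvalue_of_cc[OF assms(1)] pvalue_of_sc[OF assms(1)]
        close_cc_sc[OF assms] inflation_continuous_sc[OF assms(1)]])

lemma instability_prediction_tendsto_0:
  assumes A: "symmetric_algorithm Y p A" and s: "oos_stable M t A" and "\<eta> > 0"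
  shows "(\<lambda>n. instability (prediction A) n \<eta>) \<longlonglongrightarrow> 0"
proof (rule instability_tendsto_0[OF conformity_scores_prediction[OF A] _ \<open>\<eta> > 0\<close>])
  show "stable_scores M t (prediction A)"
    using s by (simp add: stable_scores_def oos_stable_def tendsto_zero_in_prob_def prediction_def)
qed

text \<open>By the triangle inequality, the absolute error changes by at most as much as the prediction.\<close>
lemma instability_oos_error_tendsto_0:
  assumes A: "symmetric_algorithm Y p A" and s: "oos_stable M t A" and "\<eta> > 0"
  shows "(\<lambda>n. instability (oos_error A) n \<eta>) \<longlonglongrightarrow> 0"
proof (rule tendsto_sandwich[OF _ _ tendsto_const instability_prediction_tendsto_0[OF assms]])
  show "\<forall>\<^sub>F n in sequentially. instability (oos_error A) n \<eta> \<le> instability (prediction A) n \<eta>"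
  proof (rule eventually_sequentiallyI[of 1])
    fix n :: nat assume n: "1 \<le> n"
    note D = conformity_scores_prediction[OF A] and ind = last_indices[OF n]
    let ?l = "\<lambda>\<omega>. score_all (prediction A) n (n + 1) (full_sample t n \<omega>)"
    let ?k = "\<lambda>\<omega>. score_but (prediction A) n (n + 1) n (full_sample t n \<omega>)"
    have [measurable]: "?l \<in> borel_measurable M" "?k \<in> borel_measurable M"
      by (rule measurable_compose[OF measurable_full_sample[OF n] measurable_score_all[OF D n ind(1)]]
        measurable_compose[OF measurable_full_sample[OF n] measurable_score_but[OF D n ind(1,2,4)]])+
    show "instability (oos_error A) n \<eta> \<le> instability (prediction A) n \<eta>"
      unfolding instability_def
    proof (rule finite_measure_mono)
      show "{\<omega> \<in> space M. \<bar>?l \<omega> - ?k \<omega>\<bar> > \<eta>} \<in> sets M" by measurable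
      have "\<bar>score_all (oos_error A) n (n + 1) w - score_but (oos_error A) n (n + 1) n w\<bar> \<le>
          \<bar>score_all (prediction A) n (n + 1) w - score_but (prediction A) n (n + 1) n w\<bar>" for w
        unfolding score_all_def score_but_def oos_error_eq by linarith
      then show "{\<omega> \<in> space M. \<bar>score_all (oos_error A) n (n + 1) (full_sample t n \<omega>) -
          score_but (oos_error A) n (n + 1) n (full_sample t n \<omega>)\<bar> > \<eta>} \<subseteq> {\<omega> \<in> space M. \<bar>?l \<omega> - ?k \<omega>\<bar> > \<eta>}"
        by (auto intro: less_le_trans)
    qed
  qed
qed (auto simp: instability_def intro!: always_eventually)

lemma asymp_equiv_sJ_plus_sc:
  assumes A: "symmetric_algorithm Y p A" and s: "oos_stable M t A"
  shows "asymp_equiv_methods M P t (oos_error A) (PI_sJ_plus Y A) (PS_sc Y (oos_error A))"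
  by (rule asymp_equiv_if_close[OF pvalue_of_sJ_plus[OF A] pvalue_of_sc[OF conformity_scores_oos_error[OF A]]
        close_sJ_plus_sc[OF A instability_prediction_tendsto_0[OF A s]]
        inflation_continuous_sc[OF conformity_scores_oos_error[OF A]]])

lemma oos_error_tight:
  assumes A: "symmetric_algorithm Y p A"
    and b: "stoch_bounded M (\<lambda>n \<omega>. ennreal \<bar>fst (t n (n + 1) \<omega>) - A n n (snd (t n (n + 1) \<omega>)) (training t n \<omega>)\<bar>)"
    and "e > 0"
  shows "\<exists>K. \<forall>n\<ge>1. prob {\<omega> \<in> space M. score_all (oos_error A) n (n + 1) (full_sample t n \<omega>) > K} \<le> e"
proof -
  let ?X = "\<lambda>n \<omega>. \<bar>fst (t n (n + 1) \<omega>) - A n n (snd (t n (n + 1) \<omega>)) (training t n \<omega>)\<bar>"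
  obtain K where K: "\<And>n. 1 \<le> n \<Longrightarrow> \<exists>B\<in>sets M. {\<omega> \<in> space M. ennreal (?X n \<omega>) > ennreal K} \<subseteq> B \<and> prob B \<le> e"
    using b \<open>e > 0\<close> unfolding stoch_bounded_def by meson
  have "prob {\<omega> \<in> space M. score_all (oos_error A) n (n + 1) (full_sample t n \<omega>) > max K 0} \<le> e" if n: "1 \<le> n" for n
  proof -
    obtain B where B: "B \<in> sets M" "{\<omega> \<in> space M. ennreal (?X n \<omega>) > ennreal K} \<subseteq> B" "prob B \<le> e"
      using K[OF n] by blast
    have "{\<omega> \<in> space M. score_all (oos_error A) n (n + 1) (full_sample t n \<omega>) > max K 0} \<subseteq> B"
    proof
      fix \<omega> assume \<omega>: "\<omega> \<in> {\<omega> \<in> space M. score_all (oos_error A) n (n + 1) (full_sample t n \<omega>) > max K 0}"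
      have w: "restrict (full_sample t n \<omega>) {1..n} = training t n \<omega>"
        "full_sample t n \<omega> (n + 1) = t n (n + 1) \<omega>"
        by (auto simp: full_sample_def training_def fun_eq_iff restrict_def)
      have "score_all (oos_error A) n (n + 1) (full_sample t n \<omega>) = ?X n \<omega>"
        using score_all_eq_restrict[OF conformity_scores_oos_error[OF A] n full_sample_space[OF n], of \<omega>] \<omega>
        unfolding w by (simp add: oos_error_def)
      then have "max K 0 < ?X n \<omega>" using \<omega> by simp
      then have "ennreal (max K 0) < ennreal (?X n \<omega>)" by (intro ennreal_lessI) auto
      moreover have "ennreal K \<le> ennreal (max K 0)" by (simp add: ennreal_leI)
      ultimately show "\<omega> \<in> B" using B(2) \<omega> by (auto intro: le_less_trans)
    qed
    then show ?thesis using finite_measure_mono[OF _ B(1)] B(3) by (meson order_trans)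
  qed
  then show ?thesis by blast
qed

end

lemma PI_sJ_eq_PS_sc: "PI_sJ Y A = PS_sc Y (oos_error A)"
  by (intro ext) (simp add: PI_sJ_def PS_sc_def oos_error_def loo_residual_def)

theorem corollary5p4:
  fixes M :: "'w measure"
    and Y :: "nat \<Rightarrow> real set"
    and p :: "nat \<Rightarrow> nat"
    and P :: "nat \<Rightarrow> point measure"
    and t :: "nat \<Rightarrow> nat \<Rightarrow> 'w \<Rightarrow> point"
  assumes setting: "iid_array M Y p P t"
  shows
    "(\<forall>C. conformity_scores Y p C \<and> stable_scores M t C \<longrightarrow>
        asymp_equiv_methods M P t C (PS_fc Y C) (PS_sc Y C) \<and>
        asymp_equiv_methods M P t C (PS_sc Y C) (PS_cc Y C))
   \<and> (\<forall>A. symmetric_algorithm Y p A \<and> oos_stable M t A \<longrightarrow>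
        asymp_equiv_methods M P t (oos_error A) (PI_sJ Y A) (PI_sJ_plus Y A))
   \<and> (\<forall>A C. symmetric_algorithm Y p A \<and> C = oos_error A \<longrightarrow>
        PI_sJ Y A = PS_sc Y C
        \<and> (oos_stable M t A \<longrightarrow>
            asymp_equiv_methods M P t C (PS_fc Y C) (PS_cc Y C) \<and>
            asymp_equiv_methods M P t C (PS_cc Y C) (PS_sc Y C) \<and>
            PS_sc Y C = PI_sJ Y A \<and>
            asymp_equiv_methods M P t C (PI_sJ Y A) (PI_sJ_plus Y A))
        \<and> (oos_stable M t A \<and>
            stoch_bounded M (\<lambda>n \<omega>.
              ennreal \<bar>fst (t n (n + 1) \<omega>) - A n n (snd (t n (n + 1) \<omega>)) (training t n \<omega>)\<bar>) \<longrightarrow>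
            (\<forall>PS \<in> {PS_fc Y C, PS_cc Y C, PI_sJ Y A, PI_sJ_plus Y A}.
              inflated_conservative M P t PS \<and>
              (CC M P t C \<longrightarrow> noninflated_valid M P t PS))))"
proof -
  interpret iid_array M Y p P t by (rule setting)
  have sJ: "asymp_equiv_methods M P t (oos_error A) (PI_sJ Y A) (PI_sJ_plus Y A)"
    if "symmetric_algorithm Y p A" "oos_stable M t A" for A
    unfolding PI_sJ_eq_PS_sc by (rule asymp_equiv_sym[OF asymp_equiv_sJ_plus_sc[OF that]])
  have fc: "asymp_equiv_methods M P t (oos_error A) (PS_fc Y (oos_error A)) (PS_sc Y (oos_error A))"
    and cc: "asymp_equiv_methods M P t (oos_error A) (PS_cc Y (oos_error A)) (PS_sc Y (oos_error A))"
    if "symmetric_algorithm Y p A" "oos_stable M t A" for A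
    using that by (auto intro!: asymp_equiv_fc_sc asymp_equiv_cc_sc conformity_scores_oos_error
        instability_oos_error_tendsto_0)
  have main: "inflated_conservative M P t PS \<and> (CC M P t (oos_error A) \<longrightarrow> noninflated_valid M P t PS)"
    if A: "symmetric_algorithm Y p A" "oos_stable M t A" and
      b: "stoch_bounded M (\<lambda>n \<omega>. ennreal \<bar>fst (t n (n + 1) \<omega>) - A n n (snd (t n (n + 1) \<omega>)) (training t n \<omega>)\<bar>)"
      and PS: "PS \<in> {PS_fc Y (oos_error A), PS_cc Y (oos_error A), PI_sJ Y A, PI_sJ_plus Y A}" for A PS
  proof -
    have nonneg: "0 \<le> oos_error A n m z T" for n m z T by (simp add: oos_error_def)
    note sc = sc_conservative_valid[OF conformity_scores_oos_error[OF A(1)]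
        instability_oos_error_tendsto_0[OF A] nonneg oos_error_tight[OF A(1) b]]
    show ?thesis
      using PS sc fc[OF A] cc[OF A] asymp_equiv_sJ_plus_sc[OF A]
      unfolding PI_sJ_eq_PS_sc asymp_equiv_methods_def by blast
  qed
  show ?thesis
  proof (intro conjI allI impI)
    fix C assume C: "conformity_scores Y p C \<and> stable_scores M t C"
    note stable = instability_tendsto_0[OF C[THEN conjunct1] C[THEN conjunct2]]
    show "asymp_equiv_methods M P t C (PS_fc Y C) (PS_sc Y C)"
      by (rule asymp_equiv_fc_sc[OF C[THEN conjunct1] stable])
    show "asymp_equiv_methods M P t C (PS_sc Y C) (PS_cc Y C)"
      by (rule asymp_equiv_sym[OF asymp_equiv_cc_sc[OF C[THEN conjunct1] stable]])
  next
    fix A assume "symmetric_algorithm Y p A \<and> oos_stable M t A"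
    then show "asymp_equiv_methods M P t (oos_error A) (PI_sJ Y A) (PI_sJ_plus Y A)" using sJ by blast
  next
    fix A C assume A: "symmetric_algorithm Y p A \<and> C = oos_error A"
    then show eq: "PI_sJ Y A = PS_sc Y C" by (simp add: PI_sJ_eq_PS_sc)
    then show "PS_sc Y C = PI_sJ Y A" ..
    {
      assume s: "oos_stable M t A"
      show "asymp_equiv_methods M P t C (PS_fc Y C) (PS_cc Y C)"
        using asymp_equiv_trans[OF fc asymp_equiv_sym[OF cc]] A s by blast
      show "asymp_equiv_methods M P t C (PS_cc Y C) (PS_sc Y C)" using cc A s by blast
      show "asymp_equiv_methods M P t C (PI_sJ Y A) (PI_sJ_plus Y A)" using sJ A s by blast
    }
    assume s: "oos_stable M t A \<and> stoch_bounded M (\<lambda>n \<omega>.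
      ennreal \<bar>fst (t n (n + 1) \<omega>) - A n n (snd (t n (n + 1) \<omega>)) (training t n \<omega>)\<bar>)"
    show "\<forall>PS \<in> {PS_fc Y C, PS_cc Y C, PI_sJ Y A, PI_sJ_plus Y A}. inflated_conservative M P t PS \<and>
        (CC M P t C \<longrightarrow> noninflated_valid M P t PS)"
      using main[of A] A s by blast
  qed
qed

end
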